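(* Let $(\varphi(t,x),\alpha(t))$, $t\in[0,T]$, be a path in the Virasoro-Bott group $\mathbb R\times_c\operatorname{Diff}_{\mathcal S}(\mathbb R)$. Let $U$ be a neighbourhood of $(\varphi,\alpha)$ in the space $\mathcal S([0,T]\times\mathbb R)\times C^\infty([0,T])$. Then there exists a path $(\psi,\beta)\in U$ with the same endpoints as $(\varphi,\alpha)$, i.e. $\psi(0,\cdot)=\varphi(0,\cdot)$, $\psi(T,\cdot)=\varphi(T,\cdot)$, $\beta(0)=\alpha(0)$, $\beta(T)=\alpha(T)$, and $$E(\psi,\beta)<E(\varphi,\alpha),$$ where $E$ is the energy of a path with respect to the right-invariant $L^2$-metric.
   Context: $T>0$. $\mathcal S(\mathbb R)$ is the space of rapidly decreasing smooth functions on $\mathbb R$, topologized by the seminorms $\sum_{i\le m}\|(1+|x|^2)^k\partial_x^i f\|_\infty$, $k,m\in\mathbb N$ (with $0\in\mathbb N$). $\operatorname{Diff}_{\mathcal S}(\mathbb R)$ is the group, under composition, of diffeomorphisms of $\mathbb R$ of the form $\operatorname{Id}+f$ with $f\in\mathcal S(\mathbb R)$; all its elements have positive derivative. The Bott cocycle is $c(\varphi,\psi)=\frac12\int_{\mathbb R}\log((\varphi\circ\psi)')\,d\log\psi'$. The Virasoro-Bott group $\mathbb R\times_c\operatorname{Diff}_{\mathcal S}(\mathbb R)$ is the set of pairs $(\varphi,\alpha)$ with $\varphi\in\operatorname{Diff}_{\mathcal S}(\mathbb R)$, $\alpha\in\mathbb R$, with multiplication $(\varphi,\alpha)(\psi,\beta)=(\varphi\circ\psi,\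 \alpha+\beta+c(\varphi,\psi))$ and inverse $(\varphi,\alpha)^{-1}=(\varphi^{-1},-\alpha)$. A path in the Virasoro-Bott group is a pair $(\varphi,\alpha)$ where $\alpha\in C^\infty([0,T])$ is real-valued and $\varphi:[0,T]\times\mathbb R\to\mathbb R$ is smooth with $\varphi(t,\cdot)\in\operatorname{Diff}_{\mathcal S}(\mathbb R)$ for every $t$ and $\varphi(t,x)-x\in\mathcal S([0,T]\times\mathbb R)$. The topology of $\mathcal S([0,T]\times\mathbb R)$ is given by the seminorms $$\|h\|_{\mathcal S^{k,m,n}}=\sum_{i\le m,\ j\le n}\|(1+|x|^2)^k\partial_x^i\partial_t^j h\|_\infty,\qquad k,m,n\in\mathbb N,$$ and that of $C^\infty([0,T])$ by the $C^n$-norms; paths are topologized via $(\varphi,\alpha)\mapsto(\varphi-x,\alpha)$, so closeness of paths is measured by $\|\psi-\varphi\|_{\mathcal S^{k,m,n}}+\|\beta-\alpha\|_{C^n}$. The energy of a path for the right-invariant $L^2$-metric is $$E(\varphi,\alpha)=\int_0^T\int_{\mathbb R}\varphi_t^2\varphi_x\,dx\,dt+\int_0^T\Big(\alpha_t-\int_{\mathbb R}\frac{\varphi_{tx}\varphi_{xx}}{\varphi_x^2}\,dx\Big)^2dt .$$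
   Formalization: The path (φ,α) is additionally assumed not to be constant in t; a constant path has E = 0 and E ≥ 0 for every path, so the claim fails exactly for constant paths. *)

theory Defs
  imports "HOL-Analysis.Analysis" "HOL-Algebra.Group"
begin

definition smooth_real :: "(real \<Rightarrow> real) \<Rightarrow> bool" where
  "smooth_real f \<longleftrightarrow> (\<forall>i. (deriv ^^ i) f differentiable_on UNIV)"

definition Schwartz_real :: "(real \<Rightarrow> real) set" where
  "Schwartz_real = {f. smooth_real f \<and>
     (\<forall>k i. bounded (range (\<lambda>x. (1 + \<bar>x\<bar>\<^sup>2) ^ k * (deriv ^^ i) f x)))}"

definition Diff_Schwartz :: "(real \<Rightarrow> real) set" where
  "Diff_Schwartz = {\<phi>. bij \<phi> \<and> smooth_real \<phi> \<and> smooth_real (inv_into UNIV \<phi>) \<and>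
     (\<lambda>x. \<phi> x - x) \<in> Schwartz_real}"

definition Bott_cocycle :: "(real \<Rightarrow> real) \<Rightarrow> (real \<Rightarrow> real) \<Rightarrow> real" where
  "Bott_cocycle \<phi> \<psi> =
     1/2 * (LINT x|lborel. ln (deriv (\<phi> \<circ> \<psi>) x) * deriv (\<lambda>y. ln (deriv \<psi> y)) x)"

definition Virasoro_Bott :: "((real \<Rightarrow> real) \<times> real) monoid" where
  "Virasoro_Bott =
     \<lparr>carrier = Diff_Schwartz \<times> UNIV,
      mult = (\<lambda>(\<phi>, \<alpha>) (\<psi>, \<beta>). (\<phi> \<circ> \<psi>, \<alpha> + \<beta> + Bott_cocycle \<phi> \<psi>)),
      one = (id, 0)\<rparr>"

text \<open>Derivatives in time are taken within \<open>[0,T]\<close>, hence one-sided at \<open>0\<close> and \<open>T\<close>.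
  Functions on \<open>[0,T]\<close> and on \<open>[0,T] \<times> \<real>\<close> are represented by total functions whose values
  for \<open>t\<close> outside \<open>[0,T]\<close> are irrelevant: for \<open>T > 0\<close> no predicate, norm, open set or
  energy below depends on them.\<close>

definition dt :: "real \<Rightarrow> (real \<Rightarrow> real) \<Rightarrow> real \<Rightarrow> real" where
  "dt T f t = vector_derivative f (at t within {0..T})"

definition smooth_Icc :: "real \<Rightarrow> (real \<Rightarrow> real) set" where
  "smooth_Icc T = {f. \<forall>j. (dt T ^^ j) f differentiable_on {0..T}}"

definition Cn_norm :: "real \<Rightarrow> nat \<Rightarrow> (real \<Rightarrow> real) \<Rightarrow> real" where
  "Cn_norm T n f = (\<Sum>j\<le>n. SUP t\<in>{0..T}. \<bar>(dt T ^^ j) f t\<bar>)"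

definition smooth_Icc_topology :: "real \<Rightarrow> (real \<Rightarrow> real) topology" where
  "smooth_Icc_topology T = topology_generated_by
     {{g \<in> smooth_Icc T. Cn_norm T n (\<lambda>t. g t - f t) < \<epsilon>} | f n \<epsilon>.
        f \<in> smooth_Icc T \<and> \<epsilon> > 0}"

definition pd_t :: "real \<Rightarrow> (real \<Rightarrow> real \<Rightarrow> real) \<Rightarrow> real \<Rightarrow> real \<Rightarrow> real" where
  "pd_t T h t x = dt T (\<lambda>s. h s x) t"

definition pd_x :: "(real \<Rightarrow> real \<Rightarrow> real) \<Rightarrow> real \<Rightarrow> real \<Rightarrow> real" where
  "pd_x h t x = deriv (h t) x"

definition pd :: "real \<Rightarrow> nat \<Rightarrow> nat \<Rightarrow> (real \<Rightarrow> real \<Rightarrow> real) \<Rightarrow> real \<Rightarrow> real \<Rightarrow> real" where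
  "pd T i j h = (pd_x ^^ i) ((pd_t T ^^ j) h)"

text \<open>Joint (Frechet) differentiability on the closed strip of all the derivatives
  \<open>\<partial>\<^sub>x\<^sup>i \<partial>\<^sub>t\<^sup>j h\<close> makes all of them exist and be jointly continuous; mixed
  derivatives taken in any other order then exist too and agree with these.\<close>

definition smooth_strip :: "real \<Rightarrow> (real \<Rightarrow> real \<Rightarrow> real) \<Rightarrow> bool" where
  "smooth_strip T h \<longleftrightarrow>
     (\<forall>i j. (\<lambda>(t, x). pd T i j h t x) differentiable_on ({0..T} \<times> UNIV))"

definition Schwartz_strip :: "real \<Rightarrow> (real \<Rightarrow> real \<Rightarrow> real) set" where
  "Schwartz_strip T = {h. smooth_strip T h \<and>
     (\<forall>k i j. bounded ((\<lambda>(t, x). (1 + \<bar>x\<bar>\<^sup>2) ^ k * pd T i j h t x) ` ({0..T} \<times> UNIV)))}"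

definition Schwartz_norm :: "real \<Rightarrow> nat \<Rightarrow> nat \<Rightarrow> nat \<Rightarrow> (real \<Rightarrow> real \<Rightarrow> real) \<Rightarrow> real" where
  "Schwartz_norm T k m n h =
     (\<Sum>i\<le>m. \<Sum>j\<le>n. SUP (t, x)\<in>{0..T} \<times> UNIV. \<bar>(1 + \<bar>x\<bar>\<^sup>2) ^ k * pd T i j h t x\<bar>)"

definition Schwartz_strip_topology :: "real \<Rightarrow> (real \<Rightarrow> real \<Rightarrow> real) topology" where
  "Schwartz_strip_topology T = topology_generated_by
     {{g \<in> Schwartz_strip T. Schwartz_norm T k m n (\<lambda>t x. g t x - h t x) < \<epsilon>} | h k m n \<epsilon>.
        h \<in> Schwartz_strip T \<and> \<epsilon> > 0}"

definition Virasoro_Bott_path ::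
    "real \<Rightarrow> (real \<Rightarrow> real \<Rightarrow> real) \<Rightarrow> (real \<Rightarrow> real) \<Rightarrow> bool" where
  "Virasoro_Bott_path T \<phi> \<alpha> \<longleftrightarrow>
     \<alpha> \<in> smooth_Icc T \<and> smooth_strip T \<phi> \<and>
     (\<forall>t\<in>{0..T}. (\<phi> t, \<alpha> t) \<in> carrier Virasoro_Bott) \<and>
     (\<lambda>t x. \<phi> t x - x) \<in> Schwartz_strip T"

text \<open>Paths are topologized as pairs \<open>(\<phi> - x, \<alpha>)\<close>.\<close>

definition path_coords ::
    "(real \<Rightarrow> real \<Rightarrow> real) \<Rightarrow> (real \<Rightarrow> real) \<Rightarrow> (real \<Rightarrow> real \<Rightarrow> real) \<times> (real \<Rightarrow> real)" where
  "path_coords \<phi> \<alpha> = (\<lambda>t x. \<phi> t x - x, \<alpha>)"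

definition path_topology ::
    "real \<Rightarrow> ((real \<Rightarrow> real \<Rightarrow> real) \<times> (real \<Rightarrow> real)) topology" where
  "path_topology T = prod_topology (Schwartz_strip_topology T) (smooth_Icc_topology T)"

definition energy :: "real \<Rightarrow> (real \<Rightarrow> real \<Rightarrow> real) \<Rightarrow> (real \<Rightarrow> real) \<Rightarrow> real" where
  "energy T \<phi> \<alpha> =
     (LINT t:{0..T}|lborel. LINT x|lborel. (pd_t T \<phi> t x)\<^sup>2 * pd_x \<phi> t x) +
     (LINT t:{0..T}|lborel.
        (dt T \<alpha> t -
         (LINT x|lborel. pd_x (pd_t T \<phi>) t x * pd_x (pd_x \<phi>) t x / (pd_x \<phi> t x)\<^sup>2))\<^sup>2)"

end

theory Submission
  imports Defs "HOL-Probability.Sinc_Integral"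
begin

text \<open>Put \<open>w(t) = \<alpha>\<^sub>t - \<integral> \<phi>\<^sub>t\<^sub>x \<phi>\<^sub>x\<^sub>x / \<phi>\<^sub>x\<^sup>2 dx\<close>, so that the central part of the energy is \<open>\<integral> w\<^sup>2 dt\<close>.
  If \<open>w\<close> is not constant, a perturbation of \<open>\<alpha>\<close> alone decreases the energy to first order.
  If \<open>w\<close> is constant, leave \<open>\<alpha>\<close> fixed and perturb \<open>\<phi>\<close> to \<open>\<phi> + e h\<close>: the sign of \<open>e\<close> takes care of
  the first variation, so a negative second variation suffices. For a narrow travelling bump
  \<open>h = A(t) b(n (x - v t) + c)\<close> with \<open>n\<close> large, the leading term of the second variation is
  \<open>2 w v n\<^sup>4 \<integral>\<integral> (A b'' / \<phi>\<^sub>x)\<^sup>2\<close> if \<open>w \<noteq> 0\<close>, and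
  \<open>n\<^sup>2 \<integral>\<integral> (v\<^sup>2 \<phi>\<^sub>x - 2 v \<phi>\<^sub>t) (A b')\<^sup>2\<close> if \<open>w = 0\<close>; a suitable velocity \<open>v\<close> makes it negative,
  provided in the second case that \<open>A\<close> is concentrated where \<open>\<phi>\<^sub>t \<noteq> 0\<close>.
  If \<open>w = 0\<close> and \<open>\<phi>\<^sub>t = 0\<close> everywhere, the path is constant.\<close>

subsection \<open>Smooth functions of one variable\<close>

text \<open>When \<open>w\<close> is constant the path may be critical, for instance a geodesic, so
  that the first variation tells nothing. What decides is a competition of powers of
  \<open>n\<close>: a bump of frequency \<open>n\<close> has support of width of order
  \<open>1/n\<close>, and each derivative of it costs a factor \<open>n\<close>. The product
  \<open>h_tx * h_xx\<close>, of order \<open>n^4\<close>, thus integrates to order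
  \<open>n^3\<close>, and \<open>v\<close> chooses its sign because \<open>h_tx\<close> is about
  \<open>- v * h_xx\<close>. Against it stand the kinetic part, of order \<open>n\<close>, and the
  squared first variation of the cocycle integral, of order \<open>n^2\<close> by a crude bound;
  both are harmless. For \<open>w = 0\<close> the product drops out, the kinetic part has to win at
  order \<open>n\<close>, and the crude bound is too weak: an integration by parts lowers that
  square to order 1. The kinetic coefficient is quadratic in \<open>v\<close> without constant term,
  so for small \<open>v\<close> its linear part decides the sign. A constant path has energy 0, the
  least possible value, which is why it has to be excluded.\<close>

lemma smooth_real_coinduct:
  assumes "f \<in> S"
    and "\<And>g. g \<in> S \<Longrightarrow> \<exists>g'\<in>S. \<forall>x. (g has_real_derivative g' x) (at x)"
  shows "smooth_real f"
proof -
  have *: "g differentiable_on UNIV \<and> deriv g \<in> S" if gS: "g \<in> S" for g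
  proof -
    obtain g' where g': "g' \<in> S" "\<And>x. (g has_real_derivative g' x) (at x)"
      using assms(2)[OF gS] by blast
    have "deriv g = g'"
      using g'(2) by (auto intro!: ext DERIV_imp_deriv)
    moreover have "g differentiable_on UNIV"
      using g'(2) by (auto simp: differentiable_on_def simp: real_differentiable_def)
    ultimately show ?thesis using g' by simp
  qed
  \<comment> \<open>Iterated derivatives never leave \<open>S\<close>, so no formula for the
    \<open>i\<close>-th derivative is needed.\<close>
  have "(deriv ^^ i) f \<in> S" for i
    by (induction i) (use assms(1) * in auto)
  then show ?thesis
    using * by (simp add: smooth_real_def)
qed

text \<open>Sum and product rules extend closure under differentiation from the generators to this
  algebra, so smoothness of a concrete function reduces to differentiating a few generators
  once.\<close>

inductive_set gen_alg :: "(real \<Rightarrow> real) set \<Rightarrow> (real \<Rightarrow> real) set" for B where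
  base: "f \<in> B \<Longrightarrow> f \<in> gen_alg B"
| const: "(\<lambda>_. c) \<in> gen_alg B"
| add: "f \<in> gen_alg B \<Longrightarrow> g \<in> gen_alg B \<Longrightarrow> (\<lambda>x. f x + g x) \<in> gen_alg B"
| mult: "f \<in> gen_alg B \<Longrightarrow> g \<in> gen_alg B \<Longrightarrow> (\<lambda>x. f x * g x) \<in> gen_alg B"

lemma gen_alg_smooth:
  assumes B: "\<And>g. g \<in> B \<Longrightarrow> \<exists>g'\<in>gen_alg B. \<forall>x. (g has_real_derivative g' x) (at x)"
    and "f \<in> gen_alg B"
  shows "smooth_real f"
proof (rule smooth_real_coinduct[of _ "gen_alg B"])
  fix g assume "g \<in> gen_alg B"
  then show "\<exists>g'\<in>gen_alg B. \<forall>x. (g has_real_derivative g' x) (at x)"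
  proof induction
    case (base f)
    then show ?case by (rule B)
  next
    case (const c)
    then show ?case by (intro bexI[of _ "\<lambda>_. 0"]) (auto intro: gen_alg.const)
  next
    case (add f g)
    then obtain f' g' where "f' \<in> gen_alg B" "g' \<in> gen_alg B"
      "\<forall>x. (f has_real_derivative f' x) (at x)" "\<forall>x. (g has_real_derivative g' x) (at x)"
      by blast
    then show ?case
      by (intro bexI[of _ "\<lambda>x. f' x + g' x"]) (auto intro!: gen_alg.add derivative_eq_intros)
  next
    case (mult f g)
    then obtain f' g' where *: "f' \<in> gen_alg B" "g' \<in> gen_alg B"
      "\<forall>x. (f has_real_derivative f' x) (at x)" "\<forall>x. (g has_real_derivative g' x) (at x)"
      by blast
    have "(\<lambda>x. f' x * g x + f x * g' x) \<in> gen_alg B"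
      by (intro gen_alg.add gen_alg.mult * mult)
    with * show ?case
      by (intro bexI[of _ "\<lambda>x. f' x * g x + f x * g' x"]) (auto intro!: derivative_eq_intros)
  qed
qed fact

lemma smooth_real_DERIV:
  "smooth_real f \<Longrightarrow> ((deriv ^^ i) f has_real_derivative (deriv ^^ Suc i) f x) (at x)"
  by (auto simp: smooth_real_def differentiable_on_def DERIV_deriv_iff_real_differentiable)

lemma smooth_real_continuous: "smooth_real f \<Longrightarrow> continuous_on A ((deriv ^^ i) f)"
  by (meson smooth_real_DERIV DERIV_continuous continuous_at_imp_continuous_on)

lemma smooth_real_affine:
  assumes "smooth_real f"
  shows "smooth_real (\<lambda>x. f (a * x + b))"
proof (rule gen_alg_smooth)
  let ?B = "{\<lambda>x. (deriv ^^ i) f (a * x + b) |i. True}"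
  show "(\<lambda>x. f (a * x + b)) \<in> gen_alg ?B"
    by (rule gen_alg.base) (auto intro!: exI[of _ 0])
  fix g assume "g \<in> ?B"
  then obtain i where i: "g = (\<lambda>x. (deriv ^^ i) f (a * x + b))" by blast
  have "(\<lambda>x. a * (deriv ^^ Suc i) f (a * x + b)) \<in> gen_alg ?B"
    by (rule gen_alg.mult[OF gen_alg.const gen_alg.base]) blast
  moreover have "(g has_real_derivative a * (deriv ^^ Suc i) f (a * x + b)) (at x)" for x
    unfolding i by (rule DERIV_chain'[OF _ smooth_real_DERIV[OF assms], THEN DERIV_cong])
      (auto intro!: derivative_eq_intros)
  ultimately show "\<exists>g'\<in>gen_alg ?B. \<forall>x. (g has_real_derivative g' x) (at x)"
    by (intro bexI[of _ "\<lambda>x. a * (deriv ^^ Suc i) f (a * x + b)"]) auto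
qed

lemma smooth_real_poly: "smooth_real (\<lambda>x. \<Sum>i\<le>n. a i * x ^ i)"
proof (rule gen_alg_smooth)
  let ?B = "{\<lambda>x::real. x}"
  have "(\<lambda>x. a i * x ^ i) \<in> gen_alg ?B" for i
  proof -
    have "(\<lambda>x::real. x ^ i) \<in> gen_alg ?B"
      by (induction i) (auto intro: gen_alg.intros)
    then show ?thesis by (intro gen_alg.mult gen_alg.const)
  qed
  note monom = this
  show "(\<lambda>x. \<Sum>i\<le>n. a i * x ^ i) \<in> gen_alg ?B"
    by (induction n) (use monom[of 0] in \<open>auto intro: gen_alg.add monom simp del: power_Suc\<close>)
  fix g assume "g \<in> ?B"
  then show "\<exists>g'\<in>gen_alg ?B. \<forall>x. (g has_real_derivative g' x) (at x)"
    by (intro bexI[of _ "\<lambda>_. 1"]) (auto intro: gen_alg.const)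
qed

text \<open>The derivative of the inverse is the reciprocal of \<open>f'\<close> at the inverse, and
  the derivative of that reciprocal is \<open>- f''\<close> at the inverse times its cube. Together
  with all derivatives of \<open>f\<close> at the inverse, these generators are closed under
  differentiation up to products.\<close>

lemma smooth_real_inv:
  assumes smooth: "smooth_real f" and pos: "\<And>x. deriv f x > 0" and "bij f"
  shows "smooth_real (inv_into UNIV f)"
proof (rule gen_alg_smooth)
  let ?g = "inv_into UNIV f"
  let ?r = "\<lambda>x. inverse (deriv f (?g x))"
  let ?B = "{?g, ?r} \<union> {\<lambda>x. (deriv ^^ i) f (?g x) |i. True}"
  have fg: "f (?g x) = x" "?g (f x) = x" for x
    using \<open>bij f\<close> by (simp_all add: bij_is_surj surj_f_inv_f bij_is_inj)
  have dg: "(?g has_real_derivative ?r x) (at x)" for x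
  proof -
    have d: "(f has_real_derivative deriv f y) (at y)" for y
      using smooth_real_DERIV[OF smooth, of 0] by simp
    have "isCont ?g (f (?g x))"
      by (rule isCont_inverse_function[where d=1 and f=f])
         (use d fg in \<open>auto intro: DERIV_isCont\<close>)
    then show ?thesis
      using DERIV_inverse_function[of f "deriv f (?g x)" ?g x "x - 1" "x + 1"] d pos[of "?g x"] fg
      by simp
  qed
  have r: "?r \<in> gen_alg ?B" by (rule gen_alg.base) simp
  have D: "(\<lambda>x. (deriv ^^ i) f (?g x)) \<in> gen_alg ?B" for i
    by (rule gen_alg.base) blast
  show "?g \<in> gen_alg ?B" by (rule gen_alg.base) simp
  fix h assume "h \<in> ?B"
  then consider "h = ?g" | "h = ?r" | i where "h = (\<lambda>x. (deriv ^^ i) f (?g x))" by blast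
  then show "\<exists>h'\<in>gen_alg ?B. \<forall>x. (h has_real_derivative h' x) (at x)"
  proof cases
    case 1
    with dg r show ?thesis by (intro bexI[of _ ?r]) auto
  next
    case 2
    have "(h has_real_derivative (- 1) * ((deriv ^^ 2) f (?g x) * (?r x * (?r x * ?r x)))) (at x)" for x
    proof -
      have "((\<lambda>x. deriv f (?g x)) has_real_derivative (deriv ^^ 2) f (?g x) * ?r x) (at x)"
        using DERIV_chain2[OF smooth_real_DERIV[OF smooth, of 1] dg[of x]]
        by (simp add: numeral_2_eq_2)
      from DERIV_inverse_fun[OF this] pos[of "?g x"] show ?thesis
        unfolding 2 by (simp add: field_simps)
    qed
    moreover have "(\<lambda>x. (- 1) * ((deriv ^^ 2) f (?g x) * (?r x * (?r x * ?r x)))) \<in> gen_alg ?B"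
      by (intro gen_alg.mult gen_alg.const r D)
    ultimately show ?thesis by (intro bexI[of _ "\<lambda>x. (- 1) * ((deriv ^^ 2) f (?g x) * (?r x * (?r x * ?r x)))"] allI)
  next
    case 3
    have "(h has_real_derivative (deriv ^^ Suc i) f (?g x) * ?r x) (at x)" for x
      unfolding 3 by (rule DERIV_chain2[OF smooth_real_DERIV[OF smooth] dg])
    then show ?thesis
      by (intro bexI[OF _ gen_alg.mult[OF D[of "Suc i"] r]] allI)
  qed
qed

section \<open>A smooth bump supported in \<open>[-1, 1]\<close>\<close>

definition flat_exp :: "nat \<Rightarrow> real \<Rightarrow> real" where
  "flat_exp n x = (if x > 0 then inverse x ^ n * exp (- inverse x) else 0)"

text \<open>In the variable \<open>y = 1/x\<close> this is the decay of \<open>y ^ n / exp y\<close>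
  at infinity.\<close>

lemma flat_exp_at_right_0: "(flat_exp n \<longlongrightarrow> 0) (at_right 0)"
proof -
  have "((\<lambda>x. x ^ n / exp x) \<longlongrightarrow> 0) (at_top :: real filter)"
    by (rule tendsto_power_div_exp_0)
  then have "((\<lambda>x. inverse x ^ n / exp (inverse x)) \<longlongrightarrow> 0) (at_right (0::real))"
    by (rule filterlim_compose[OF _ filterlim_inverse_at_top_right])
  then show ?thesis
    by (rule Lim_transform_eventually)
       (auto simp: flat_exp_def eventually_at_filter exp_minus divide_inverse)
qed

text \<open>The powers of \<open>inverse x\<close> are part of \<open>flat_exp\<close> because
  differentiating \<open>exp (- inverse x)\<close> produces them: the family indexed by
  \<open>n\<close> is closed under differentiation.\<close>

lemma DERIV_flat_exp:
  "(flat_exp n has_real_derivative - real n * flat_exp (Suc n) x + flat_exp (n + 2) x) (at x)"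
proof -
  consider "x > 0" | "x < 0" | "x = 0" by linarith
  then show ?thesis
  proof cases
    case 1
    have "((\<lambda>x. inverse x ^ n * exp (- inverse x)) has_real_derivative
        - real n * flat_exp (Suc n) x + flat_exp (n + 2) x) (at x)"
      using 1 by (cases n) (auto intro!: derivative_eq_intros simp: flat_exp_def field_simps power2_eq_square,
        metis Suc_pred neq0_conv power_Suc)
    then show ?thesis
      by (rule DERIV_cong_ev[THEN iffD1, rotated -1])
         (use 1 in \<open>auto simp: flat_exp_def eventually_nhds intro!: exI[of _ "{0<..}"]\<close>)
  next
    case 2
    have "((\<lambda>x. 0) has_real_derivative - real n * flat_exp (Suc n) x + flat_exp (n + 2) x) (at x)"
      using 2 by (auto simp: flat_exp_def)
    then show ?thesis
      by (rule DERIV_cong_ev[THEN iffD1, rotated -1])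
         (use 2 in \<open>auto simp: flat_exp_def eventually_nhds intro!: exI[of _ "{..<0}"]\<close>)
  next
    case 3
    \<comment> \<open>For \<open>h > 0\<close> the difference quotient at 0 is
      \<open>flat_exp (Suc n) h\<close>, which tends to 0.\<close>
    have "((\<lambda>h. flat_exp n h / h) \<longlongrightarrow> 0) (at_right 0)"
      by (rule Lim_transform_eventually[OF flat_exp_at_right_0[of "Suc n"]])
         (auto simp: flat_exp_def eventually_at_filter divide_inverse)
    moreover have "((\<lambda>h. flat_exp n h / h) \<longlongrightarrow> 0) (at_left 0)"
      by (rule Lim_transform_eventually[OF tendsto_const[of 0]])
         (auto simp: flat_exp_def eventually_at_filter)
    ultimately have "((\<lambda>h. flat_exp n h / h) \<longlongrightarrow> 0) (at 0)"
      by (simp add: filterlim_split_at)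
    then show ?thesis
      using 3 by (simp add: DERIV_def flat_exp_def)
  qed
qed

definition bump :: "real \<Rightarrow> real" where
  "bump x = flat_exp 0 (1 - x) * flat_exp 0 (1 + x)"

lemma smooth_bump: "smooth_real bump"
proof (rule gen_alg_smooth)
  \<comment> \<open>Varying \<open>c\<close> covers both factors \<open>1 - x\<close> and
    \<open>1 + x\<close>; varying \<open>n\<close> makes the generators closed under
    differentiation.\<close>
  let ?B = "{\<lambda>x. flat_exp n (1 + c * x) |n c. True}"
  have B: "(\<lambda>x. flat_exp n (1 + c * x)) \<in> gen_alg ?B" for n c
    by (rule gen_alg.base) blast
  have eq: "bump = (\<lambda>x. flat_exp 0 (1 + (- 1) * x) * flat_exp 0 (1 + 1 * x))"
    by (simp add: bump_def fun_eq_iff)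
  show "bump \<in> gen_alg ?B"
    unfolding eq by (rule gen_alg.mult[OF B B])
  fix g assume "g \<in> ?B"
  then obtain n c where g: "g = (\<lambda>x. flat_exp n (1 + c * x))" by blast
  let ?g' = "\<lambda>x. c * (- real n * flat_exp (Suc n) (1 + c * x) + flat_exp (n + 2) (1 + c * x))"
  have "(g has_real_derivative ?g' x) (at x)" for x
    unfolding g by (rule DERIV_chain'[OF _ DERIV_flat_exp, THEN DERIV_cong])
      (auto intro!: derivative_eq_intros)
  moreover have "?g' \<in> gen_alg ?B"
    by (intro gen_alg.add gen_alg.mult gen_alg.const B)
  ultimately show "\<exists>g'\<in>gen_alg ?B. \<forall>x. (g has_real_derivative g' x) (at x)" by (intro bexI[of _ ?g']) auto
qed

lemma bump_0: "bump 0 > 0"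
  by (simp add: bump_def flat_exp_def)

text \<open>The strict inequality defines an open set, so near each of its points the function is
  locally 0 and derivatives cannot see anything else.\<close>

lemma deriv_funpow_eq_0_outside:
  assumes "\<And>x. \<bar>x\<bar> > R \<Longrightarrow> f x = (0::real)"
  shows "\<bar>x\<bar> > R \<Longrightarrow> (deriv ^^ i) f x = 0"
proof (induction i arbitrary: x)
  case (Suc i)
  have "\<forall>\<^sub>F y in nhds x. \<bar>y\<bar> > R"
    using Suc.prems by (auto simp: eventually_nhds intro!: exI[of _ "{y. \<bar>y\<bar> > R}"] open_Collect_less continuous_intros)
  then have "\<forall>\<^sub>F y in nhds x. (deriv ^^ i) f y = (\<lambda>_. 0) y"
    by eventually_elim (use Suc.IH in auto)
  then have "deriv ((deriv ^^ i) f) x = deriv (\<lambda>_. 0) x"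
    by (rule deriv_cong_ev) simp
  then show ?case by simp
qed (use assms in auto)

lemma bump_eq_0: "\<bar>x\<bar> \<ge> 1 \<Longrightarrow> bump x = 0"
  by (auto simp: bump_def flat_exp_def)

lemma deriv_bump_eq_0: "\<bar>x\<bar> > 1 \<Longrightarrow> (deriv ^^ i) bump x = 0"
  by (rule deriv_funpow_eq_0_outside[where R=1]) (auto simp: bump_eq_0)

text \<open>If a derivative vanished identically, the one before it would be constant, hence 0 by
  its value outside the support, and so on down to \<open>bump 0 > 0\<close>. This gives positive
  leading coefficients later.\<close>

lemma deriv_bump_nonzero: "\<exists>x. (deriv ^^ i) bump x \<noteq> 0"
proof (induction i)
  case 0
  then show ?case using bump_0 by (auto intro!: exI[of _ 0])
next
  case (Suc i)
  show ?case
  proof (rule ccontr)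
    assume "\<nexists>x. (deriv ^^ Suc i) bump x \<noteq> 0"
    then have "\<forall>x. ((deriv ^^ i) bump has_real_derivative 0) (at x)"
      using smooth_real_DERIV[OF smooth_bump, of i] by auto
    then have "(deriv ^^ i) bump x = (deriv ^^ i) bump 2" for x
      by (rule DERIV_isconst_all)
    with deriv_bump_eq_0[of 2 i] Suc show False by auto
  qed
qed

lemma continuous_vanishing_outside_bounded:
  fixes f :: "real \<Rightarrow> real"
  assumes "continuous_on UNIV f" "\<And>x. \<bar>x\<bar> > R \<Longrightarrow> f x = (0::real)"
  obtains M where "M > 0" "\<And>x. \<bar>f x\<bar> \<le> M"
proof -
  have "bounded (f ` {-R..R})"
    by (intro compact_imp_bounded compact_continuous_image continuous_on_subset[OF assms(1)]) auto
  then obtain M where M: "\<forall>x\<in>{-R..R}. \<bar>f x\<bar> \<le> M"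
    by (auto simp: bounded_iff)
  show ?thesis
  proof
    show "max M 1 > 0" by simp
    show "\<bar>f x\<bar> \<le> max M 1" for x
    proof (cases "\<bar>x\<bar> > R")
      case False
      then show ?thesis using bspec[OF M, of x] by (simp add: abs_le_iff) linarith
    qed (use assms(2) in auto)
  qed
qed

subsection \<open>Derivatives on the strip\<close>

abbreviation strip :: "real \<Rightarrow> (real \<times> real) set" where
  "strip T \<equiv> {0..T} \<times> UNIV"

text \<open>A nondegenerate interval makes the derivative within it unique even at the endpoints, so
  \<open>dt\<close> can be read off from any derivative that has been found.\<close>

lemma dt_eqI:
  assumes "T > 0" "t \<in> {0..T}" "(f has_vector_derivative f') (at t within {0..T})"
  shows "dt T f t = f'"
  using vector_derivative_within_cbox[of 0 T t f f'] assms by (simp add: dt_def)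

lemma has_vector_derivative_dt:
  assumes "f differentiable_on {0..T}" "t \<in> {0..T}"
  shows "(f has_vector_derivative dt T f t) (at t within {0..T})"
  using assms by (simp add: dt_def differentiable_on_def vector_derivative_works[symmetric])

lemma differentiable_on_strip_t:
  assumes "(\<lambda>(t, x). g t x) differentiable_on strip T"
  shows "(\<lambda>s. g s x) differentiable_on {0..T}"
proof -
  have "(\<lambda>s. (\<lambda>(t, x). g t x) (s, x)) differentiable_on {0..T}"
  proof (rule differentiable_on_compose[where g="\<lambda>s. (s, x)" and f="\<lambda>(t, x). g t x"])
    show "(\<lambda>s. (s, x)) differentiable_on {0..T}"
      by (auto intro!: derivative_intros simp: differentiable_on_def)
  qed (auto intro: differentiable_on_subset[OF assms])
  then show ?thesis by simp
qed

lemma differentiable_on_strip_x: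
  assumes "(\<lambda>(t, x). g t x) differentiable_on strip T" "t \<in> {0..T}"
  shows "g t differentiable_on UNIV"
proof -
  have "(\<lambda>x. (\<lambda>(t, x). g t x) (t, x)) differentiable_on UNIV"
  proof (rule differentiable_on_compose[where g="\<lambda>x. (t, x)" and f="\<lambda>(t, x). g t x"])
    show "(\<lambda>x. (t, x)) differentiable_on UNIV"
      by (auto intro!: derivative_intros simp: differentiable_on_def)
  qed (use assms(2) in \<open>auto intro: differentiable_on_subset[OF assms(1)]\<close>)
  then show ?thesis by simp
qed

lemma pd_0_Suc: "pd T 0 (Suc j) h t x = dt T (\<lambda>s. pd T 0 j h s x) t"
  by (simp add: pd_def pd_t_def)

lemma pd_Suc: "pd T (Suc i) j h t x = deriv (pd T i j h t) x"
  by (simp add: pd_def pd_x_def)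

lemma pd_i_0: "pd T i 0 h t = (deriv ^^ i) (h t)"
proof (induction i)
  case (Suc i)
  then show ?case by (auto simp: pd_Suc)
qed (simp add: pd_def)

lemma smooth_strip_continuous:
  "smooth_strip T h \<Longrightarrow> continuous_on (strip T) (\<lambda>(t, x). pd T i j h t x)"
  unfolding smooth_strip_def by (blast intro: differentiable_imp_continuous_on)

lemma smooth_strip_has_derivative_t:
  assumes "smooth_strip T h" "t \<in> {0..T}"
  shows "((\<lambda>s. pd T 0 j h s x) has_vector_derivative pd T 0 (Suc j) h t x) (at t within {0..T})"
  unfolding pd_0_Suc
  by (rule has_vector_derivative_dt[OF differentiable_on_strip_t])
     (use assms in \<open>auto simp: smooth_strip_def\<close>)

lemma smooth_strip_has_derivative_x:
  assumes "smooth_strip T h" "t \<in> {0..T}"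
  shows "(pd T i j h t has_real_derivative pd T (Suc i) j h t x) (at x)"
proof -
  have "pd T i j h t differentiable_on UNIV"
    using assms by (intro differentiable_on_strip_x[of _ T]) (auto simp: smooth_strip_def)
  then show ?thesis
    by (simp add: pd_Suc DERIV_deriv_iff_real_differentiable differentiable_on_def)
qed

text \<open>Identifies all \<open>pd T i j h\<close> at once with a family of candidates
  \<open>D\<close>. As \<open>pd\<close> takes the time derivatives first, the time equations are
  needed only for \<open>i = 0\<close>.\<close>

lemma pd_eqI:
  assumes "T > 0"
    and t: "\<And>j t x. t \<in> {0..T} \<Longrightarrow>
      ((\<lambda>s. D 0 j s x) has_vector_derivative D 0 (Suc j) t x) (at t within {0..T})"
    and x: "\<And>i j t x. t \<in> {0..T} \<Longrightarrow> (D i j t has_real_derivative D (Suc i) j t x) (at x)"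
    and h: "\<And>t x. t \<in> {0..T} \<Longrightarrow> h t x = D 0 0 t x"
    and "t \<in> {0..T}"
  shows "pd T i j h t x = D i j t x"
proof -
  have j: "pd T 0 j h t x = D 0 j t x" if "t \<in> {0..T}" for t x j
    using that
  proof (induction j arbitrary: t x)
    case 0
    then show ?case using h by (simp add: pd_def)
  next
    case (Suc j)
    have "((\<lambda>s. pd T 0 j h s x) has_vector_derivative D 0 (Suc j) t x) (at t within {0..T})"
      by (rule has_vector_derivative_transform[OF \<open>t \<in> {0..T}\<close> _ t]) (use Suc in auto)
    then show ?case
      unfolding pd_0_Suc by (rule dt_eqI[OF \<open>T > 0\<close> \<open>t \<in> {0..T}\<close>])
  qed
  show ?thesis
  proof (induction i arbitrary: x)
    case 0
    then show ?case using j assms by blast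
  next
    case (Suc i)
    then have "pd T i j h t = D i j t" by blast
    then show ?case
      unfolding pd_Suc using x[OF \<open>t \<in> {0..T}\<close>] by (simp add: DERIV_imp_deriv)
  qed
qed

lemma pd_add_scaled:
  assumes "T > 0" "smooth_strip T f" "smooth_strip T g" "t \<in> {0..T}"
  shows "pd T i j (\<lambda>t x. f t x + c * g t x) t x = pd T i j f t x + c * pd T i j g t x"
proof (rule pd_eqI[where D="\<lambda>i j t x. pd T i j f t x + c * pd T i j g t x"])
  show "((\<lambda>s. pd T 0 j f s x + c * pd T 0 j g s x) has_vector_derivative
      pd T 0 (Suc j) f t x + c * pd T 0 (Suc j) g t x) (at t within {0..T})"
    if "t \<in> {0..T}" for j t x
    using smooth_strip_has_derivative_t[OF assms(2) that] smooth_strip_has_derivative_t[OF assms(3) that]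
    by (auto intro!: derivative_intros)
  show "((\<lambda>x. pd T i j f t x + c * pd T i j g t x) has_real_derivative
      pd T (Suc i) j f t x + c * pd T (Suc i) j g t x) (at x)"
    if "t \<in> {0..T}" for i j t x
    using smooth_strip_has_derivative_x[OF assms(2) that] smooth_strip_has_derivative_x[OF assms(3) that]
    by (auto intro!: derivative_eq_intros)
qed (use assms in \<open>auto simp: pd_def\<close>)

lemma differentiable_on_cong:
  assumes "f differentiable_on S" "\<And>x. x \<in> S \<Longrightarrow> g x = f x"
  shows "g differentiable_on S"
  unfolding differentiable_on_def
proof
  fix x assume "x \<in> S"
  with assms obtain F where "(f has_derivative F) (at x within S)"
    by (auto simp: differentiable_on_def differentiable_def)
  then have "(g has_derivative F) (at x within S)"
    by (rule has_derivative_transform[OF \<open>x \<in> S\<close>, rotated]) (use assms(2) in auto)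
  then show "g differentiable at x within S" by (auto simp: differentiable_def)
qed

lemma smooth_strip_add_scaled:
  assumes "T > 0" "smooth_strip T f" "smooth_strip T g"
  shows "smooth_strip T (\<lambda>t x. f t x + c * g t x)"
  unfolding smooth_strip_def
proof (intro allI)
  fix i j
  have "(\<lambda>p. (\<lambda>(t, x). pd T i j f t x) p + c * (\<lambda>(t, x). pd T i j g t x) p) differentiable_on strip T"
    using assms(2,3) unfolding smooth_strip_def differentiable_on_def
    by (intro ballI differentiable_add differentiable_mult differentiable_const) auto
  then show "(\<lambda>(t, x). pd T i j (\<lambda>t x. f t x + c * g t x) t x) differentiable_on strip T"
    by (rule differentiable_on_cong) (auto simp: pd_add_scaled[OF assms])
qed

lemma Schwartz_strip_add_scaled:
  assumes "T > 0" "f \<in> Schwartz_strip T" "g \<in> Schwartz_strip T"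
  shows "(\<lambda>t x. f t x + c * g t x) \<in> Schwartz_strip T"
  unfolding Schwartz_strip_def
proof (intro CollectI conjI allI)
  have s: "smooth_strip T f" "smooth_strip T g"
    using assms by (auto simp: Schwartz_strip_def)
  show "smooth_strip T (\<lambda>t x. f t x + c * g t x)"
    by (rule smooth_strip_add_scaled[OF assms(1) s])
  fix k i j
  have "bounded ((\<lambda>(t, x). (1 + \<bar>x\<bar>\<^sup>2) ^ k * pd T i j f t x) ` strip T)"
       "bounded ((\<lambda>(t, x). (1 + \<bar>x\<bar>\<^sup>2) ^ k * pd T i j g t x) ` strip T)"
    using assms by (auto simp: Schwartz_strip_def)
  then obtain M N where MN: "\<forall>t\<in>{0..T}. \<forall>x. \<bar>(1 + \<bar>x\<bar>\<^sup>2) ^ k * pd T i j f t x\<bar> \<le> M"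
      "\<forall>t\<in>{0..T}. \<forall>x. \<bar>(1 + \<bar>x\<bar>\<^sup>2) ^ k * pd T i j g t x\<bar> \<le> N"
    by (auto simp: bounded_iff)
  have "\<bar>(1 + \<bar>x\<bar>\<^sup>2) ^ k * pd T i j (\<lambda>t x. f t x + c * g t x) t x\<bar> \<le> M + \<bar>c\<bar> * N"
    if "t \<in> {0..T}" for t x
  proof -
    have "(1 + \<bar>x\<bar>\<^sup>2) ^ k * pd T i j (\<lambda>t x. f t x + c * g t x) t x =
        (1 + \<bar>x\<bar>\<^sup>2) ^ k * pd T i j f t x + c * ((1 + \<bar>x\<bar>\<^sup>2) ^ k * pd T i j g t x)"
      using that by (simp add: pd_add_scaled[OF assms(1) s] algebra_simps)
    also have "\<bar>\<dots>\<bar> \<le> M + \<bar>c\<bar> * N"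
      by (rule order_trans[OF abs_triangle_ineq])
         (unfold abs_mult[of c], intro add_mono mult_left_mono MN[rule_format] that abs_ge_zero)
    finally show ?thesis .
  qed
  then show "bounded ((\<lambda>(t, x). (1 + \<bar>x\<bar>\<^sup>2) ^ k * pd T i j (\<lambda>t x. f t x + c * g t x) t x) ` strip T)"
    unfolding bounded_iff by (intro exI[of _ "M + \<bar>c\<bar> * N"]) auto
qed

text \<open>Of all the weights only \<open>k = 1\<close> is needed for the estimates of the energy:
  it already yields an integrable majorant that does not depend on \<open>t\<close>.\<close>

lemma Schwartz_strip_bound:
  assumes "f \<in> Schwartz_strip T"
  obtains C where "C > 0" "\<And>t x. t \<in> {0..T} \<Longrightarrow> \<bar>pd T i j f t x\<bar> \<le> C / (1 + x\<^sup>2)"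
proof -
  have "bounded ((\<lambda>(t, x). (1 + \<bar>x\<bar>\<^sup>2) ^ 1 * pd T i j f t x) ` strip T)"
    using assms unfolding Schwartz_strip_def by blast
  then obtain M where M: "\<forall>t\<in>{0..T}. \<forall>x. \<bar>(1 + x\<^sup>2) * pd T i j f t x\<bar> \<le> M"
    by (auto simp: bounded_iff)
  show ?thesis
  proof
    show "max M 1 > 0" by simp
    show "\<bar>pd T i j f t x\<bar> \<le> max M 1 / (1 + x\<^sup>2)" if "t \<in> {0..T}" for t x
    proof -
      have "1 + x\<^sup>2 > 0" by (simp add: add_pos_nonneg)
      moreover have "(1 + x\<^sup>2) * \<bar>pd T i j f t x\<bar> \<le> max M 1"
        using M[rule_format, OF that, of x] \<open>1 + x\<^sup>2 > 0\<close> by (simp add: abs_mult)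
      ultimately show ?thesis by (simp add: pos_le_divide_eq mult.commute)
    qed
  qed
qed

lemma Schwartz_strip_slice:
  assumes "f \<in> Schwartz_strip T" "t \<in> {0..T}"
  shows "f t \<in> Schwartz_real"
proof -
  have "smooth_real (f t)"
    unfolding smooth_real_def pd_i_0[of T, symmetric]
    using assms by (intro allI differentiable_on_strip_x[of _ T]) (auto simp: Schwartz_strip_def smooth_strip_def)
  moreover have "bounded (range (\<lambda>x. (1 + \<bar>x\<bar>\<^sup>2) ^ k * (deriv ^^ i) (f t) x))" for k i
  proof (rule bounded_subset)
    show "bounded ((\<lambda>(t, x). (1 + \<bar>x\<bar>\<^sup>2) ^ k * pd T i 0 f t x) ` strip T)"
      using assms by (auto simp: Schwartz_strip_def)
    show "range (\<lambda>x. (1 + \<bar>x\<bar>\<^sup>2) ^ k * (deriv ^^ i) (f t) x) \<subseteq> (\<lambda>(t, x). (1 + \<bar>x\<bar>\<^sup>2) ^ k * pd T i 0 f t x) ` strip T"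
      using assms(2) by (force simp: pd_i_0)
  qed
  ultimately show ?thesis by (simp add: Schwartz_real_def)
qed

text \<open>The two-variable counterpart of \<open>smooth_real_coinduct\<close>: whatever is shown
  for the members of a class closed under both partial derivatives holds for every \<open>pd\<close>
  of each member.\<close>

lemma pd_in_closed_class:
  assumes "T > 0" "h \<in> S"
    and t: "\<And>g. g \<in> S \<Longrightarrow> \<exists>g'\<in>S. \<forall>t x. ((\<lambda>s. g s x) has_real_derivative g' t x) (at t)"
    and x: "\<And>g. g \<in> S \<Longrightarrow> \<exists>g'\<in>S. \<forall>t x. (g t has_real_derivative g' t x) (at x)"
  shows "\<exists>g\<in>S. \<forall>t\<in>{0..T}. \<forall>x. pd T i j h t x = g t x"
proof -
  obtain Dt where Dt: "\<And>g. g \<in> S \<Longrightarrow> Dt g \<in> S"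
      "\<And>g t x. g \<in> S \<Longrightarrow> ((\<lambda>s. g s x) has_real_derivative Dt g t x) (at t)"
    using t by metis
  obtain Dx where Dx: "\<And>g. g \<in> S \<Longrightarrow> Dx g \<in> S"
      "\<And>g t x. g \<in> S \<Longrightarrow> (g t has_real_derivative Dx g t x) (at x)"
    using x by metis
  have 1: "(Dt ^^ j) h \<in> S" for j by (induction j) (use Dt \<open>h \<in> S\<close> in auto)
  have 2: "(Dx ^^ i) ((Dt ^^ j) h) \<in> S" for i j by (induction i) (use Dx 1 in auto)
  have "pd T i j h t x = (Dx ^^ i) ((Dt ^^ j) h) t x" if "t \<in> {0..T}" for t x
  proof (rule pd_eqI[where D="\<lambda>i j. (Dx ^^ i) ((Dt ^^ j) h)"])
    show "((\<lambda>s. (Dx ^^ 0) ((Dt ^^ j) h) s x) has_vector_derivative (Dx ^^ 0) ((Dt ^^ Suc j) h) t x)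
        (at t within {0..T})" for j t x
      using Dt(2)[OF 1] by (simp add: has_real_derivative_iff_has_vector_derivative has_vector_derivative_at_within)
  qed (use assms(1) that Dx(2)[OF 2] in auto)
  with 2 show ?thesis by blast
qed

text \<open>Finite linear combinations of these products suffice: by the chain rule a time
  derivative raises \<open>i\<close>, or raises \<open>j\<close> at the cost of a factor
  \<open>\<nu>\<close>, and a space derivative raises \<open>j\<close> at the cost of
  \<open>\<mu>\<close>.\<close>

inductive_set wave_space :: "(real \<Rightarrow> real) \<Rightarrow> (real \<Rightarrow> real) \<Rightarrow> real \<Rightarrow> real \<Rightarrow> real \<Rightarrow> (real \<Rightarrow> real \<Rightarrow> real) set"
  for A B \<mu> \<nu> c where
  base: "(\<lambda>t x. (deriv ^^ i) A t * (deriv ^^ j) B (\<mu> * x + \<nu> * t + c)) \<in> wave_space A B \<mu> \<nu> c"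
| add: "f \<in> wave_space A B \<mu> \<nu> c \<Longrightarrow> g \<in> wave_space A B \<mu> \<nu> c \<Longrightarrow>
    (\<lambda>t x. f t x + a * g t x) \<in> wave_space A B \<mu> \<nu> c"

context
  fixes A B :: "real \<Rightarrow> real" and \<mu> \<nu> c :: real
  assumes A: "smooth_real A" and B: "smooth_real B"
begin

lemma wave_DERIV_x:
  "((\<lambda>x. (deriv ^^ i) A t * (deriv ^^ j) B (\<mu> * x + \<nu> * t + c)) has_real_derivative
    \<mu> * ((deriv ^^ i) A t * (deriv ^^ Suc j) B (\<mu> * x + \<nu> * t + c))) (at x)"
proof -
  have "((\<lambda>x. (deriv ^^ j) B (\<mu> * x + \<nu> * t + c)) has_real_derivative
      (deriv ^^ Suc j) B (\<mu> * x + \<nu> * t + c) * \<mu>) (at x)"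
    by (rule DERIV_chain2[OF smooth_real_DERIV[OF B]]) (auto intro!: derivative_eq_intros)
  from DERIV_cmult[OF this, of "(deriv ^^ i) A t"] show ?thesis by (simp add: mult_ac)
qed

lemma wave_DERIV_t:
  "((\<lambda>t. (deriv ^^ i) A t * (deriv ^^ j) B (\<mu> * x + \<nu> * t + c)) has_real_derivative
    (deriv ^^ Suc i) A t * (deriv ^^ j) B (\<mu> * x + \<nu> * t + c) +
    \<nu> * ((deriv ^^ i) A t * (deriv ^^ Suc j) B (\<mu> * x + \<nu> * t + c))) (at t)"
proof -
  have "((\<lambda>t. (deriv ^^ j) B (\<mu> * x + \<nu> * t + c)) has_real_derivative
      (deriv ^^ Suc j) B (\<mu> * x + \<nu> * t + c) * \<nu>) (at t)"
    by (rule DERIV_chain2[OF smooth_real_DERIV[OF B]]) (auto intro!: derivative_eq_intros)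
  from DERIV_mult[OF smooth_real_DERIV[OF A] this, of i] show ?thesis by (simp add: algebra_simps)
qed

lemma wave_space_zero: "(\<lambda>t x. 0) \<in> wave_space A B \<mu> \<nu> c"
  using wave_space.add[OF wave_space.base[of 0 A 0 B] wave_space.base[of 0 A 0 B], where a="-1"]
  by simp

lemma wave_space_scale: "g \<in> wave_space A B \<mu> \<nu> c \<Longrightarrow> (\<lambda>t x. a * g t x) \<in> wave_space A B \<mu> \<nu> c"
  using wave_space.add[OF wave_space_zero, of g a] by simp

lemma wave_space_DERIV_x:
  "g \<in> wave_space A B \<mu> \<nu> c \<Longrightarrow>
    \<exists>g'\<in>wave_space A B \<mu> \<nu> c. \<forall>t x. (g t has_real_derivative g' t x) (at x)"
proof (induction rule: wave_space.induct)
  case (base i j)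
  show ?case
    by (rule bexI[OF _ wave_space_scale[OF wave_space.base[of i _ "Suc j"], of \<mu>]]) (intro allI wave_DERIV_x)
next
  case (add f g a)
  then obtain f' g' where *: "f' \<in> wave_space A B \<mu> \<nu> c" "g' \<in> wave_space A B \<mu> \<nu> c"
    "\<forall>t x. (f t has_real_derivative f' t x) (at x)" "\<forall>t x. (g t has_real_derivative g' t x) (at x)"
    by blast
  then show ?case
    by (intro bexI[OF _ wave_space.add[OF *(1,2), where a=a]] allI) (auto intro!: derivative_eq_intros)
qed

lemma wave_space_DERIV_t:
  "g \<in> wave_space A B \<mu> \<nu> c \<Longrightarrow>
    \<exists>g'\<in>wave_space A B \<mu> \<nu> c. \<forall>t x. ((\<lambda>s. g s x) has_real_derivative g' t x) (at t)"
proof (induction rule: wave_space.induct)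
  case (base i j)
  show ?case
    by (rule bexI[OF _ wave_space.add[OF wave_space.base[of "Suc i" _ j] wave_space.base[of i _ "Suc j"], where a=\<nu>]])
      (intro allI wave_DERIV_t)
next
  case (add f g a)
  then obtain f' g' where *: "f' \<in> wave_space A B \<mu> \<nu> c" "g' \<in> wave_space A B \<mu> \<nu> c"
    "\<forall>t x. ((\<lambda>s. f s x) has_real_derivative f' t x) (at t)"
    "\<forall>t x. ((\<lambda>s. g s x) has_real_derivative g' t x) (at t)"
    by blast
  then show ?case
    by (intro bexI[OF _ wave_space.add[OF *(1,2), where a=a]] allI) (auto intro!: derivative_eq_intros)
qed

lemma wave_space_differentiable:
  "g \<in> wave_space A B \<mu> \<nu> c \<Longrightarrow> (\<lambda>(t, x). g t x) differentiable_on UNIV"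
proof (induction rule: wave_space.induct)
  case (base i j)
  have D: "(\<lambda>y. (deriv ^^ i) f y) differentiable at y" if "smooth_real f" for f i y
    using smooth_real_DERIV[OF that, of i] by (auto simp: real_differentiable_def)
  have 1: "(\<lambda>p. (deriv ^^ i) A (fst p)) differentiable (at p)" for p :: "real \<times> real"
    by (rule differentiable_compose[of "(deriv ^^ i) A" fst])
       (auto intro: D[OF A] differentiableI bounded_linear_imp_has_derivative bounded_linear_fst)
  have 2: "(\<lambda>p. (deriv ^^ j) B (\<mu> * snd p + \<nu> * fst p + c)) differentiable (at p)" for p :: "real \<times> real"
    by (rule differentiable_compose[of "(deriv ^^ j) B" "\<lambda>p. \<mu> * snd p + \<nu> * fst p + c"])
       (auto intro!: D[OF B] differentiable_add differentiable_mult differentiable_const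
          intro: differentiableI bounded_linear_imp_has_derivative bounded_linear_fst bounded_linear_snd)
  show ?case
    using differentiable_mult[OF 1 2] by (auto simp: differentiable_on_def case_prod_unfold)
next
  case (add f g a)
  then show ?case
    by (auto simp: differentiable_on_def case_prod_unfold intro!: differentiable_add differentiable_mult differentiable_const)
qed

text \<open>The wave moves at finite speed, so during \<open>[0, T]\<close> its support stays within
  a fixed distance \<open>R\<close> of 0, the same for every member of the class.\<close>

lemma wave_space_bound:
  fixes T :: real
  assumes "\<mu> \<noteq> 0" and supp: "\<And>y. \<bar>y\<bar> > 1 \<Longrightarrow> B y = 0"
  defines "R \<equiv> (1 + \<bar>\<nu>\<bar> * T + \<bar>c\<bar>) / \<bar>\<mu>\<bar>"
  assumes "g \<in> wave_space A B \<mu> \<nu> c"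
  shows "\<exists>M. \<forall>t\<in>{0..T}. \<forall>x. \<bar>g t x\<bar> \<le> M \<and> (\<bar>x\<bar> > R \<longrightarrow> g t x = 0)"
  using assms(4)
proof (induction rule: wave_space.induct)
  case (base i j)
  have supp': "\<bar>y\<bar> > 1 \<Longrightarrow> (deriv ^^ j) B y = 0" for y
    by (rule deriv_funpow_eq_0_outside[OF supp])
  obtain N where N: "N > 0" "\<And>y. \<bar>(deriv ^^ j) B y\<bar> \<le> N"
    using continuous_vanishing_outside_bounded[OF smooth_real_continuous[OF B] supp'] by blast
  have "bounded ((deriv ^^ i) A ` {0..T})"
    by (intro compact_imp_bounded compact_continuous_image smooth_real_continuous A) auto
  then obtain M where M: "\<forall>t\<in>{0..T}. \<bar>(deriv ^^ i) A t\<bar> \<le> M"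
    by (auto simp: bounded_iff)
  have "\<bar>(deriv ^^ i) A t * (deriv ^^ j) B (\<mu> * x + \<nu> * t + c)\<bar> \<le> M * N" if "t \<in> {0..T}" for t x
    unfolding abs_mult using M that N by (intro mult_mono) fastforce+
  moreover have "(deriv ^^ j) B (\<mu> * x + \<nu> * t + c) = 0" if "t \<in> {0..T}" "\<bar>x\<bar> > R" for t x
  proof (rule supp')
    have "\<bar>\<mu>\<bar> * \<bar>x\<bar> > 1 + \<bar>\<nu>\<bar> * T + \<bar>c\<bar>"
      using that(2) \<open>\<mu> \<noteq> 0\<close> by (simp add: R_def field_simps)
    moreover have "\<bar>\<nu> * t\<bar> \<le> \<bar>\<nu>\<bar> * T"
      using that(1) by (simp add: abs_mult mult_left_mono)
    ultimately show "\<bar>\<mu> * x + \<nu> * t + c\<bar> > 1"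
      unfolding abs_mult[symmetric] by linarith
  qed
  ultimately show ?case by (intro exI[of _ "M * N"]) auto
next
  case (add f g a)
  then obtain M N where MN: "\<forall>t\<in>{0..T}. \<forall>x. \<bar>f t x\<bar> \<le> M \<and> (\<bar>x\<bar> > R \<longrightarrow> f t x = 0)"
    "\<forall>t\<in>{0..T}. \<forall>x. \<bar>g t x\<bar> \<le> N \<and> (\<bar>x\<bar> > R \<longrightarrow> g t x = 0)" by blast
  have "\<bar>f t x + a * g t x\<bar> \<le> M + \<bar>a\<bar> * N" if "t \<in> {0..T}" for t x
    by (rule order_trans[OF abs_triangle_ineq])
       (use MN that in \<open>auto simp: abs_mult intro!: add_mono mult_left_mono\<close>)
  with MN show ?case by (intro exI[of _ "M + \<bar>a\<bar> * N"]) auto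
qed

lemma wave_in_Schwartz_strip:
  assumes "T > 0" "\<mu> \<noteq> 0" and supp: "\<And>y. \<bar>y\<bar> > 1 \<Longrightarrow> B y = 0"
  shows "(\<lambda>t x. A t * B (\<mu> * x + \<nu> * t + c)) \<in> Schwartz_strip T"
proof -
  let ?h = "\<lambda>t x. A t * B (\<mu> * x + \<nu> * t + c)"
  let ?R = "(1 + \<bar>\<nu>\<bar> * T + \<bar>c\<bar>) / \<bar>\<mu>\<bar>"
  have h: "?h \<in> wave_space A B \<mu> \<nu> c"
    using wave_space.base[of 0 A 0 B] by simp
  have pd: "\<exists>g\<in>wave_space A B \<mu> \<nu> c. \<forall>t\<in>{0..T}. \<forall>x. pd T i j ?h t x = g t x" for i j
    by (rule pd_in_closed_class[OF \<open>T > 0\<close> h wave_space_DERIV_t wave_space_DERIV_x])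
  have "(\<lambda>(t, x). pd T i j ?h t x) differentiable_on strip T" for i j
  proof -
    obtain g where g: "g \<in> wave_space A B \<mu> \<nu> c" "\<forall>t\<in>{0..T}. \<forall>x. pd T i j ?h t x = g t x"
      using pd by blast
    then show ?thesis
      by (intro differentiable_on_cong[OF differentiable_on_subset[OF wave_space_differentiable[OF g(1)]]]) auto
  qed
  moreover have "bounded ((\<lambda>(t, x). (1 + \<bar>x\<bar>\<^sup>2) ^ k * pd T i j ?h t x) ` strip T)" for k i j
  proof -
    obtain g where g: "g \<in> wave_space A B \<mu> \<nu> c" "\<forall>t\<in>{0..T}. \<forall>x. pd T i j ?h t x = g t x"
      using pd by blast
    obtain M where M: "\<forall>t\<in>{0..T}. \<forall>x. \<bar>g t x\<bar> \<le> M \<and> (\<bar>x\<bar> > ?R \<longrightarrow> g t x = 0)"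
      using wave_space_bound[OF assms(2) supp g(1)] by blast
    \<comment> \<open>The weight is unbounded, but it matters only for
      \<open>\<bar>x\<bar> \<le> R\<close>, where its largest value is attained at
      \<open>R\<close>.\<close>
    have "\<bar>(1 + \<bar>x\<bar>\<^sup>2) ^ k * g t x\<bar> \<le> (1 + ?R\<^sup>2) ^ k * M" if t: "t \<in> {0..T}" for t x
    proof (cases "\<bar>x\<bar> > ?R")
      case True
      moreover have "M \<ge> 0" using M t by (meson abs_ge_zero order_trans)
      ultimately show ?thesis using M t by simp
    next
      case False
      then have "\<bar>x\<bar>\<^sup>2 \<le> ?R\<^sup>2" by (intro power_mono) auto
      then show ?thesis
        unfolding abs_mult using M t by (intro mult_mono) (auto simp: power_abs intro!: power_mono)
    qed
    with g show ?thesis unfolding bounded_iff by (intro exI[of _ "(1 + ?R\<^sup>2) ^ k * M"]) auto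
  qed
  ultimately show ?thesis by (simp add: Schwartz_strip_def smooth_strip_def)
qed

end

subsection \<open>Topology of the space of paths\<close>

text \<open>The analogue of \<open>pd_eqI\<close> for functions of time alone.\<close>

lemma dt_funpow_eqI:
  assumes "T > 0"
    and D: "\<And>j t. t \<in> {0..T} \<Longrightarrow> (D j has_vector_derivative D (Suc j) t) (at t within {0..T})"
    and h: "\<And>t. t \<in> {0..T} \<Longrightarrow> h t = D 0 t"
    and "t \<in> {0..T}"
  shows "(dt T ^^ j) h t = D j t"
  using \<open>t \<in> {0..T}\<close>
proof (induction j arbitrary: t)
  case (Suc j)
  have "((dt T ^^ j) h has_vector_derivative D (Suc j) t) (at t within {0..T})"
    by (rule has_vector_derivative_transform[OF Suc.prems _ D[OF Suc.prems]]) (rule Suc.IH)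
  then show ?case using dt_eqI[OF \<open>T > 0\<close> Suc.prems] by simp
qed (use h in auto)

lemma smooth_Icc_has_derivative:
  "f \<in> smooth_Icc T \<Longrightarrow> t \<in> {0..T} \<Longrightarrow>
    ((dt T ^^ j) f has_vector_derivative (dt T ^^ Suc j) f t) (at t within {0..T})"
  using has_vector_derivative_dt[of "(dt T ^^ j) f" T t] by (auto simp: smooth_Icc_def)

lemma dt_add_scaled:
  assumes "T > 0" "f \<in> smooth_Icc T" "g \<in> smooth_Icc T" "t \<in> {0..T}"
  shows "(dt T ^^ j) (\<lambda>t. f t + c * g t) t = (dt T ^^ j) f t + c * (dt T ^^ j) g t"
proof (rule dt_funpow_eqI[where D="\<lambda>j t. (dt T ^^ j) f t + c * (dt T ^^ j) g t"])
  show "((\<lambda>t. (dt T ^^ j) f t + c * (dt T ^^ j) g t) has_vector_derivative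
      (dt T ^^ Suc j) f t + c * (dt T ^^ Suc j) g t) (at t within {0..T})" if "t \<in> {0..T}" for j t
    using smooth_Icc_has_derivative[OF assms(2) that, of j] smooth_Icc_has_derivative[OF assms(3) that, of j]
    by (intro has_vector_derivative_add has_vector_derivative_mult_right)
qed (use assms in auto)

lemma smooth_Icc_add_scaled:
  assumes "T > 0" "f \<in> smooth_Icc T" "g \<in> smooth_Icc T"
  shows "(\<lambda>t. f t + c * g t) \<in> smooth_Icc T"
  unfolding smooth_Icc_def
proof (intro CollectI allI)
  fix j
  have "(\<lambda>t. (dt T ^^ j) f t + c * (dt T ^^ j) g t) differentiable_on {0..T}"
    using assms unfolding smooth_Icc_def differentiable_on_def
    by (intro ballI differentiable_add differentiable_mult differentiable_const) auto
  then show "(dt T ^^ j) (\<lambda>t. f t + c * g t) differentiable_on {0..T}"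
    by (rule differentiable_on_cong) (rule dt_add_scaled[OF assms])
qed

lemma smooth_real_in_smooth_Icc:
  assumes "T > 0" "smooth_real f"
  shows "f \<in> smooth_Icc T" and "t \<in> {0..T} \<Longrightarrow> dt T f t = deriv f t"
proof -
  have D: "((deriv ^^ j) f has_vector_derivative (deriv ^^ Suc j) f t) (at t within {0..T})" for j t
    using smooth_real_DERIV[OF assms(2)]
    by (simp add: has_real_derivative_iff_has_vector_derivative has_vector_derivative_at_within)
  have *: "(dt T ^^ j) f t = (deriv ^^ j) f t" if "t \<in> {0..T}" for j t
    by (rule dt_funpow_eqI[OF assms(1) _ _ that, where D="\<lambda>j. (deriv ^^ j) f"]) (rule D, simp)
  show "f \<in> smooth_Icc T"
    unfolding smooth_Icc_def
  proof (intro CollectI allI)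
    fix j
    have "(deriv ^^ j) f differentiable_on {0..T}"
      using D by (auto simp: differentiable_on_def intro: differentiableI_vector)
    then show "(dt T ^^ j) f differentiable_on {0..T}"
      by (rule differentiable_on_cong) (rule *)
  qed
  show "dt T f t = deriv f t" if "t \<in> {0..T}"
    using *[OF that, of 1] by simp
qed

lemma smooth_Icc_continuous: "f \<in> smooth_Icc T \<Longrightarrow> continuous_on {0..T} ((dt T ^^ j) f)"
  by (auto simp: smooth_Icc_def intro: differentiable_imp_continuous_on)

lemma Cn_norm_add_scaled:
  assumes "T > 0" "f \<in> smooth_Icc T" "g \<in> smooth_Icc T"
  shows "Cn_norm T n (\<lambda>t. f t + c * g t) \<le> Cn_norm T n f + \<bar>c\<bar> * Cn_norm T n g"
proof -
  \<comment> \<open>The supremum of an unbounded set of reals would carry no information; continuity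
    on a compact interval excludes this.\<close>
  have bdd: "bdd_above ((\<lambda>t. \<bar>(dt T ^^ j) f t\<bar>) ` {0..T})" if "f \<in> smooth_Icc T" for f j
    by (rule bounded_imp_bdd_above[OF compact_imp_bounded[OF compact_continuous_image[OF
          continuous_on_rabs[OF smooth_Icc_continuous[OF that]] compact_Icc]]])
  have "(SUP t\<in>{0..T}. \<bar>(dt T ^^ j) (\<lambda>t. f t + c * g t) t\<bar>) \<le>
      (SUP t\<in>{0..T}. \<bar>(dt T ^^ j) f t\<bar>) + \<bar>c\<bar> * (SUP t\<in>{0..T}. \<bar>(dt T ^^ j) g t\<bar>)" for j
  proof (rule cSUP_least)
    fix t assume t: "t \<in> {0..T}"
    have "\<bar>(dt T ^^ j) (\<lambda>t. f t + c * g t) t\<bar> \<le> \<bar>(dt T ^^ j) f t\<bar> + \<bar>c\<bar> * \<bar>(dt T ^^ j) g t\<bar>"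
      unfolding dt_add_scaled[OF assms t] abs_mult[symmetric] by (rule abs_triangle_ineq)
    also have "\<dots> \<le> (SUP t\<in>{0..T}. \<bar>(dt T ^^ j) f t\<bar>) + \<bar>c\<bar> * (SUP t\<in>{0..T}. \<bar>(dt T ^^ j) g t\<bar>)"
      by (intro add_mono mult_left_mono cSUP_upper[OF t] bdd assms abs_ge_zero)
    finally show "\<bar>(dt T ^^ j) (\<lambda>t. f t + c * g t) t\<bar> \<le> \<dots>" .
  qed (use assms in auto)
  then show ?thesis
    unfolding Cn_norm_def sum_distrib_left sum.distrib[symmetric] by (rule sum_mono)
qed

lemma Schwartz_norm_add_scaled:
  assumes "T > 0" "f \<in> Schwartz_strip T" "g \<in> Schwartz_strip T"
  shows "Schwartz_norm T k m n (\<lambda>t x. f t x + c * g t x) \<le>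
    Schwartz_norm T k m n f + \<bar>c\<bar> * Schwartz_norm T k m n g"
proof -
  let ?S = "\<lambda>f i j. SUP (t, x)\<in>strip T. \<bar>(1 + \<bar>x\<bar>\<^sup>2) ^ k * pd T i j f t x\<bar>"
  have s: "smooth_strip T f" "smooth_strip T g"
    using assms by (auto simp: Schwartz_strip_def)
  have le: "\<bar>(1 + \<bar>x\<bar>\<^sup>2) ^ k * pd T i j f t x\<bar> \<le> ?S f i j"
    if "f \<in> Schwartz_strip T" "t \<in> {0..T}" for f i j t x
  proof -
    have "bounded ((\<lambda>(t, x). (1 + \<bar>x\<bar>\<^sup>2) ^ k * pd T i j f t x) ` strip T)"
      using that unfolding Schwartz_strip_def by blast
    then obtain a where "\<forall>t\<in>{0..T}. \<forall>x. \<bar>(1 + \<bar>x\<bar>\<^sup>2) ^ k * pd T i j f t x\<bar> \<le> a"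
      by (auto simp: bounded_iff)
    then have "bdd_above ((\<lambda>(t, x). \<bar>(1 + \<bar>x\<bar>\<^sup>2) ^ k * pd T i j f t x\<bar>) ` strip T)"
      by (intro bdd_aboveI[of _ a]) auto
    from cSUP_upper[OF _ this, of "(t, x)"] that show ?thesis by simp
  qed
  have "?S (\<lambda>t x. f t x + c * g t x) i j \<le> ?S f i j + \<bar>c\<bar> * ?S g i j" for i j
  proof (rule cSUP_least)
    fix p assume p: "p \<in> strip T"
    then obtain t x where tx: "p = (t, x)" "t \<in> {0..T}" by auto
    have "(1 + \<bar>x\<bar>\<^sup>2) ^ k * pd T i j (\<lambda>t x. f t x + c * g t x) t x =
        (1 + \<bar>x\<bar>\<^sup>2) ^ k * pd T i j f t x + c * ((1 + \<bar>x\<bar>\<^sup>2) ^ k * pd T i j g t x)"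
      using tx by (simp add: pd_add_scaled[OF assms(1) s] algebra_simps)
    also have "\<bar>\<dots>\<bar> \<le> \<bar>(1 + \<bar>x\<bar>\<^sup>2) ^ k * pd T i j f t x\<bar> + \<bar>c\<bar> * \<bar>(1 + \<bar>x\<bar>\<^sup>2) ^ k * pd T i j g t x\<bar>"
      unfolding abs_mult[symmetric, of c] by (rule abs_triangle_ineq)
    also have "\<dots> \<le> ?S f i j + \<bar>c\<bar> * ?S g i j"
      by (intro add_mono mult_left_mono le assms tx abs_ge_zero)
    finally show "(case p of (t, x) \<Rightarrow> \<bar>(1 + \<bar>x\<bar>\<^sup>2) ^ k * pd T i j (\<lambda>t x. f t x + c * g t x) t x\<bar>) \<le> \<dots>"
      by (simp add: tx)
  qed (use assms in auto)
  then show ?thesis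
    unfolding Schwartz_norm_def sum_distrib_left sum.distrib[symmetric] by (intro sum_mono)
qed

text \<open>Convergence may be tested on a subbasis: finite intersections combine finitely many
  eventual statements, and for a union one member containing \<open>p\<close> is enough.\<close>

lemma eventually_in_generated_open:
  assumes "openin (topology_generated_by B) V" "p \<in> V"
    and B: "\<And>W. W \<in> B \<Longrightarrow> p \<in> W \<Longrightarrow> \<forall>\<^sub>F s in F. \<gamma> s \<in> W"
  shows "\<forall>\<^sub>F s in F. \<gamma> s \<in> V"
proof -
  have "generate_topology_on B V"
    using assms(1) by (simp add: openin_topology_generated_by_iff)
  then show ?thesis
    using \<open>p \<in> V\<close>
  proof induction
    case (Int a b)
    then show ?case by (auto intro: eventually_conj)
  next
    case (UN K)
    then obtain k where k: "k \<in> K" "p \<in> k" by blast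
    then have "\<forall>\<^sub>F s in F. \<gamma> s \<in> k" using UN.IH by blast
    then show ?case by eventually_elim (use k in blast)
  qed (use B in auto)
qed

text \<open>A bound affine in \<open>\<bar>s\<bar>\<close> replaces continuity of \<open>N\<close>;
  the strict inequality \<open>N0 < e\<close> leaves the room.\<close>

lemma eventually_in_seminorm_ball:
  fixes N :: "'a \<Rightarrow> real"
  assumes "\<And>s. N (\<gamma> s) \<le> N0 + \<bar>s\<bar> * N1" "N0 < e"
  shows "\<forall>\<^sub>F s in nhds (0::real). N (\<gamma> s) < e"
proof -
  have "((\<lambda>s. N0 + \<bar>s\<bar> * N1) \<longlongrightarrow> N0 + \<bar>0\<bar> * N1) (nhds 0)"
    by (intro tendsto_add tendsto_mult tendsto_rabs tendsto_const filterlim_ident)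
  then have "\<forall>\<^sub>F s in nhds 0. N0 + \<bar>s\<bar> * N1 < e"
    using assms(2) by (intro order_tendstoD(2)) auto
  then show ?thesis by eventually_elim (use assms(1) in \<open>auto intro: order.strict_trans1\<close>)
qed

text \<open>Lines through \<open>f\<close> are continuous at parameter 0. The subbasic balls are
  centred at an arbitrary \<open>h0\<close> rather than at \<open>f\<close>, so the distance from
  \<open>f\<close> to \<open>h0\<close> enters as the constant term of the affine bound.\<close>

lemma Schwartz_strip_topology_line:
  assumes "T > 0" "openin (Schwartz_strip_topology T) V" "f \<in> V" "f \<in> Schwartz_strip T" "h \<in> Schwartz_strip T"
  shows "\<forall>\<^sub>F s in nhds 0. (\<lambda>t x. f t x + s * h t x) \<in> V"
  using assms(2,3) unfolding Schwartz_strip_topology_def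
proof (rule eventually_in_generated_open)
  fix W assume "W \<in> {{g \<in> Schwartz_strip T. Schwartz_norm T k m n (\<lambda>t x. g t x - h t x) < \<epsilon>} | h k m n \<epsilon>.
        h \<in> Schwartz_strip T \<and> \<epsilon> > 0}" "f \<in> W"
  then obtain h0 k m n e where W: "W = {g \<in> Schwartz_strip T. Schwartz_norm T k m n (\<lambda>t x. g t x - h0 t x) < e}"
    "h0 \<in> Schwartz_strip T" "Schwartz_norm T k m n (\<lambda>t x. f t x - h0 t x) < e" by blast
  have d: "(\<lambda>t x. f t x - h0 t x) \<in> Schwartz_strip T"
    using Schwartz_strip_add_scaled[OF assms(1,4) W(2), of "-1"] by simp
  have "Schwartz_norm T k m n (\<lambda>t x. (f t x + s * h t x) - h0 t x) \<le>
      Schwartz_norm T k m n (\<lambda>t x. f t x - h0 t x) + \<bar>s\<bar> * Schwartz_norm T k m n h" for s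
    using Schwartz_norm_add_scaled[OF assms(1) d assms(5), of k m n s] by (simp add: algebra_simps)
  from eventually_in_seminorm_ball[of "\<lambda>g. Schwartz_norm T k m n (\<lambda>t x. g t x - h0 t x)"
      "\<lambda>s t x. f t x + s * h t x", OF this W(3)]
  show "\<forall>\<^sub>F s in nhds 0. (\<lambda>t x. f t x + s * h t x) \<in> W"
    by eventually_elim (simp add: W Schwartz_strip_add_scaled assms)
qed

lemma smooth_Icc_topology_line:
  assumes "T > 0" "openin (smooth_Icc_topology T) V" "f \<in> V" "f \<in> smooth_Icc T" "h \<in> smooth_Icc T"
  shows "\<forall>\<^sub>F s in nhds 0. (\<lambda>t. f t + s * h t) \<in> V"
  using assms(2,3) unfolding smooth_Icc_topology_def
proof (rule eventually_in_generated_open)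
  fix W assume "W \<in> {{g \<in> smooth_Icc T. Cn_norm T n (\<lambda>t. g t - f t) < \<epsilon>} | f n \<epsilon>.
        f \<in> smooth_Icc T \<and> \<epsilon> > 0}" "f \<in> W"
  then obtain h0 n e where W: "W = {g \<in> smooth_Icc T. Cn_norm T n (\<lambda>t. g t - h0 t) < e}"
    "h0 \<in> smooth_Icc T" "Cn_norm T n (\<lambda>t. f t - h0 t) < e" by blast
  have d: "(\<lambda>t. f t - h0 t) \<in> smooth_Icc T"
    using smooth_Icc_add_scaled[OF assms(1,4) W(2), of "-1"] by simp
  have "Cn_norm T n (\<lambda>t. (f t + s * h t) - h0 t) \<le>
      Cn_norm T n (\<lambda>t. f t - h0 t) + \<bar>s\<bar> * Cn_norm T n h" for s
    using Cn_norm_add_scaled[OF assms(1) d assms(5), of n s] by (simp add: algebra_simps)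
  from eventually_in_seminorm_ball[of "\<lambda>g. Cn_norm T n (\<lambda>t. g t - h0 t)"
      "\<lambda>s t. f t + s * h t", OF this W(3)]
  show "\<forall>\<^sub>F s in nhds 0. (\<lambda>t. f t + s * h t) \<in> W"
    by eventually_elim (simp add: W smooth_Icc_add_scaled assms)
qed

lemma path_topology_line:
  assumes "T > 0" "openin (path_topology T) V" "(f, \<alpha>) \<in> V"
    and "f \<in> Schwartz_strip T" "\<alpha> \<in> smooth_Icc T" "h \<in> Schwartz_strip T" "\<eta> \<in> smooth_Icc T"
  shows "\<forall>\<^sub>F s in nhds 0. (\<lambda>t x. f t x + s * h t x, \<lambda>t. \<alpha> t + s * \<eta> t) \<in> V"
proof -
  obtain V1 V2 where V: "openin (Schwartz_strip_topology T) V1" "openin (smooth_Icc_topology T) V2"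
    "f \<in> V1" "\<alpha> \<in> V2" "V1 \<times> V2 \<subseteq> V"
    using assms(2)[unfolded path_topology_def openin_prod_topology_alt, rule_format, OF assms(3)] by blast
  from Schwartz_strip_topology_line[OF assms(1) V(1,3) assms(4,6)]
    smooth_Icc_topology_line[OF assms(1) V(2,4) assms(5,7)]
  show ?thesis by eventually_elim (use V(5) in auto)
qed

subsection \<open>Perturbed paths\<close>

text \<open>Positive slope gives injectivity and a smooth inverse. Surjectivity comes from the
  intermediate value theorem, because the map differs from the identity by the bounded function
  \<open>f\<close>.\<close>

lemma Id_plus_Schwartz_in_Diff:
  assumes f: "f \<in> Schwartz_real" and pos: "\<And>x. 1 + deriv f x > 0"
  shows "(\<lambda>x. x + f x) \<in> Diff_Schwartz"
proof -
  let ?g = "\<lambda>x. x + f x"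
  have smooth_f: "smooth_real f" using f by (simp add: Schwartz_real_def)
  have g': "(?g has_real_derivative 1 + deriv f x) (at x)" for x
    using smooth_real_DERIV[OF smooth_f, of 0 x] by (auto intro!: derivative_eq_intros)
  have smooth_g: "smooth_real ?g"
  proof (rule gen_alg_smooth)
    let ?B = "insert (\<lambda>x. x) {(deriv ^^ i) f |i. True}"
    have "f \<in> {(deriv ^^ i) f |i. True}" by (auto intro!: exI[of _ 0])
    then show "?g \<in> gen_alg ?B" by (intro gen_alg.add gen_alg.base) auto
    fix g assume "g \<in> ?B"
    then consider "g = (\<lambda>x. x)" | i where "g = (deriv ^^ i) f" by blast
    then show "\<exists>g'\<in>gen_alg ?B. \<forall>x. (g has_real_derivative g' x) (at x)"
    proof cases
      case 1
      then show ?thesis by (intro bexI[OF _ gen_alg.const[of 1]]) auto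
    next
      case 2
      have "(deriv ^^ Suc i) f \<in> ?B" by blast
      then show ?thesis
        using smooth_real_DERIV[OF smooth_f] by (intro bexI[OF _ gen_alg.base]) (auto simp: 2)
    qed
  qed
  have mono: "?g x < ?g y" if "x < y" for x y
    by (rule DERIV_pos_imp_increasing[OF that]) (use g' pos in blast)
  have inj: "inj ?g"
  proof (rule injI)
    fix x y assume "?g x = ?g y"
    then show "x = y" using mono[of x y] mono[of y x] by (cases x y rule: linorder_cases) auto
  qed
  have "surj ?g"
  proof -
    have "bounded (range (\<lambda>x. (1 + \<bar>x\<bar>\<^sup>2) ^ 0 * (deriv ^^ 0) f x))"
      using f unfolding Schwartz_real_def by blast
    then obtain M where M: "\<forall>x. \<bar>f x\<bar> \<le> M" by (auto simp: bounded_iff)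
    have "\<exists>x. ?g x = y" for y
    proof -
      have "\<exists>x\<ge>y - M. x \<le> y + M \<and> ?g x = y"
      proof (rule IVT')
        have "0 \<le> M" using M abs_ge_zero order_trans by blast
        then show "y - M \<le> y + M" by simp
        show "(y - M) + f (y - M) \<le> y" "y \<le> (y + M) + f (y + M)"
          using M[rule_format, of "y - M"] M[rule_format, of "y + M"] by (simp_all add: abs_le_iff)
        show "continuous_on {y - M..y + M} ?g"
          using g' by (meson DERIV_continuous continuous_at_imp_continuous_on)
      qed
      then show ?thesis by blast
    qed
    then show ?thesis by (metis surj_def)
  qed
  with inj have "bij ?g" by (simp add: bij_def)
  moreover have "smooth_real (inv_into UNIV ?g)"
    using smooth_real_inv[OF smooth_g _ \<open>bij ?g\<close>] pos DERIV_imp_deriv[OF g'] by simp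
  ultimately show ?thesis using smooth_g f by (simp add: Diff_Schwartz_def)
qed

text \<open>Differentiating the composition with the inverse gives 1, so smoothness of the inverse
  excludes critical points.\<close>

lemma Diff_Schwartz_deriv_nonzero:
  assumes "\<phi> \<in> Diff_Schwartz"
  shows "deriv \<phi> x \<noteq> 0"
proof -
  let ?g = "inv_into UNIV \<phi>"
  have s: "smooth_real \<phi>" "smooth_real ?g" and b: "bij \<phi>"
    using assms by (auto simp: Diff_Schwartz_def)
  have "((\<lambda>x. ?g (\<phi> x)) has_real_derivative deriv ?g (\<phi> x) * deriv \<phi> x) (at x)"
    using DERIV_chain2[OF smooth_real_DERIV[OF s(2), of 0] smooth_real_DERIV[OF s(1), of 0]] by simp
  moreover have "(\<lambda>x. ?g (\<phi> x)) = (\<lambda>x. x)"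
    using b by (simp add: bij_is_inj)
  ultimately have "deriv ?g (\<phi> x) * deriv \<phi> x = 1"
    using DERIV_unique[OF _ DERIV_ident] by metis
  then show ?thesis by auto
qed

text \<open>Only \<open>\<phi> - x\<close> is a Schwartz function; the correction term consists of
  the derivatives of \<open>x\<close>, namely \<open>x\<close>, 1 and 0.\<close>

lemma path_pd:
  assumes "T > 0" "Virasoro_Bott_path T \<phi> \<alpha>" "t \<in> {0..T}"
  shows "pd T i j \<phi> t x = pd T i j (\<lambda>t x. \<phi> t x - x) t x +
    (if j = 0 \<and> i = 0 then x else if j = 0 \<and> i = 1 then 1 else 0)"
proof -
  let ?f = "\<lambda>t x. \<phi> t x - x"
  let ?D = "\<lambda>i j t x. pd T i j ?f t x + (if j = 0 \<and> i = 0 then x else if j = 0 \<and> i = 1 then 1 else 0)"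
  have s: "smooth_strip T ?f"
    using assms(2) by (simp add: Virasoro_Bott_path_def Schwartz_strip_def)
  show ?thesis
  proof (rule pd_eqI[where D="?D", OF assms(1)])
    show "((\<lambda>s. ?D 0 j s x) has_vector_derivative ?D 0 (Suc j) t x) (at t within {0..T})"
      if "t \<in> {0..T}" for j t x
      using has_vector_derivative_add[OF smooth_strip_has_derivative_t[OF s that, of j x]
          has_vector_derivative_const[of "if j = 0 then x else 0"]] by (cases j) auto
    show "(?D i j t has_real_derivative ?D (Suc i) j t x) (at x)" if "t \<in> {0..T}" for i j t x
      using smooth_strip_has_derivative_x[OF s that, of i j x]
      by (cases "j = 0"; cases i) (auto intro!: derivative_eq_intros)
    show "\<phi> t x = ?D 0 0 t x" for t x by (simp add: pd_def)
  qed fact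
qed

lemma path_pd_bound:
  assumes "T > 0" "Virasoro_Bott_path T \<phi> \<alpha>" "j > 0 \<or> i > 1"
  obtains C where "C > 0" "\<And>t x. t \<in> {0..T} \<Longrightarrow> \<bar>pd T i j \<phi> t x\<bar> \<le> C / (1 + x\<^sup>2)"
proof -
  have "(\<lambda>t x. \<phi> t x - x) \<in> Schwartz_strip T"
    using assms(2) by (simp add: Virasoro_Bott_path_def)
  from Schwartz_strip_bound[OF this, of i j] obtain C where
    C: "C > 0" "\<And>t x. t \<in> {0..T} \<Longrightarrow> \<bar>pd T i j (\<lambda>t x. \<phi> t x - x) t x\<bar> \<le> C / (1 + x\<^sup>2)" by blast
  show ?thesis
    by (rule that[OF C(1)]) (use C(2) assms(3) in \<open>auto simp: path_pd[OF assms(1,2)]\<close>)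
qed

lemma path_slope_bound:
  assumes "T > 0" "Virasoro_Bott_path T \<phi> \<alpha>"
  obtains C where "C > 0" "\<And>t x. t \<in> {0..T} \<Longrightarrow> \<bar>pd T 1 0 \<phi> t x - 1\<bar> \<le> C / (1 + x\<^sup>2)"
proof -
  have "(\<lambda>t x. \<phi> t x - x) \<in> Schwartz_strip T"
    using assms(2) by (simp add: Virasoro_Bott_path_def)
  from Schwartz_strip_bound[OF this, of 1 0] obtain C where
    C: "C > 0" "\<And>t x. t \<in> {0..T} \<Longrightarrow> \<bar>pd T 1 0 (\<lambda>t x. \<phi> t x - x) t x\<bar> \<le> C / (1 + x\<^sup>2)" by blast
  show ?thesis
    by (rule that[OF C(1)]) (use C(2) in \<open>simp add: path_pd[OF assms]\<close>)
qed

text \<open>Decay of \<open>\<phi>_x - 1\<close> makes the slope at least \<open>1/2\<close> far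
  out. It has no zeros, hence is positive everywhere, and on the remaining compact set it attains a
  positive minimum.\<close>

lemma path_slope_lower_bound:
  assumes "T > 0" "Virasoro_Bott_path T \<phi> \<alpha>"
  obtains \<delta> where "\<delta> > 0" "\<delta> < 1" "\<And>t x. t \<in> {0..T} \<Longrightarrow> \<delta> \<le> pd T 1 0 \<phi> t x"
proof -
  obtain C where C: "C > 0" "\<And>t x. t \<in> {0..T} \<Longrightarrow> \<bar>pd T 1 0 \<phi> t x - 1\<bar> \<le> C / (1 + x\<^sup>2)"
    using path_slope_bound[OF assms] by blast
  have s: "smooth_strip T \<phi>" using assms by (simp add: Virasoro_Bott_path_def)
  \<comment> \<open>As \<open>R \<ge> 1\<close>, any \<open>x\<close> with
    \<open>\<bar>x\<bar> \<ge> R\<close> has \<open>x^2 \<ge> \<bar>x\<bar>\<close>, so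
    \<open>1 + x^2\<close> exceeds \<open>2 * C\<close> and the deviation from slope 1 is at most
    \<open>1/2\<close>.\<close>
  define R where "R = 2 * C + 1"
  have far: "1/2 \<le> pd T 1 0 \<phi> t x" if "t \<in> {0..T}" "\<bar>x\<bar> \<ge> R" for t x
  proof -
    have "\<bar>x\<bar> * 1 \<le> \<bar>x\<bar> * \<bar>x\<bar>" using that C(1) by (intro mult_left_mono) (auto simp: R_def)
    then have "2 * C \<le> 1 + x\<^sup>2" using that C(1) by (simp add: R_def power2_eq_square)
    then have "C / (1 + x\<^sup>2) \<le> 1/2" by (simp add: divide_le_eq add_pos_nonneg)
    with C(2)[OF that(1), of x] show ?thesis by linarith
  qed
  have cont: "continuous_on (strip T) (\<lambda>(t, x). pd T 1 0 \<phi> t x)"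
    by (rule smooth_strip_continuous[OF s])
  have pos: "pd T 1 0 \<phi> t x > 0" if t: "t \<in> {0..T}" for t x
  proof (rule ccontr)
    assume neg: "\<not> pd T 1 0 \<phi> t x > 0"
    have D: "\<phi> t \<in> Diff_Schwartz"
      using assms t by (auto simp: Virasoro_Bott_path_def Virasoro_Bott_def)
    have "continuous_on UNIV (pd T 1 0 \<phi> t)"
      unfolding continuous_on_eq_continuous_at[OF open_UNIV]
      using smooth_strip_has_derivative_x[OF s t] DERIV_continuous by blast
    then have *: "continuous_on {x..max x R} (pd T 1 0 \<phi> t)"
      by (rule continuous_on_subset) simp
    have "\<bar>max x R\<bar> \<ge> R" using C(1) by (simp add: R_def)
    from far[OF t this] have "0 \<le> pd T 1 0 \<phi> t (max x R)" by simp
    \<comment> \<open>Between a point of nonpositive slope and a far point to its right the slope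
      would have to vanish.\<close>
    from IVT'[of "pd T 1 0 \<phi> t", OF _ this _ *] neg
    obtain y where "pd T 1 0 \<phi> t y = 0" by auto
    then show False
      using Diff_Schwartz_deriv_nonzero[OF D, of y] by (simp add: pd_i_0)
  qed
  have cpt: "compact ({0..T} \<times> {-R..R})" by (intro compact_Times compact_Icc)
  have "R > 0" using C(1) by (simp add: R_def)
  with \<open>T > 0\<close> have ne: "{0..T} \<times> {-R..R} \<noteq> {}" by auto
  from continuous_attains_inf[OF cpt ne continuous_on_subset[OF cont]]
  obtain p where p: "p \<in> {0..T} \<times> {-R..R}"
    "\<forall>q\<in>{0..T} \<times> {-R..R}. (\<lambda>(t, x). pd T 1 0 \<phi> t x) p \<le> (\<lambda>(t, x). pd T 1 0 \<phi> t x) q" by blast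
  define m where "m = (\<lambda>(t, x). pd T 1 0 \<phi> t x) p"
  have m: "m > 0" using p(1) pos by (auto simp: m_def)
  have near: "m \<le> pd T 1 0 \<phi> t x" if "t \<in> {0..T}" "\<bar>x\<bar> \<le> R" for t x
    using bspec[OF p(2), of "(t, x)"] that by (auto simp: m_def abs_le_iff)
  show ?thesis
  proof
    show "min m (1/2) > 0" "min m (1/2) < 1" using m by auto
    show "min m (1/2) \<le> pd T 1 0 \<phi> t x" if "t \<in> {0..T}" for t x
      using near[OF that, of x] far[OF that, of x] by (cases "\<bar>x\<bar> \<le> R") auto
  qed
qed

text \<open>The uniform lower bound \<open>\<delta>\<close> on the slope tolerates any
  \<open>s\<close> with \<open>\<bar>s\<bar> * C < \<delta>\<close>, where \<open>C\<close> bounds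
  \<open>h_x\<close>; this one threshold works for all \<open>t\<close> and
  \<open>x\<close>.\<close>

lemma perturbed_path:
  assumes "T > 0" "Virasoro_Bott_path T \<phi> \<alpha>" "h \<in> Schwartz_strip T" "\<eta> \<in> smooth_Icc T"
  shows "\<forall>\<^sub>F s in nhds 0. Virasoro_Bott_path T (\<lambda>t x. \<phi> t x + s * h t x) (\<lambda>t. \<alpha> t + s * \<eta> t)"
proof -
  obtain \<delta> where \<delta>: "\<delta> > 0" "\<delta> < 1" "\<And>t x. t \<in> {0..T} \<Longrightarrow> \<delta> \<le> pd T 1 0 \<phi> t x"
    by (rule path_slope_lower_bound[OF assms(1,2)]) (rule that, assumption+)
  obtain C where C: "C > 0" "\<And>t x. t \<in> {0..T} \<Longrightarrow> \<bar>pd T 1 0 h t x\<bar> \<le> C / (1 + x\<^sup>2)"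
    by (rule Schwartz_strip_bound[OF assms(3)]) (rule that, assumption+)
  have C': "\<bar>pd T 1 0 h t x\<bar> \<le> C" if "t \<in> {0..T}" for t x
  proof -
    have "C / (1 + x\<^sup>2) \<le> C / 1" using C(1) by (intro divide_left_mono) (auto intro: add_pos_nonneg)
    with C(2)[OF that, of x] show ?thesis by simp
  qed
  have "\<forall>\<^sub>F s in nhds (0::real). 0 + \<bar>s\<bar> * C < \<delta>"
    by (rule eventually_in_seminorm_ball[of "\<lambda>x. x"]) (use \<delta> in auto)
  then show ?thesis
  proof eventually_elim
    case (elim s)
    let ?\<psi> = "\<lambda>t x. \<phi> t x + s * h t x"
    let ?f = "\<lambda>t x. \<phi> t x - x"
    have f: "?f \<in> Schwartz_strip T" "smooth_strip T \<phi>" "\<alpha> \<in> smooth_Icc T"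
      using assms(2) by (auto simp: Virasoro_Bott_path_def)
    have h: "smooth_strip T h" using assms(3) by (simp add: Schwartz_strip_def)
    have g: "(\<lambda>t x. ?f t x + s * h t x) \<in> Schwartz_strip T"
      by (rule Schwartz_strip_add_scaled[OF assms(1) f(1) assms(3)])
    have eq: "(\<lambda>t x. ?f t x + s * h t x) = (\<lambda>t x. ?\<psi> t x - x)"
      by (simp add: algebra_simps)
    have "?\<psi> t \<in> Diff_Schwartz" if t: "t \<in> {0..T}" for t
    proof -
      have "(\<lambda>x. x + (\<lambda>x. ?f t x + s * h t x) x) \<in> Diff_Schwartz"
      proof (rule Id_plus_Schwartz_in_Diff)
        show "(\<lambda>x. ?f t x + s * h t x) \<in> Schwartz_real"
          using Schwartz_strip_slice[OF g t] by simp
        fix x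
        have "deriv (\<lambda>x. ?f t x + s * h t x) x = pd T 1 0 (\<lambda>t x. ?f t x + s * h t x) t x"
          by (simp add: pd_i_0)
        also have "\<dots> = pd T 1 0 ?f t x + s * pd T 1 0 h t x"
          using f(1) h t by (intro pd_add_scaled) (auto simp: Schwartz_strip_def assms(1))
        finally have "1 + deriv (\<lambda>x. ?f t x + s * h t x) x = pd T 1 0 \<phi> t x + s * pd T 1 0 h t x"
          using path_pd[OF assms(1,2) t, of 1 0 x] by simp
        moreover have "\<bar>s * pd T 1 0 h t x\<bar> \<le> \<bar>s\<bar> * C"
          unfolding abs_mult by (intro mult_left_mono C' t) simp
        ultimately show "1 + deriv (\<lambda>x. ?f t x + s * h t x) x > 0"
          using \<delta>(3)[OF t, of x] elim by (simp add: abs_le_iff)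
      qed
      then show ?thesis by (simp add: algebra_simps)
    qed
    then show ?case
      using smooth_Icc_add_scaled[OF assms(1) f(3) assms(4)] smooth_strip_add_scaled[OF assms(1) f(2) h] g
      by (auto simp: Virasoro_Bott_path_def Virasoro_Bott_def eq)
  qed
qed

subsection \<open>Integrals over space\<close>

definition strip_bounded :: "real \<Rightarrow> (real \<Rightarrow> real \<Rightarrow> real) \<Rightarrow> bool" where
  "strip_bounded T f \<longleftrightarrow> continuous_on (strip T) (\<lambda>(t, x). f t x) \<and>
    (\<exists>C. \<forall>t\<in>{0..T}. \<forall>x. \<bar>f t x\<bar> \<le> C)"

text \<open>One integrable majorant for all \<open>t\<close> allows dominated convergence in
  \<open>t\<close>. Products with \<open>strip_bounded\<close> factors stay in the class, so a
  density qualifies as soon as one of its factors decays.\<close>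

definition strip_decaying :: "real \<Rightarrow> (real \<Rightarrow> real \<Rightarrow> real) \<Rightarrow> bool" where
  "strip_decaying T f \<longleftrightarrow> continuous_on (strip T) (\<lambda>(t, x). f t x) \<and>
    (\<exists>C. \<forall>t\<in>{0..T}. \<forall>x. \<bar>f t x\<bar> \<le> C / (1 + x\<^sup>2))"

definition x_integral :: "(real \<Rightarrow> real \<Rightarrow> real) \<Rightarrow> real \<Rightarrow> real" where
  "x_integral f t = (LINT x|lborel. f t x)"

text \<open>This rule and the three after it, applied backwards along the syntax of a polynomial
  expression, bound its absolute value by the same expression in the bounds with each minus turned
  into plus. This is why many bounds below are first stated unsimplified.\<close>

lemma abs_add_le: "\<bar>a\<bar> \<le> A \<Longrightarrow> \<bar>b\<bar> \<le> B \<Longrightarrow> \<bar>a + b\<bar> \<le> A + (B::real)"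
  by linarith

lemma abs_diff_le: "\<bar>a\<bar> \<le> A \<Longrightarrow> \<bar>b\<bar> \<le> B \<Longrightarrow> \<bar>a - b\<bar> \<le> A + (B::real)"
  by linarith

lemma abs_mult_le: "\<bar>a\<bar> \<le> A \<Longrightarrow> \<bar>b\<bar> \<le> B \<Longrightarrow> \<bar>a * b\<bar> \<le> A * (B::real)"
  unfolding abs_mult by (rule mult_mono) auto

lemma abs_power_le: "\<bar>a\<bar> \<le> A \<Longrightarrow> \<bar>a ^ n\<bar> \<le> (A::real) ^ n"
  unfolding power_abs by (rule power_mono) auto

lemma strip_bounded_const: "strip_bounded T (\<lambda>t x. c)"
  by (auto simp: strip_bounded_def case_prod_unfold intro!: exI[of _ "\<bar>c\<bar>"] continuous_intros)

lemma strip_boundedI: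
  assumes "continuous_on (strip T) (\<lambda>(t, x). f t x)" "\<And>t x. t \<in> {0..T} \<Longrightarrow> \<bar>f t x\<bar> \<le> C"
  shows "strip_bounded T f"
  unfolding strip_bounded_def by (intro conjI exI[of _ C] ballI allI assms)

lemma strip_boundedE:
  assumes "strip_bounded T f"
  obtains C where "\<And>t x. t \<in> {0..T} \<Longrightarrow> \<bar>f t x\<bar> \<le> C"
proof -
  obtain C where "\<forall>t\<in>{0..T}. \<forall>x. \<bar>f t x\<bar> \<le> C"
    using assms by (auto simp: strip_bounded_def)
  then show ?thesis by (intro that[of C]) blast
qed

lemma strip_bounded_continuous: "strip_bounded T f \<Longrightarrow> continuous_on (strip T) (\<lambda>(t, x). f t x)"
  by (simp add: strip_bounded_def)

lemma strip_bounded_mult: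
  assumes "strip_bounded T f" "strip_bounded T g"
  shows "strip_bounded T (\<lambda>t x. f t x * g t x)"
proof -
  obtain C D where "\<And>t x. t \<in> {0..T} \<Longrightarrow> \<bar>f t x\<bar> \<le> C" "\<And>t x. t \<in> {0..T} \<Longrightarrow> \<bar>g t x\<bar> \<le> D"
    using assms by (elim strip_boundedE) (rule that)
  then show ?thesis
    using continuous_on_mult[OF assms[THEN strip_bounded_continuous]]
    by (intro strip_boundedI[OF _ abs_mult_le]) (auto simp: case_prod_unfold)
qed

lemma strip_bounded_add:
  assumes "strip_bounded T f" "strip_bounded T g"
  shows "strip_bounded T (\<lambda>t x. f t x + g t x)"
proof -
  obtain C D where "\<And>t x. t \<in> {0..T} \<Longrightarrow> \<bar>f t x\<bar> \<le> C" "\<And>t x. t \<in> {0..T} \<Longrightarrow> \<bar>g t x\<bar> \<le> D"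
    using assms by (elim strip_boundedE) (rule that)
  then show ?thesis
    using continuous_on_add[OF assms[THEN strip_bounded_continuous]]
    by (intro strip_boundedI[OF _ abs_add_le]) (auto simp: case_prod_unfold)
qed

lemma strip_bounded_power:
  assumes "strip_bounded T f"
  shows "strip_bounded T (\<lambda>t x. f t x ^ n)"
proof (induction n)
  case 0
  then show ?case using strip_bounded_const[of T 1] by simp
next
  case (Suc n)
  then show ?case using strip_bounded_mult[OF assms] by simp
qed

lemma strip_bounded_inverse:
  assumes "strip_bounded T f" "\<delta> > 0" "\<And>t x. t \<in> {0..T} \<Longrightarrow> \<delta> \<le> f t x"
  shows "strip_bounded T (\<lambda>t x. inverse (f t x))"
  unfolding strip_bounded_def case_prod_unfold
proof
  have nz: "f t x > 0" if "t \<in> {0..T}" for t x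
    using assms(2) assms(3)[OF that, of x] by linarith
  have ne: "f (fst p) (snd p) \<noteq> 0" if "p \<in> strip T" for p
    using nz[of "fst p" "snd p"] that by auto
  show "continuous_on (strip T) (\<lambda>p. inverse (f (fst p) (snd p)))"
    using assms(1) ne by (intro continuous_on_inverse) (auto simp: strip_bounded_def case_prod_unfold)
  have "\<bar>inverse (f t x)\<bar> \<le> inverse \<delta>" if "t \<in> {0..T}" for t x
    using nz[OF that, of x] assms(2) assms(3)[OF that, of x] by (auto intro: le_imp_inverse_le)
  then show "\<exists>C. \<forall>t\<in>{0..T}. \<forall>x. \<bar>inverse (f t x)\<bar> \<le> C" by blast
qed

lemma strip_decaying_mult_bounded:
  assumes "strip_decaying T f" "strip_bounded T g"
  shows "strip_decaying T (\<lambda>t x. f t x * g t x)" "strip_decaying T (\<lambda>t x. g t x * f t x)"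
proof -
  obtain C where C: "\<forall>t\<in>{0..T}. \<forall>x. \<bar>f t x\<bar> \<le> C / (1 + x\<^sup>2)"
    using assms(1) by (auto simp: strip_decaying_def)
  obtain D where D: "\<forall>t\<in>{0..T}. \<forall>x. \<bar>g t x\<bar> \<le> D"
    using assms(2) by (auto simp: strip_bounded_def)
  have "\<bar>f t x * g t x\<bar> \<le> (C * D) / (1 + x\<^sup>2)" if "t \<in> {0..T}" for t x
    using abs_mult_le[OF C[rule_format, OF that, of x] D[rule_format, OF that, of x]] by simp
  then have *: "\<exists>E. \<forall>t\<in>{0..T}. \<forall>x. \<bar>f t x * g t x\<bar> \<le> E / (1 + x\<^sup>2)" by blast
  show "strip_decaying T (\<lambda>t x. f t x * g t x)"
    using assms * unfolding strip_decaying_def strip_bounded_def case_prod_unfold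
    by (intro conjI continuous_on_mult) auto
  then show "strip_decaying T (\<lambda>t x. g t x * f t x)"
    by (simp add: mult.commute)
qed

lemma strip_decaying_imp_bounded:
  assumes "strip_decaying T f"
  shows "strip_bounded T f"
proof -
  obtain C where C: "\<forall>t\<in>{0..T}. \<forall>x. \<bar>f t x\<bar> \<le> C / (1 + x\<^sup>2)"
    using assms by (auto simp: strip_decaying_def)
  have "\<bar>f t x\<bar> \<le> \<bar>C\<bar>" if "t \<in> {0..T}" for t x
  proof -
    have "C / (1 + x\<^sup>2) \<le> \<bar>C\<bar> / 1"
      by (intro frac_le) auto
    with C[rule_format, OF that, of x] show ?thesis by simp
  qed
  with assms show ?thesis by (intro strip_boundedI[of T f "\<bar>C\<bar>"]) (auto simp: strip_decaying_def)
qed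

lemma strip_decaying_cmult: "strip_decaying T f \<Longrightarrow> strip_decaying T (\<lambda>t x. c * f t x)"
  by (rule strip_decaying_mult_bounded[OF _ strip_bounded_const])

lemma strip_decaying_add:
  assumes "strip_decaying T f" "strip_decaying T g"
  shows "strip_decaying T (\<lambda>t x. f t x + g t x)"
proof -
  obtain C where C: "\<forall>t\<in>{0..T}. \<forall>x. \<bar>f t x\<bar> \<le> C / (1 + x\<^sup>2)"
    using assms(1) by (auto simp: strip_decaying_def)
  obtain D where D: "\<forall>t\<in>{0..T}. \<forall>x. \<bar>g t x\<bar> \<le> D / (1 + x\<^sup>2)"
    using assms(2) by (auto simp: strip_decaying_def)
  have "\<bar>f t x + g t x\<bar> \<le> (C + D) / (1 + x\<^sup>2)" if "t \<in> {0..T}" for t x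
    using abs_add_le[OF C[rule_format, OF that, of x] D[rule_format, OF that, of x]]
    by (simp add: add_divide_distrib)
  then have *: "\<exists>E. \<forall>t\<in>{0..T}. \<forall>x. \<bar>f t x + g t x\<bar> \<le> E / (1 + x\<^sup>2)" by blast
  then show ?thesis
    using assms * unfolding strip_decaying_def strip_bounded_def case_prod_unfold
    by (intro conjI continuous_on_add) auto
qed

lemma strip_decaying_diff:
  assumes "strip_decaying T f" "strip_decaying T g"
  shows "strip_decaying T (\<lambda>t x. f t x - g t x)"
  using strip_decaying_add[OF assms(1) strip_decaying_cmult[OF assms(2), of "-1"]] by simp

lemma integrable_1_plus_square: "integrable lborel (\<lambda>x::real. C / (1 + x\<^sup>2))"
  and integral_1_plus_square: "(LINT x|lborel. C / (1 + x\<^sup>2)) = C * pi"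
proof -
  have "integrable lborel (\<lambda>x::real. inverse (1 + x\<^sup>2))"
    using integrable_inverse_1_plus_square by (simp add: set_integrable_def)
  then show "integrable lborel (\<lambda>x::real. C / (1 + x\<^sup>2))"
    unfolding divide_inverse by (rule integrable_mult_right)
  have "(LINT x|lborel. inverse (1 + x\<^sup>2)) = pi"
    using LBINT_inverse_1_plus_square
    by (simp add: interval_lebesgue_integral_def set_lebesgue_integral_def)
  then show "(LINT x|lborel. C / (1 + x\<^sup>2)) = C * pi"
    by (simp add: divide_inverse)
qed

lemma strip_decaying_slice:
  assumes "strip_decaying T f" "t \<in> {0..T}"
  shows "continuous_on UNIV (f t)"
proof -
  have "continuous_on UNIV (\<lambda>x. (\<lambda>(t, x). f t x) (t, x))"
    by (rule continuous_on_compose2[where t="strip T"])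
       (use assms in \<open>auto simp: strip_decaying_def intro!: continuous_intros\<close>)
  then show ?thesis by simp
qed

lemma strip_decaying_integrable:
  assumes "strip_decaying T f" "t \<in> {0..T}"
  shows "integrable lborel (f t)"
proof -
  obtain C where C: "\<forall>t\<in>{0..T}. \<forall>x. \<bar>f t x\<bar> \<le> C / (1 + x\<^sup>2)"
    using assms(1) by (auto simp: strip_decaying_def)
  show ?thesis
  proof (rule Bochner_Integration.integrable_bound[OF integrable_1_plus_square[of C]])
    show "f t \<in> borel_measurable lborel"
      using borel_measurable_continuous_onI[OF strip_decaying_slice[OF assms]] by simp
    have "\<bar>f t x\<bar> \<le> norm (C / (1 + x\<^sup>2))" for x
      using C[rule_format, OF assms(2), of x] by (rule order_trans) (simp only: real_norm_def abs_ge_self)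
    then show "AE x in lborel. norm (f t x) \<le> norm (C / (1 + x\<^sup>2))" by simp
  qed
qed

lemma x_integral_bound:
  assumes "strip_decaying T f" "t \<in> {0..T}" "\<And>x. \<bar>f t x\<bar> \<le> C / (1 + x\<^sup>2)"
  shows "\<bar>x_integral f t\<bar> \<le> C * pi"
proof -
  have "\<bar>x_integral f t\<bar> \<le> (LINT x|lborel. C / (1 + x\<^sup>2))"
    unfolding x_integral_def
    using Bochner_Integration.integral_norm_bound_integral[OF strip_decaying_integrable[OF assms(1,2)]
        integrable_1_plus_square[of C]] assms(3) by simp
  then show ?thesis by (simp only: integral_1_plus_square)
qed

text \<open>Dominated convergence along sequences, with the majorant common to all
  \<open>t\<close>.\<close>

lemma x_integral_continuous:
  assumes "strip_decaying T f"
  shows "continuous_on {0..T} (x_integral f)"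
  unfolding continuous_on_sequentially
proof (intro allI ballI impI)
  fix X t assume t: "t \<in> {0..T}" and X: "(\<forall>n. X n \<in> {0..T}) \<and> X \<longlonglongrightarrow> t"
  obtain C where C: "\<forall>t\<in>{0..T}. \<forall>x. \<bar>f t x\<bar> \<le> C / (1 + x\<^sup>2)"
    using assms by (auto simp: strip_decaying_def)
  have cont: "continuous_on (strip T) (\<lambda>(t, x). f t x)"
    using assms by (simp add: strip_decaying_def)
  have "(\<lambda>n. LINT x|lborel. f (X n) x) \<longlonglongrightarrow> (LINT x|lborel. f t x)"
  proof (rule integral_dominated_convergence[where w="\<lambda>x. C / (1 + x\<^sup>2)"])
    show "f t \<in> borel_measurable lborel" "f (X n) \<in> borel_measurable lborel" for n
      using borel_measurable_integrable[OF strip_decaying_integrable[OF assms]] t X by auto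
    show "integrable lborel (\<lambda>x. C / (1 + x\<^sup>2))" by (rule integrable_1_plus_square)
    show "AE x in lborel. norm (f (X n) x) \<le> C / (1 + x\<^sup>2)" for n
      using C X by simp
    have "(\<lambda>n. f (X n) x) \<longlonglongrightarrow> f t x" for x
    proof -
      have "(\<lambda>n. (X n, x)) \<longlonglongrightarrow> (t, x)"
        using X by (intro tendsto_intros) auto
      then have "((\<lambda>(t, x). f t x) \<circ> (\<lambda>n. (X n, x))) \<longlonglongrightarrow> (\<lambda>(t, x). f t x) (t, x)"
        using cont[unfolded continuous_on_sequentially, rule_format, of "(t, x)" "\<lambda>n. (X n, x)"] t X by auto
      then show ?thesis by (simp add: o_def)
    qed
    then show "AE x in lborel. (\<lambda>n. f (X n) x) \<longlonglongrightarrow> f t x" by simp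
  qed
  then show "(x_integral f \<circ> X) \<longlonglongrightarrow> x_integral f t"
    by (simp add: o_def x_integral_def)
qed

lemma x_integral_add:
  assumes "strip_decaying T f" "strip_decaying T g" "t \<in> {0..T}"
  shows "x_integral (\<lambda>t x. f t x + g t x) t = x_integral f t + x_integral g t"
  unfolding x_integral_def
  by (rule Bochner_Integration.integral_add) (rule strip_decaying_integrable[OF assms(1,3)], rule strip_decaying_integrable[OF assms(2,3)])

lemma x_integral_cmult: "x_integral (\<lambda>t x. c * f t x) t = c * x_integral f t"
  by (simp add: x_integral_def)

lemma Schwartz_strip_decaying:
  assumes "h \<in> Schwartz_strip T"
  shows "strip_decaying T (pd T i j h)"
proof -
  obtain C where "C > 0" "\<And>t x. t \<in> {0..T} \<Longrightarrow> \<bar>pd T i j h t x\<bar> \<le> C / (1 + x\<^sup>2)"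
    by (rule Schwartz_strip_bound[OF assms]) (rule that, assumption+)
  moreover have "smooth_strip T h" using assms by (simp add: Schwartz_strip_def)
  ultimately show ?thesis
    unfolding strip_decaying_def using smooth_strip_continuous by blast
qed

lemma path_pd_decaying:
  assumes "T > 0" "Virasoro_Bott_path T \<phi> \<alpha>" "j > 0 \<or> i > 1"
  shows "strip_decaying T (pd T i j \<phi>)"
proof -
  obtain C where "C > 0" "\<And>t x. t \<in> {0..T} \<Longrightarrow> \<bar>pd T i j \<phi> t x\<bar> \<le> C / (1 + x\<^sup>2)"
    by (rule path_pd_bound[OF assms]) (rule that, assumption+)
  moreover have "smooth_strip T \<phi>" using assms by (simp add: Virasoro_Bott_path_def)
  ultimately show ?thesis
    unfolding strip_decaying_def using smooth_strip_continuous by blast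
qed

lemma path_slope_bounded:
  assumes "T > 0" "Virasoro_Bott_path T \<phi> \<alpha>"
  shows "strip_bounded T (pd T 1 0 \<phi>)"
proof -
  have "smooth_strip T \<phi>" using assms by (simp add: Virasoro_Bott_path_def)
  then have cont: "continuous_on (strip T) (\<lambda>(t, x). pd T 1 0 \<phi> t x)"
    by (rule smooth_strip_continuous)
  obtain C where C: "C > 0" "\<And>t x. t \<in> {0..T} \<Longrightarrow> \<bar>pd T 1 0 \<phi> t x - 1\<bar> \<le> C / (1 + x\<^sup>2)"
    by (rule path_slope_bound[OF assms]) (rule that, assumption+)
  have "\<bar>pd T 1 0 \<phi> t x\<bar> \<le> C + 1" if "t \<in> {0..T}" for t x
  proof -
    have "C / (1 + x\<^sup>2) \<le> C / 1" using C(1) by (intro divide_left_mono) (auto intro: add_pos_nonneg)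
    with C(2)[OF that, of x] show ?thesis by linarith
  qed
  then show ?thesis by (rule strip_boundedI[OF cont])
qed

lemma path_inverse_slope_bounded:
  assumes "T > 0" "Virasoro_Bott_path T \<phi> \<alpha>"
  shows "strip_bounded T (\<lambda>t x. inverse (pd T 1 0 \<phi> t x))"
proof -
  obtain \<delta> where "\<delta> > 0" "\<delta> < 1" "\<And>t x. t \<in> {0..T} \<Longrightarrow> \<delta> \<le> pd T 1 0 \<phi> t x"
    by (rule path_slope_lower_bound[OF assms]) (rule that, assumption+)
  then show ?thesis
    by (intro strip_bounded_inverse[OF path_slope_bounded[OF assms]])
qed

section \<open>The two densities of the energy\<close>

definition kinetic_density :: "real \<Rightarrow> (real \<Rightarrow> real \<Rightarrow> real) \<Rightarrow> real \<Rightarrow> real \<Rightarrow> real" where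
  "kinetic_density T \<phi> t x = (pd T 0 1 \<phi> t x)\<^sup>2 * pd T 1 0 \<phi> t x"

text \<open>Division by the squared slope is written with \<open>inverse\<close>, so that the
  density is a polynomial in bounded functions, the inverse slope being one of them.\<close>

definition cocycle_density :: "real \<Rightarrow> (real \<Rightarrow> real \<Rightarrow> real) \<Rightarrow> real \<Rightarrow> real \<Rightarrow> real" where
  "cocycle_density T \<phi> t x =
    pd T 1 1 \<phi> t x * pd T 2 0 \<phi> t x * (inverse (pd T 1 0 \<phi> t x))\<^sup>2"

lemma energy_eq:
  "energy T \<phi> \<alpha> = (LINT t:{0..T}|lborel. x_integral (kinetic_density T \<phi>) t) +
    (LINT t:{0..T}|lborel. (dt T \<alpha> t - x_integral (cocycle_density T \<phi>) t)\<^sup>2)"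
  by (simp add: energy_def x_integral_def kinetic_density_def cocycle_density_def pd_def
      numeral_2_eq_2 divide_inverse power_inverse)

lemma kinetic_density_decaying:
  assumes "T > 0" "Virasoro_Bott_path T \<phi> \<alpha>"
  shows "strip_decaying T (kinetic_density T \<phi>)"
  unfolding kinetic_density_def[abs_def] power2_eq_square
  using path_pd_decaying[OF assms, of 1 0] path_slope_bounded[OF assms]
  by (intro strip_decaying_mult_bounded(1)) (auto intro: strip_decaying_imp_bounded)

lemma cocycle_density_decaying:
  assumes "T > 0" "Virasoro_Bott_path T \<phi> \<alpha>"
  shows "strip_decaying T (cocycle_density T \<phi>)"
  unfolding cocycle_density_def[abs_def]
  using path_pd_decaying[OF assms, of 1 1] path_pd_decaying[OF assms, of 0 2]
    path_inverse_slope_bounded[OF assms]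
  by (intro strip_decaying_mult_bounded(1) strip_bounded_power) (auto intro: strip_decaying_imp_bounded)

subsection \<open>The second variation of the energy\<close>

text \<open>The coefficients of \<open>e\<close> and \<open>e\<^sup>2\<close> in the densities of \<open>\<phi> + e h\<close>.\<close>

definition cocycle_first :: "real \<Rightarrow> (real \<Rightarrow> real \<Rightarrow> real) \<Rightarrow> (real \<Rightarrow> real \<Rightarrow> real) \<Rightarrow> real \<Rightarrow> real \<Rightarrow> real" where
  "cocycle_first T \<phi> h t x =
    (let a = pd T 1 1 \<phi> t x; b = pd T 2 0 \<phi> t x; u = inverse (pd T 1 0 \<phi> t x);
         a' = pd T 1 1 h t x; b' = pd T 2 0 h t x; p' = pd T 1 0 h t x
     in (a' * b + a * b') * u\<^sup>2 - 2 * p' * a * b * u ^ 3)"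

definition cocycle_second :: "real \<Rightarrow> (real \<Rightarrow> real \<Rightarrow> real) \<Rightarrow> (real \<Rightarrow> real \<Rightarrow> real) \<Rightarrow> real \<Rightarrow> real \<Rightarrow> real" where
  "cocycle_second T \<phi> h t x =
    (let a = pd T 1 1 \<phi> t x; b = pd T 2 0 \<phi> t x; u = inverse (pd T 1 0 \<phi> t x);
         a' = pd T 1 1 h t x; b' = pd T 2 0 h t x; p' = pd T 1 0 h t x
     in a' * b' * u\<^sup>2 - 2 * p' * (a' * b + a * b') * u ^ 3 + 3 * p'\<^sup>2 * a * b * u ^ 4)"

definition kinetic_second :: "real \<Rightarrow> (real \<Rightarrow> real \<Rightarrow> real) \<Rightarrow> (real \<Rightarrow> real \<Rightarrow> real) \<Rightarrow> real \<Rightarrow> real \<Rightarrow> real" where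
  "kinetic_second T \<phi> h t x = (pd T 0 1 h t x)\<^sup>2 * pd T 1 0 \<phi> t x +
     2 * pd T 0 1 \<phi> t x * pd T 0 1 h t x * pd T 1 0 h t x"

text \<open>With first and second cocycle coefficients \<open>J1\<close> and \<open>J2\<close>, the
  square of \<open>w - e * J1 - e^2 * J2\<close> has \<open>e^2\<close>-coefficient
  \<open>J1^2 - 2 * w * J2\<close>. The result is the Taylor coefficient of the energy, that is half
  of the second derivative.\<close>

definition second_variation :: "real \<Rightarrow> (real \<Rightarrow> real \<Rightarrow> real) \<Rightarrow> real \<Rightarrow> (real \<Rightarrow> real \<Rightarrow> real) \<Rightarrow> real" where
  "second_variation T \<phi> w h = (LINT t:{0..T}|lborel. x_integral (kinetic_second T \<phi> h) t) +
    (LINT t:{0..T}|lborel. (x_integral (cocycle_first T \<phi> h) t)\<^sup>2 - 2 * w * x_integral (cocycle_second T \<phi> h) t)"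

text \<open>Taylor expansion of the inverse square to second order, with exact remainder. The factor
  \<open>p'\<close> is pulled out besides \<open>e ^ 3\<close>: in the application it is
  \<open>h_x\<close>, whose decay makes the remainder integrable over the line.\<close>

lemma rational_expansion_remainder:
  fixes a b p a' b' p' e :: real
  assumes "p \<noteq> 0" "p + e * p' \<noteq> 0"
  defines "u \<equiv> inverse p" and "v \<equiv> inverse (p + e * p')"
  shows "(a + e * a') * (b + e * b') * v\<^sup>2 - (a * b * u\<^sup>2
      + e * ((a' * b + a * b') * u\<^sup>2 - 2 * p' * a * b * u ^ 3)
      + e\<^sup>2 * (a' * b' * u\<^sup>2 - 2 * p' * (a' * b + a * b') * u ^ 3 + 3 * p'\<^sup>2 * a * b * u ^ 4))
    = e ^ 3 * (p' * (3 * (a * b' + a' * b) * p' * u ^ 4 - 2 * a' * b' * u ^ 3 + 3 * e * a' * b' * p' * u ^ 4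
      - (a + e * a') * (b + e * b') * (4 * p'\<^sup>2 * p + 3 * e * p' ^ 3) * u ^ 4 * v\<^sup>2))"
proof -
  have u: "u * p = 1" and v: "v * (p + e * p') = 1"
    using assms(1,2) by (simp_all add: u_def v_def)
  have "v\<^sup>2 = u\<^sup>2 - 2 * e * p' * u ^ 3 + 3 * e\<^sup>2 * p'\<^sup>2 * u ^ 4
      - e ^ 3 * p' * (4 * p'\<^sup>2 * p + 3 * e * p' ^ 3) * u ^ 4 * v\<^sup>2"
  proof -
    \<comment> \<open>Clearing the denominators \<open>p ^ 4 * (p + e * p')^2\<close> leaves a
      polynomial identity that follows from \<open>u * p = 1\<close> and
      \<open>v * (p + e * p') = 1\<close>.\<close>
    have "p ^ 4 * (p + e * p')\<^sup>2 * (u\<^sup>2 - 2 * e * p' * u ^ 3 + 3 * e\<^sup>2 * p'\<^sup>2 * u ^ 4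
      - e ^ 3 * p' * (4 * p'\<^sup>2 * p + 3 * e * p' ^ 3) * u ^ 4 * v\<^sup>2) = p ^ 4"
      using u v by algebra
    moreover have "p ^ 4 * (p + e * p')\<^sup>2 * v\<^sup>2 = p ^ 4"
      using v by algebra
    ultimately show ?thesis
      using assms(1,2) by (metis (no_types, lifting) mult_cancel_left mult_eq_0_iff power_not_zero)
  qed
  then show ?thesis by algebra
qed

lemma rational_expansion_bound:
  fixes L :: real
  obtains K where "\<And>a b p a' b' p' e. \<bar>a\<bar> \<le> L \<Longrightarrow> \<bar>b\<bar> \<le> L \<Longrightarrow> \<bar>a'\<bar> \<le> L \<Longrightarrow> \<bar>b'\<bar> \<le> L \<Longrightarrow>
      \<bar>p'\<bar> \<le> L \<Longrightarrow> \<bar>p\<bar> \<le> L \<Longrightarrow> \<bar>inverse p\<bar> \<le> L \<Longrightarrow> \<bar>inverse (p + e * p')\<bar> \<le> L \<Longrightarrow> \<bar>e\<bar> \<le> 1 \<Longrightarrow>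
      p \<noteq> 0 \<Longrightarrow> p + e * p' \<noteq> 0 \<Longrightarrow>
      \<bar>(a + e * a') * (b + e * b') * (inverse (p + e * p'))\<^sup>2 - (a * b * (inverse p)\<^sup>2
      + e * ((a' * b + a * b') * (inverse p)\<^sup>2 - 2 * p' * a * b * inverse p ^ 3)
      + e\<^sup>2 * (a' * b' * (inverse p)\<^sup>2 - 2 * p' * (a' * b + a * b') * inverse p ^ 3 + 3 * p'\<^sup>2 * a * b * inverse p ^ 4))\<bar>
      \<le> \<bar>e\<bar> ^ 3 * (\<bar>p'\<bar> * K)"
proof -
  \<comment> \<open>The bracket of the exact remainder with every factor replaced by its bound. The
    factors \<open>1\<close> stand for \<open>\<bar>e\<bar> \<le> 1\<close>, and the shape is kept
    so that the rules for absolute values match.\<close>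
  define K where "K = 3 * (L * L + L * L) * L * L ^ 4 + 2 * L * L * L ^ 3 + 3 * 1 * L * L * L * L ^ 4 +
      (L + 1 * L) * (L + 1 * L) * (4 * L\<^sup>2 * L + 3 * 1 * L ^ 3) * L ^ 4 * L\<^sup>2"
  have c: "\<bar>2\<bar> \<le> (2::real)" "\<bar>3\<bar> \<le> (3::real)" "\<bar>4\<bar> \<le> (4::real)" by simp_all
  show ?thesis
  proof (rule that)
    fix a b p a' b' p' e :: real
    assume A: "\<bar>a\<bar> \<le> L" "\<bar>b\<bar> \<le> L" "\<bar>a'\<bar> \<le> L" "\<bar>b'\<bar> \<le> L" "\<bar>p'\<bar> \<le> L" "\<bar>p\<bar> \<le> L"
      "\<bar>inverse p\<bar> \<le> L" "\<bar>inverse (p + e * p')\<bar> \<le> L" "\<bar>e\<bar> \<le> 1" and nz: "p \<noteq> 0" "p + e * p' \<noteq> 0"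
    show "\<bar>(a + e * a') * (b + e * b') * (inverse (p + e * p'))\<^sup>2 - (a * b * (inverse p)\<^sup>2
      + e * ((a' * b + a * b') * (inverse p)\<^sup>2 - 2 * p' * a * b * inverse p ^ 3)
      + e\<^sup>2 * (a' * b' * (inverse p)\<^sup>2 - 2 * p' * (a' * b + a * b') * inverse p ^ 3 + 3 * p'\<^sup>2 * a * b * inverse p ^ 4))\<bar>
      \<le> \<bar>e\<bar> ^ 3 * (\<bar>p'\<bar> * K)"
      unfolding rational_expansion_remainder[OF nz] abs_mult[of "e ^ 3"] abs_mult[of p'] power_abs K_def
      by (intro mult_left_mono abs_diff_le abs_add_le abs_mult_le abs_power_le A c) auto
  qed
qed

lemma set_integrable_continuous: "continuous_on {0..T} F \<Longrightarrow> set_integrable lborel {0..T} F"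
  for F :: "real \<Rightarrow> real"
  by (rule borel_integrable_atLeastAtMost')

lemma x_integral_cong: "(\<And>x. f t x = g t x) \<Longrightarrow> x_integral f t = x_integral g t"
  by (simp add: x_integral_def)

lemma x_integral_add_scaled:
  assumes "strip_decaying T f" "strip_decaying T g" "t \<in> {0..T}"
  shows "x_integral (\<lambda>t x. f t x + c * g t x) t = x_integral f t + c * x_integral g t"
  using x_integral_add[OF assms(1) strip_decaying_cmult[OF assms(2)] assms(3)]
  by (simp add: x_integral_cmult)

lemma strip_decaying_bound:
  assumes "strip_decaying T f"
  obtains C where "\<And>t x. t \<in> {0..T} \<Longrightarrow> \<bar>f t x\<bar> \<le> C / (1 + x\<^sup>2)"
proof -
  obtain C where "\<forall>t\<in>{0..T}. \<forall>x. \<bar>f t x\<bar> \<le> C / (1 + x\<^sup>2)"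
    using assms by (auto simp: strip_decaying_def)
  then show ?thesis by (intro that[of C]) blast
qed

lemma x_integral_bounded:
  assumes "strip_decaying T f"
  obtains C where "\<And>t. t \<in> {0..T} \<Longrightarrow> \<bar>x_integral f t\<bar> \<le> C"
proof -
  obtain C where C: "\<And>t x. t \<in> {0..T} \<Longrightarrow> \<bar>f t x\<bar> \<le> C / (1 + x\<^sup>2)"
    by (rule strip_decaying_bound[OF assms]) (rule that)
  show ?thesis
    by (rule that[of "C * pi"]) (rule x_integral_bound[OF assms _ C])
qed

lemma strip_bounded_common_bound:
  assumes "\<And>f. f \<in> set fs \<Longrightarrow> strip_bounded T f"
  shows "\<exists>L. \<forall>f\<in>set fs. \<forall>t\<in>{0..T}. \<forall>x. \<bar>f t x\<bar> \<le> L"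
  using assms
proof (induction fs)
  case (Cons f fs)
  obtain L where L: "\<forall>f\<in>set fs. \<forall>t\<in>{0..T}. \<forall>x. \<bar>f t x\<bar> \<le> L"
    using Cons by auto
  obtain C where C: "\<And>t x. t \<in> {0..T} \<Longrightarrow> \<bar>f t x\<bar> \<le> C"
    by (rule strip_boundedE[of T f]) (use Cons.prems in auto)
  have "\<forall>g\<in>set (f # fs). \<forall>t\<in>{0..T}. \<forall>x. \<bar>g t x\<bar> \<le> max L C"
    using L C by (auto simp: le_max_iff_disj)
  then show ?case by blast
qed auto

section \<open>Expansion of the energy along \<open>\<phi> + e * h\<close>\<close>

context
  fixes T :: real and \<phi> h :: "real \<Rightarrow> real \<Rightarrow> real" and \<alpha> :: "real \<Rightarrow> real"
  assumes T: "T > 0" and path: "Virasoro_Bott_path T \<phi> \<alpha>" and h: "h \<in> Schwartz_strip T"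
begin

lemma path_dec:
  "strip_decaying T (pd T 0 1 \<phi>)" "strip_decaying T (pd T 1 1 \<phi>)" "strip_decaying T (pd T 2 0 \<phi>)"
  by (rule path_pd_decaying[OF T path]; simp)+

lemma pert_dec: "strip_decaying T (pd T i j h)"
  by (rule Schwartz_strip_decaying[OF h])

lemma slope_bdd: "strip_bounded T (pd T 1 0 \<phi>)" "strip_bounded T (\<lambda>t x. inverse (pd T 1 0 \<phi> t x))"
  by (rule path_slope_bounded[OF T path], rule path_inverse_slope_bounded[OF T path])

lemmas bdd = strip_decaying_imp_bounded[OF path_dec(1)] strip_decaying_imp_bounded[OF path_dec(2)]
  strip_decaying_imp_bounded[OF path_dec(3)] strip_decaying_imp_bounded[OF pert_dec] slope_bdd
  strip_bounded_const

lemma cocycle_first_decaying: "strip_decaying T (cocycle_first T \<phi> h)"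
  unfolding cocycle_first_def[abs_def] Let_def
  by (intro strip_decaying_diff strip_decaying_mult_bounded(1)[where g="\<lambda>t x. inverse (pd T 1 0 \<phi> t x) ^ _"]
      strip_decaying_add strip_decaying_mult_bounded(1)[where g="pd T _ _ \<phi>"]
      strip_decaying_mult_bounded(1)[where g="pd T _ _ h"] strip_decaying_cmult
      strip_bounded_power pert_dec path_dec bdd)

lemma cocycle_second_decaying: "strip_decaying T (cocycle_second T \<phi> h)"
  unfolding cocycle_second_def[abs_def] Let_def power2_eq_square[of "pd T 1 0 h _ _"]
  by (intro strip_decaying_diff strip_decaying_mult_bounded(1)[where g="\<lambda>t x. inverse (pd T 1 0 \<phi> t x) ^ _"]
      strip_decaying_add strip_decaying_mult_bounded(1)[where g="pd T _ _ \<phi>"]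
      strip_decaying_mult_bounded(1)[where g="pd T _ _ h"] strip_decaying_cmult
      strip_decaying_mult_bounded(1)
      strip_bounded_power strip_bounded_add strip_bounded_mult pert_dec path_dec bdd)

lemma kinetic_second_decaying: "strip_decaying T (kinetic_second T \<phi> h)"
  unfolding kinetic_second_def[abs_def] power2_eq_square
  by (intro strip_decaying_add strip_decaying_mult_bounded(1) strip_decaying_cmult pert_dec path_dec bdd)

lemma pd_perturbed:
  "t \<in> {0..T} \<Longrightarrow> pd T i j (\<lambda>t x. \<phi> t x + e * h t x) t x = pd T i j \<phi> t x + e * pd T i j h t x"
  using path h T by (intro pd_add_scaled) (auto simp: Virasoro_Bott_path_def Schwartz_strip_def)

text \<open>The density is a cubic polynomial in the derivatives of the path, so here the expansion
  is exact and stops at \<open>e ^ 3\<close>.\<close>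

lemma kinetic_expansion:
  assumes "t \<in> {0..T}"
  defines "B1 \<equiv> \<lambda>t x. 2 * pd T 0 1 \<phi> t x * pd T 0 1 h t x * pd T 1 0 \<phi> t x +
      (pd T 0 1 \<phi> t x)\<^sup>2 * pd T 1 0 h t x"
    and "B3 \<equiv> \<lambda>t x. (pd T 0 1 h t x)\<^sup>2 * pd T 1 0 h t x"
  shows "x_integral (kinetic_density T (\<lambda>t x. \<phi> t x + e * h t x)) t =
    x_integral (kinetic_density T \<phi>) t + e * x_integral B1 t +
    e\<^sup>2 * x_integral (kinetic_second T \<phi> h) t + e ^ 3 * x_integral B3 t"
    and "strip_decaying T B1" "strip_decaying T B3"
proof -
  show B1: "strip_decaying T B1"
    unfolding B1_def power2_eq_square
    by (intro strip_decaying_add strip_decaying_mult_bounded(1) strip_decaying_cmult pert_dec path_dec bdd)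
  show B3: "strip_decaying T B3"
    unfolding B3_def power2_eq_square
    by (intro strip_decaying_add strip_decaying_mult_bounded(1) strip_decaying_cmult pert_dec path_dec bdd)
  let ?k = "kinetic_density T \<phi>" and ?k2 = "kinetic_second T \<phi> h"
  have d: "strip_decaying T ?k" "strip_decaying T (\<lambda>t x. ?k t x + e * B1 t x)"
    "strip_decaying T (\<lambda>t x. (?k t x + e * B1 t x) + e\<^sup>2 * ?k2 t x)" "strip_decaying T ?k2"
    by (intro kinetic_density_decaying[OF T path] kinetic_second_decaying B1
        strip_decaying_add strip_decaying_cmult)+
  have "x_integral (kinetic_density T (\<lambda>t x. \<phi> t x + e * h t x)) t =
      x_integral (\<lambda>t x. ((?k t x + e * B1 t x) + e\<^sup>2 * ?k2 t x) + e ^ 3 * B3 t x) t"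
    by (rule x_integral_cong)
       (simp add: kinetic_density_def kinetic_second_def pd_perturbed[OF assms(1)] B1_def B3_def,
        simp add: algebra_simps power2_eq_square power3_eq_cube)
  then show "x_integral (kinetic_density T (\<lambda>t x. \<phi> t x + e * h t x)) t =
    x_integral (kinetic_density T \<phi>) t + e * x_integral B1 t +
    e\<^sup>2 * x_integral (kinetic_second T \<phi> h) t + e ^ 3 * x_integral B3 t"
    using d assms(1)
    by (simp only: x_integral_add_scaled[OF d(3) B3] x_integral_add_scaled[OF d(2) d(4)]
        x_integral_add_scaled[OF d(1) B1])
qed

text \<open>The pointwise remainder is integrated over \<open>x\<close>; the constants are uniform
  in \<open>t\<close>, as is needed to integrate over time afterwards.\<close>

lemma cocycle_expansion:
  obtains e0 K where "e0 > 0" "e0 \<le> 1" "K \<ge> 0"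
    "\<And>e t. \<bar>e\<bar> \<le> e0 \<Longrightarrow> Virasoro_Bott_path T (\<lambda>t x. \<phi> t x + e * h t x) \<alpha> \<Longrightarrow> t \<in> {0..T} \<Longrightarrow>
      \<bar>x_integral (cocycle_density T (\<lambda>t x. \<phi> t x + e * h t x)) t - (x_integral (cocycle_density T \<phi>) t
        + e * x_integral (cocycle_first T \<phi> h) t + e\<^sup>2 * x_integral (cocycle_second T \<phi> h) t)\<bar> \<le> \<bar>e\<bar> ^ 3 * K"
proof -
  obtain \<delta> where \<delta>: "\<delta> > 0" "\<delta> < 1" "\<And>t x. t \<in> {0..T} \<Longrightarrow> \<delta> \<le> pd T 1 0 \<phi> t x"
    by (rule path_slope_lower_bound[OF T path]) (rule that, assumption+)
  \<comment> \<open>The constant \<open>2 / \<delta>\<close> joins the list because it bounds the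
    inverse slopes of both \<open>\<phi>\<close> and the perturbed path.\<close>
  have "\<exists>L. \<forall>f\<in>set [pd T 1 1 \<phi>, pd T 2 0 \<phi>, pd T 1 1 h, pd T 2 0 h, pd T 1 0 h, pd T 1 0 \<phi>,
      \<lambda>t x. inverse \<delta> * 2]. \<forall>t\<in>{0..T}. \<forall>x. \<bar>f t x\<bar> \<le> L"
    by (rule strip_bounded_common_bound) (use bdd in auto)
  then obtain L0 where L0: "\<forall>f\<in>set [pd T 1 1 \<phi>, pd T 2 0 \<phi>, pd T 1 1 h, pd T 2 0 h, pd T 1 0 h, pd T 1 0 \<phi>,
      \<lambda>t x. inverse \<delta> * 2]. \<forall>t\<in>{0..T}. \<forall>x. \<bar>f t x\<bar> \<le> L0" by blast
  define L where "L = max L0 1"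
  have L: "\<bar>pd T 1 1 \<phi> t x\<bar> \<le> L" "\<bar>pd T 2 0 \<phi> t x\<bar> \<le> L" "\<bar>pd T 1 1 h t x\<bar> \<le> L" "\<bar>pd T 2 0 h t x\<bar> \<le> L"
     "\<bar>pd T 1 0 h t x\<bar> \<le> L" "\<bar>pd T 1 0 \<phi> t x\<bar> \<le> L" "\<bar>inverse \<delta> * 2\<bar> \<le> L" "L > 0" if "t \<in> {0..T}" for t x
    using L0 that by (auto simp: L_def le_max_iff_disj)
  obtain K where K: "\<And>a b p a' b' p' e. \<bar>a\<bar> \<le> L \<Longrightarrow> \<bar>b\<bar> \<le> L \<Longrightarrow> \<bar>a'\<bar> \<le> L \<Longrightarrow> \<bar>b'\<bar> \<le> L \<Longrightarrow>
      \<bar>p'\<bar> \<le> L \<Longrightarrow> \<bar>p\<bar> \<le> L \<Longrightarrow> \<bar>inverse p\<bar> \<le> L \<Longrightarrow> \<bar>inverse (p + e * p')\<bar> \<le> L \<Longrightarrow> \<bar>e\<bar> \<le> 1 \<Longrightarrow>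
      p \<noteq> 0 \<Longrightarrow> p + e * p' \<noteq> 0 \<Longrightarrow>
      \<bar>(a + e * a') * (b + e * b') * (inverse (p + e * p'))\<^sup>2 - (a * b * (inverse p)\<^sup>2
      + e * ((a' * b + a * b') * (inverse p)\<^sup>2 - 2 * p' * a * b * inverse p ^ 3)
      + e\<^sup>2 * (a' * b' * (inverse p)\<^sup>2 - 2 * p' * (a' * b + a * b') * inverse p ^ 3 + 3 * p'\<^sup>2 * a * b * inverse p ^ 4))\<bar>
      \<le> \<bar>e\<bar> ^ 3 * (\<bar>p'\<bar> * K)"
    by (rule rational_expansion_bound[of L]) (rule that)
  obtain C where C: "\<And>t x. t \<in> {0..T} \<Longrightarrow> \<bar>pd T 1 0 h t x\<bar> \<le> C / (1 + x\<^sup>2)"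
    by (rule strip_decaying_bound[OF pert_dec[of 1 0]]) (rule that)
  \<comment> \<open>With \<open>\<bar>h_x\<bar> \<le> L\<close> this makes the slope drop by at most
    \<open>\<delta> / 2\<close>, so at least \<open>\<delta> / 2\<close> of it remains.\<close>
  define e0 where "e0 = min 1 (\<delta> / (2 * L))"
  have L_pos: "L > 0" by (simp add: L_def)
  define R where "R = (\<lambda>e t x. cocycle_density T (\<lambda>t x. \<phi> t x + e * h t x) t x - ((cocycle_density T \<phi> t x
        + e * cocycle_first T \<phi> h t x) + e\<^sup>2 * cocycle_second T \<phi> h t x))"
  have R: "\<bar>R e t x\<bar> \<le> (\<bar>e\<bar> ^ 3 * (C * \<bar>K\<bar>)) / (1 + x\<^sup>2)" if e: "\<bar>e\<bar> \<le> e0" and t: "t \<in> {0..T}" for e t x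
  proof -
    let ?p = "pd T 1 0 \<phi> t x" and ?p' = "pd T 1 0 h t x"
    have "\<bar>e * ?p'\<bar> \<le> (\<delta> / (2 * L)) * L"
      using e L(5)[OF t] by (intro abs_mult_le) (auto simp: e0_def)
    then have p: "?p + e * ?p' \<ge> \<delta> / 2"
      using \<delta>(3)[OF t, of x] L_pos by (simp add: abs_le_iff)
    have i1: "\<bar>inverse ?p\<bar> \<le> L"
    proof -
      have "inverse ?p \<le> inverse \<delta>" using \<delta>(1) \<delta>(3)[OF t, of x] by (intro le_imp_inverse_le)
      moreover have "inverse \<delta> > 0" using \<delta>(1) by simp
      moreover have "?p > 0" using \<delta>(1) \<delta>(3)[OF t, of x] by linarith
      ultimately show ?thesis using L(7)[OF t] by (simp only: abs_of_pos positive_imp_inverse_positive)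
    qed
    have i2: "\<bar>inverse (?p + e * ?p')\<bar> \<le> L"
    proof -
      have "inverse (?p + e * ?p') \<le> inverse (\<delta> / 2)" using \<delta>(1) p by (intro le_imp_inverse_le) auto
      moreover have "?p + e * ?p' > 0" using \<delta>(1) p by linarith
      moreover have "inverse (\<delta> / 2) = inverse \<delta> * 2"
        by (simp only: inverse_divide) (simp only: divide_inverse mult.commute)
      moreover have "inverse \<delta> > 0" using \<delta>(1) by simp
      ultimately show ?thesis using L(7)[OF t] by (simp only: abs_of_pos positive_imp_inverse_positive)
    qed
    have "\<bar>R e t x\<bar> \<le> \<bar>e\<bar> ^ 3 * (\<bar>?p'\<bar> * K)"
      using K[OF L(1)[OF t] L(2)[OF t] L(3)[OF t] L(4)[OF t] L(5)[OF t] L(6)[OF t] i1 i2] e \<delta>(1) p \<delta>(3)[OF t, of x]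
      by (simp add: R_def cocycle_density_def cocycle_first_def cocycle_second_def Let_def pd_perturbed[OF t] e0_def)
    also have "\<dots> \<le> \<bar>e\<bar> ^ 3 * ((C / (1 + x\<^sup>2)) * \<bar>K\<bar>)"
      by (intro mult_left_mono order_trans[OF mult_left_mono mult_right_mono[OF C[OF t]]]) auto
    finally show ?thesis by (simp add: mult_ac)
  qed
  show ?thesis
  proof (rule that)
    show "e0 > 0" "e0 \<le> 1" using \<delta>(1) L_pos by (auto simp: e0_def)
    have "0 \<le> C / (1 + 0\<^sup>2)" using C[of 0 0] T abs_ge_zero order_trans by (metis atLeastAtMost_iff less_imp_le order_refl)
    then show "0 \<le> C * \<bar>K\<bar> * pi" by simp
    fix e t assume e: "\<bar>e\<bar> \<le> e0" and path': "Virasoro_Bott_path T (\<lambda>t x. \<phi> t x + e * h t x) \<alpha>"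
      and t: "t \<in> {0..T}"
    let ?S = "\<lambda>t x. (cocycle_density T \<phi> t x + e * cocycle_first T \<phi> h t x) + e\<^sup>2 * cocycle_second T \<phi> h t x"
    have dec: "strip_decaying T ?S"
      using cocycle_density_decaying[OF T path] cocycle_first_decaying cocycle_second_decaying
      by (intro strip_decaying_add strip_decaying_cmult)
    have dec': "strip_decaying T (R e)"
      unfolding R_def by (rule strip_decaying_diff[OF cocycle_density_decaying[OF T path'] dec])
    have "\<bar>x_integral (R e) t\<bar> \<le> (\<bar>e\<bar> ^ 3 * (C * \<bar>K\<bar>)) * pi"
      by (rule x_integral_bound[OF dec' t R[OF e t]])
    moreover have "x_integral (cocycle_density T (\<lambda>t x. \<phi> t x + e * h t x)) t = x_integral (R e) t + x_integral ?S t"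
      unfolding x_integral_add[OF dec' dec t, symmetric] by (rule x_integral_cong) (simp add: R_def)
    moreover have "x_integral ?S t = x_integral (cocycle_density T \<phi>) t
        + e * x_integral (cocycle_first T \<phi> h) t + e\<^sup>2 * x_integral (cocycle_second T \<phi> h) t"
      using x_integral_add_scaled[OF cocycle_density_decaying[OF T path] cocycle_first_decaying t]
        x_integral_add_scaled[OF strip_decaying_add[OF cocycle_density_decaying[OF T path]
            strip_decaying_cmult[OF cocycle_first_decaying]] cocycle_second_decaying t] by simp
    ultimately show "\<bar>x_integral (cocycle_density T (\<lambda>t x. \<phi> t x + e * h t x)) t - (x_integral (cocycle_density T \<phi>) t
        + e * x_integral (cocycle_first T \<phi> h) t + e\<^sup>2 * x_integral (cocycle_second T \<phi> h) t)\<bar> \<le> \<bar>e\<bar> ^ 3 * (C * \<bar>K\<bar> * pi)"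
      by (simp add: mult_ac)
  qed
qed

text \<open>Constancy of \<open>w\<close> turns the central part into an expansion around one
  number, so that \<open>w\<close> comes out of the time integrals. For the decrease only an upper
  bound with cubic error is needed.\<close>

lemma energy_expansion:
  assumes w: "\<And>t. t \<in> {0..T} \<Longrightarrow> dt T \<alpha> t - x_integral (cocycle_density T \<phi>) t = w"
  defines "Q \<equiv> second_variation T \<phi> w h"
  obtains e0 L K where "e0 > 0" "e0 \<le> 1" "K \<ge> 0"
    "\<And>e. \<bar>e\<bar> \<le> e0 \<Longrightarrow> Virasoro_Bott_path T (\<lambda>t x. \<phi> t x + e * h t x) \<alpha> \<Longrightarrow>
      energy T (\<lambda>t x. \<phi> t x + e * h t x) \<alpha> \<le> energy T \<phi> \<alpha> + e * L + e\<^sup>2 * Q + \<bar>e\<bar> ^ 3 * K"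
proof -
  obtain e0 K where e0: "e0 > 0" "e0 \<le> 1" and K: "K \<ge> 0"
    "\<And>e t. \<bar>e\<bar> \<le> e0 \<Longrightarrow> Virasoro_Bott_path T (\<lambda>t x. \<phi> t x + e * h t x) \<alpha> \<Longrightarrow> t \<in> {0..T} \<Longrightarrow>
      \<bar>x_integral (cocycle_density T (\<lambda>t x. \<phi> t x + e * h t x)) t - (x_integral (cocycle_density T \<phi>) t
        + e * x_integral (cocycle_first T \<phi> h) t + e\<^sup>2 * x_integral (cocycle_second T \<phi> h) t)\<bar> \<le> \<bar>e\<bar> ^ 3 * K"
    by (rule cocycle_expansion) (rule that, assumption+)
  define B1 where "B1 = (\<lambda>t x. 2 * pd T 0 1 \<phi> t x * pd T 0 1 h t x * pd T 1 0 \<phi> t x +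
      (pd T 0 1 \<phi> t x)\<^sup>2 * pd T 1 0 h t x)"
  define B3 where "B3 = (\<lambda>t x. (pd T 0 1 h t x)\<^sup>2 * pd T 1 0 h t x)"
  have B: "strip_decaying T B1" "strip_decaying T B3"
    using kinetic_expansion(2,3)[of 0] T by (auto simp: B1_def B3_def)
  let ?J1 = "x_integral (cocycle_first T \<phi> h)" and ?J2 = "x_integral (cocycle_second T \<phi> h)"
  let ?k = "x_integral (kinetic_density T \<phi>)" and ?k2 = "x_integral (kinetic_second T \<phi> h)"
  obtain M1 where M1: "\<And>t. t \<in> {0..T} \<Longrightarrow> \<bar>?J1 t\<bar> \<le> M1"
    by (rule x_integral_bounded[OF cocycle_first_decaying]) (rule that)
  obtain M2 where M2: "\<And>t. t \<in> {0..T} \<Longrightarrow> \<bar>?J2 t\<bar> \<le> M2"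
    by (rule x_integral_bounded[OF cocycle_second_decaying]) (rule that)
  obtain M3 where M3: "\<And>t. t \<in> {0..T} \<Longrightarrow> \<bar>x_integral B3 t\<bar> \<le> M3"
    by (rule x_integral_bounded[OF B(2)]) (rule that)
  \<comment> \<open>The summands bound, in this order, the cubic kinetic term,
    \<open>- 2 * w * D\<close>, the cross term of \<open>e * J1\<close> with
    \<open>e^2 * J2 + D\<close>, and the square of the latter; \<open>D\<close> is the cocycle
    remainder.\<close>
  define K' where "K' = M3 + 2 * \<bar>w\<bar> * K + 2 * M1 * (M2 + K) + (M2 + K) * (M2 + K)"
  define L where "L = (LINT t:{0..T}|lborel. x_integral B1 t) - 2 * w * (LINT t:{0..T}|lborel. ?J1 t)"
  have K'_nonneg: "K' \<ge> 0"
  proof -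
    have "0 \<in> {0..T}" using T by simp
    then have "M1 \<ge> 0" "M2 \<ge> 0" "M3 \<ge> 0" using M1 M2 M3 abs_ge_zero order_trans by blast+
    then show ?thesis using K(1) by (simp add: K'_def)
  qed
  have cont: "continuous_on {0..T} ?J1" "continuous_on {0..T} ?J2" "continuous_on {0..T} ?k"
    "continuous_on {0..T} ?k2" "continuous_on {0..T} (x_integral B1)"
    by (intro x_integral_continuous B cocycle_first_decaying cocycle_second_decaying
        kinetic_density_decaying[OF T path] kinetic_second_decaying)+
  show ?thesis
  proof (rule that[of e0 "K' * T" L])
    show "e0 > 0" "e0 \<le> 1" by fact+
    show "K' * T \<ge> 0" using K'_nonneg T by simp
    fix e assume e: "\<bar>e\<bar> \<le> e0" and path': "Virasoro_Bott_path T (\<lambda>t x. \<phi> t x + e * h t x) \<alpha>"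
    let ?\<psi> = "\<lambda>t x. \<phi> t x + e * h t x"
    let ?c = "\<lambda>t. dt T \<alpha> t - x_integral (cocycle_density T ?\<psi>) t"
    have c_bound: "x_integral (kinetic_density T ?\<psi>) t + (?c t)\<^sup>2 \<le> ?k t + w\<^sup>2 + e * (x_integral B1 t - 2 * w * ?J1 t)
        + e\<^sup>2 * (?k2 t + ((?J1 t)\<^sup>2 - 2 * w * ?J2 t)) + \<bar>e\<bar> ^ 3 * K'" if t: "t \<in> {0..T}" for t
    proof -
      define D where "D = x_integral (cocycle_density T ?\<psi>) t - (x_integral (cocycle_density T \<phi>) t
        + e * ?J1 t + e\<^sup>2 * ?J2 t)"
      have D: "\<bar>D\<bar> \<le> \<bar>e\<bar> ^ 3 * K" unfolding D_def by (rule K(2)[OF e path' t])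
      have e1: "\<bar>e\<bar> \<le> 1" using e e0 by simp
      \<comment> \<open>One power of \<open>e\<close> is given up, so that
        \<open>e^2 * J2 + D\<close> has a common factor \<open>e^2\<close>; its square is then of
        order \<open>e^4\<close>, and \<open>e^4 \<le> \<bar>e\<bar> ^ 3\<close>.\<close>
      have D2: "\<bar>D\<bar> \<le> \<bar>e\<bar>\<^sup>2 * K"
        by (rule order_trans[OF D]) (intro mult_right_mono K(1) power_decreasing e1; simp)
      have c: "?c t = w - e * ?J1 t - (e\<^sup>2 * ?J2 t + D)"
        using w[OF t] by (simp add: D_def)
      have S: "\<bar>e\<^sup>2 * ?J2 t + D\<bar> \<le> \<bar>e\<bar>\<^sup>2 * (M2 + K)"
        using abs_add_le[OF abs_mult_le[OF _ M2[OF t]] D2, of "e\<^sup>2" "\<bar>e\<bar>\<^sup>2"] by (simp add: algebra_simps)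
      have "\<bar>x_integral B3 t * e ^ 3 - 2 * w * D + 2 * e * ?J1 t * (e\<^sup>2 * ?J2 t + D) + (e\<^sup>2 * ?J2 t + D) * (e\<^sup>2 * ?J2 t + D)\<bar>
        \<le> M3 * \<bar>e\<bar> ^ 3 + 2 * \<bar>w\<bar> * (\<bar>e\<bar> ^ 3 * K) + 2 * \<bar>e\<bar> * M1 * (\<bar>e\<bar>\<^sup>2 * (M2 + K)) + (\<bar>e\<bar>\<^sup>2 * (M2 + K)) * (\<bar>e\<bar>\<^sup>2 * (M2 + K))"
        by (intro abs_add_le abs_diff_le abs_mult_le M3[OF t] D S M1[OF t]) (auto simp: power_abs)
      also have "\<dots> = \<bar>e\<bar> ^ 3 * (M3 + 2 * \<bar>w\<bar> * K + 2 * M1 * (M2 + K)) + \<bar>e\<bar> ^ 4 * ((M2 + K) * (M2 + K))"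
        by algebra
      also have "\<dots> \<le> \<bar>e\<bar> ^ 3 * (M3 + 2 * \<bar>w\<bar> * K + 2 * M1 * (M2 + K)) + \<bar>e\<bar> ^ 3 * ((M2 + K) * (M2 + K))"
        by (intro add_left_mono mult_right_mono power_decreasing e1) auto
      also have "\<dots> = \<bar>e\<bar> ^ 3 * K'" by (simp add: K'_def algebra_simps)
      finally have "x_integral B3 t * e ^ 3 - 2 * w * D + 2 * e * ?J1 t * (e\<^sup>2 * ?J2 t + D) + (e\<^sup>2 * ?J2 t + D) * (e\<^sup>2 * ?J2 t + D)
        \<le> \<bar>e\<bar> ^ 3 * K'" by linarith
      moreover have "x_integral (kinetic_density T ?\<psi>) t = ?k t + e * x_integral B1 t + e\<^sup>2 * ?k2 t + e ^ 3 * x_integral B3 t"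
        unfolding B1_def B3_def by (rule kinetic_expansion(1)[OF t])
      ultimately show ?thesis
        unfolding c by (simp add: algebra_simps power2_eq_square)
    qed
    have alpha: "continuous_on {0..T} (dt T \<alpha>)"
      using path smooth_Icc_continuous[of \<alpha> T 1] by (simp add: Virasoro_Bott_path_def)
    have cont': "continuous_on {0..T} (x_integral (kinetic_density T ?\<psi>))" "continuous_on {0..T} (\<lambda>t. (?c t)\<^sup>2)"
      by (intro continuous_on_power continuous_on_diff alpha x_integral_continuous
          kinetic_density_decaying[OF T path'] cocycle_density_decaying[OF T path'])+
    note si = set_integrable_continuous
    have "energy T ?\<psi> \<alpha> = (LINT t:{0..T}|lborel. x_integral (kinetic_density T ?\<psi>) t + (?c t)\<^sup>2)"
      unfolding energy_eq by (rule set_integral_add(2)[OF si[OF cont'(1)] si[OF cont'(2)], symmetric])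
    also have "\<dots> \<le> (LINT t:{0..T}|lborel. ?k t + w\<^sup>2 + e * (x_integral B1 t - 2 * w * ?J1 t)
        + e\<^sup>2 * (?k2 t + ((?J1 t)\<^sup>2 - 2 * w * ?J2 t)) + \<bar>e\<bar> ^ 3 * K')"
      by (rule set_integral_mono[OF _ _ c_bound]) (intro si continuous_intros cont cont')+
    also have "\<dots> = ((LINT t:{0..T}|lborel. ?k t) + (LINT t:{0..T}|lborel. w\<^sup>2)) + e * L + e\<^sup>2 * Q + (LINT t:{0..T}|lborel. \<bar>e\<bar> ^ 3 * K')"
    proof -
      let ?S = "\<lambda>F. LINT t:{0..T}|lborel. F t"
      let ?q = "\<lambda>t. (?J1 t)\<^sup>2 - 2 * w * ?J2 t"
      have i: "set_integrable lborel {0..T} ?k" "set_integrable lborel {0..T} (\<lambda>t. w\<^sup>2)"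
        "set_integrable lborel {0..T} (x_integral B1)" "set_integrable lborel {0..T} (\<lambda>t. 2 * w * ?J1 t)"
        "set_integrable lborel {0..T} ?k2" "set_integrable lborel {0..T} ?q"
        "set_integrable lborel {0..T} (\<lambda>t. \<bar>e\<bar> ^ 3 * K')"
        by (intro si continuous_intros cont)+
      have j: "set_integrable lborel {0..T} (\<lambda>t. ?k t + w\<^sup>2)"
        "set_integrable lborel {0..T} (\<lambda>t. e * (x_integral B1 t - 2 * w * ?J1 t))"
        "set_integrable lborel {0..T} (\<lambda>t. e\<^sup>2 * (?k2 t + ?q t))"
        by (intro si continuous_intros cont)+
      have "?S (\<lambda>t. x_integral B1 t - 2 * w * ?J1 t) = L"
        unfolding L_def set_integral_diff(2)[OF i(3,4)] set_integral_mult_right ..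
      moreover have "?S (\<lambda>t. ?k2 t + ?q t) = Q"
        unfolding Q_def second_variation_def by (rule set_integral_add(2)[OF i(5,6)])
      ultimately show ?thesis
        unfolding set_integral_add(2)[OF set_integral_add(1)[OF set_integral_add(1)[OF j(1,2)] j(3)] i(7)]
          set_integral_add(2)[OF set_integral_add(1)[OF j(1,2)] j(3)]
          set_integral_add(2)[OF j(1,2)] set_integral_add(2)[OF i(1,2)] set_integral_mult_right by simp
    qed
    also have "(LINT t:{0..T}|lborel. \<bar>e\<bar> ^ 3 * K') = \<bar>e\<bar> ^ 3 * (K' * T)"
      using T by (simp add: set_lebesgue_integral_def)
    also have "(LINT t:{0..T}|lborel. ?k t) + (LINT t:{0..T}|lborel. w\<^sup>2) = energy T \<phi> \<alpha>"
    proof -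
      have "(LINT t:{0..T}|lborel. (dt T \<alpha> t - x_integral (cocycle_density T \<phi>) t)\<^sup>2) = (LINT t:{0..T}|lborel. w\<^sup>2)"
        by (rule set_lebesgue_integral_cong) (simp, use w in auto)
      then show ?thesis by (simp only: energy_eq)
    qed
    finally show "energy T ?\<psi> \<alpha> \<le> energy T \<phi> \<alpha> + e * L + e\<^sup>2 * Q + \<bar>e\<bar> ^ 3 * (K' * T)" .
  qed
qed

text \<open>The predicate \<open>P\<close> bundles what has to hold for small parameters: being a
  path and staying in the given neighbourhood. The linear term needs no computation, since one of
  the two signs makes it nonpositive.\<close>

lemma energy_decrease:
  assumes w: "\<And>t. t \<in> {0..T} \<Longrightarrow> dt T \<alpha> t - x_integral (cocycle_density T \<phi>) t = w"
  assumes neg: "second_variation T \<phi> w h < 0"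
    and P: "\<forall>\<^sub>F s in nhds 0. P s"
    and P_path: "\<And>s. P s \<Longrightarrow> Virasoro_Bott_path T (\<lambda>t x. \<phi> t x + s * h t x) \<alpha>"
  shows "\<exists>s. P s \<and> energy T (\<lambda>t x. \<phi> t x + s * h t x) \<alpha> < energy T \<phi> \<alpha>"
proof -
  define Q where "Q = second_variation T \<phi> w h"
  obtain e0 L K where e0: "e0 > 0" "e0 \<le> 1" and K: "K \<ge> 0"
    "\<And>e. \<bar>e\<bar> \<le> e0 \<Longrightarrow> Virasoro_Bott_path T (\<lambda>t x. \<phi> t x + e * h t x) \<alpha> \<Longrightarrow>
      energy T (\<lambda>t x. \<phi> t x + e * h t x) \<alpha> \<le> energy T \<phi> \<alpha> + e * L + e\<^sup>2 * Q + \<bar>e\<bar> ^ 3 * K"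
    by (rule energy_expansion[OF w, folded Q_def]) (assumption, rule that, assumption+)
  obtain d where d: "d > 0" "\<And>s. \<bar>s\<bar> < d \<Longrightarrow> P s"
    using P by (auto simp: eventually_nhds_metric dist_real_def)
  \<comment> \<open>The last entry gives \<open>s0 * K < - Q\<close>, so that the quadratic term
    beats the cubic error; \<open>K + 1\<close> keeps the denominator positive.\<close>
  define s0 where "s0 = min (min e0 (d / 2)) (- Q / (2 * (K + 1)))"
  have Q: "Q < 0" using neg by (simp add: Q_def)
  have s0: "s0 > 0" "s0 \<le> e0" "s0 < d" "s0 \<le> - Q / (2 * (K + 1))"
  proof -
    have "- Q / (2 * (K + 1)) > 0" using Q K(1) by (intro divide_pos_pos) auto
    then show "s0 > 0" using e0 d(1) by (simp add: s0_def)
    show "s0 \<le> e0" "s0 \<le> - Q / (2 * (K + 1))" unfolding s0_def by linarith+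
    have "s0 \<le> d / 2" unfolding s0_def by linarith
    with d(1) show "s0 < d" by linarith
  qed
  define s where "s = (if L > 0 then - s0 else s0)"
  have s: "\<bar>s\<bar> = s0" "s * L \<le> 0" using s0(1) by (auto simp: s_def mult_le_0_iff)
  have "P s" using d(2) s s0 by simp
  have "s0 * (2 * (K + 1)) \<le> - Q"
    using s0(4) K(1) by (subst pos_le_divide_eq[symmetric]) auto
  then have "s0 * K < - Q"
    using s0(1) K(1) Q by (simp add: algebra_simps)
  then have "s0\<^sup>2 * (s0 * K + Q) < 0"
    using s0(1) by (intro mult_pos_neg) auto
  moreover have "s\<^sup>2 * Q + \<bar>s\<bar> ^ 3 * K = s0\<^sup>2 * (s0 * K + Q)"
    unfolding power2_abs[of s, symmetric] s(1) by (simp add: algebra_simps power2_eq_square power3_eq_cube)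
  moreover have "energy T (\<lambda>t x. \<phi> t x + s * h t x) \<alpha> \<le> energy T \<phi> \<alpha> + s * L + s\<^sup>2 * Q + \<bar>s\<bar> ^ 3 * K"
    using s s0 by (intro K(2) P_path \<open>P s\<close>) simp
  ultimately show ?thesis using \<open>P s\<close> s(2) by (intro exI[of _ s]) linarith
qed

end

subsection \<open>Travelling bumps\<close>

lemma abs_numeral_le: "\<bar>2\<bar> \<le> (2::real)" "\<bar>3\<bar> \<le> (3::real)"
  by simp_all

text \<open>The substitution \<open>y = n * x + d\<close> gains the factor \<open>1 / n\<close>:
  this is where the small width of the bump enters all estimates.\<close>

lemma x_integral_le_scaled:
  assumes "strip_decaying T f" "t \<in> {0..T}" "n > 0" "integrable lborel g"
    and le: "\<And>x. f t x \<le> g (n * x + d)"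
  shows "x_integral f t \<le> (LINT y|lborel. g y) / n"
proof -
  have i: "integrable lborel (\<lambda>x. g (d + n * x))"
    using lborel_integrable_real_affine[OF assms(4)] assms(3) by simp
  have "x_integral f t \<le> (LINT x|lborel. g (d + n * x))"
    unfolding x_integral_def
    by (rule integral_mono[OF strip_decaying_integrable[OF assms(1,2)] i]) (use le in \<open>simp add: add.commute\<close>)
  also have "\<dots> = (LINT y|lborel. g y) / n"
    using lborel_integral_real_affine[of n g d] assms(3) by simp
  finally show ?thesis .
qed

lemma integrable_indicator_Icc: "integrable lborel (\<lambda>y::real. K * indicator {-1..1} y :: real)"
  by (intro integrable_mult_right integrable_real_indicator) auto

lemma integral_indicator_Icc: "(LINT y|lborel. K * indicator {-1..1::real} y :: real) = 2 * K"
  by simp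

text \<open>The phase of a point in the support lies in \<open>[-1, 1]\<close>, an interval of
  length 2.\<close>

lemma x_integral_abs_le_scaled:
  assumes "strip_decaying T f" "t \<in> {0..T}" "n > 0"
    and le: "\<And>x. \<bar>f t x\<bar> \<le> K * indicator {-1..1} (n * x + d)"
  shows "\<bar>x_integral f t\<bar> \<le> 2 * K / n"
proof -
  have "x_integral f t \<le> (LINT y|lborel. K * indicator {-1..1::real} y) / n"
    by (rule x_integral_le_scaled[OF assms(1,2,3) integrable_indicator_Icc, where d=d])
       (use le in \<open>metis abs_le_D1\<close>)
  moreover have "x_integral (\<lambda>t x. (-1) * f t x) t \<le> (LINT y|lborel. K * indicator {-1..1::real} y) / n"
    by (rule x_integral_le_scaled[OF strip_decaying_cmult[OF assms(1)] assms(2,3) integrable_indicator_Icc, where d=d])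
       (use le in \<open>metis abs_le_D2 mult_minus1\<close>)
  ultimately show ?thesis
    unfolding x_integral_cmult integral_indicator_Icc by (simp add: abs_le_iff)
qed

text \<open>Serves as integration by parts without boundary terms.\<close>

lemma integral_deriv_compact_support:
  fixes F F' :: "real \<Rightarrow> real"
  assumes F: "\<And>x. (F has_real_derivative F' x) (at x)" and "continuous_on UNIV F'"
    and 0: "\<And>x. \<bar>x\<bar> > R \<Longrightarrow> F x = 0"
  shows "(LINT x|lborel. F' x) = 0"
proof -
  \<comment> \<open>Strictly beyond \<open>R\<close>, so that \<open>F\<close> vanishes at both
    ends, and positive whatever the sign of \<open>R\<close>.\<close>
  define R' where "R' = max R 0 + 1"
  have "deriv F = F'" using F by (auto intro!: ext DERIV_imp_deriv)
  then have "F' x = 0" if "\<bar>x\<bar> > R" for x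
    using deriv_funpow_eq_0_outside[of R F, OF 0 that, of 1] by simp
  then have "F' x = F' x * indicator {-R'..R'} x" for x
    by (cases "\<bar>x\<bar> > R") (auto simp: R'_def indicator_def abs_le_iff)
  then have "(LINT x|lborel. F' x) = (LINT x|lborel. F' x * indicator {-R'..R'} x)"
    by (rule Bochner_Integration.integral_cong[OF refl])
  also have "\<dots> = F R' - F (- R')"
    by (rule integral_FTC_Icc_real[OF _ F])
       (use assms(2) in \<open>auto simp: R'_def continuous_on_eq_continuous_at\<close>)
  also have "\<dots> = 0" using 0[of R'] 0[of "-R'"] by (simp add: R'_def)
  finally show ?thesis .
qed

lemma set_integral_pos_continuous:
  fixes f :: "real \<Rightarrow> real"
  assumes cont: "continuous_on {a..b} f" and nonneg: "\<And>x. x \<in> {a..b} \<Longrightarrow> f x \<ge> 0"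
    and "c \<in> {a..b}" "f c > 0" "a < b"
  shows "(LINT x:{a..b}|lborel. f x) > 0"
proof -
  have i: "set_integrable lborel {a..b} f" by (rule borel_integrable_atLeastAtMost'[OF cont])
  have eq: "(LINT x:{a..b}|lborel. f x) = integral {a..b} f"
    by (rule set_borel_integral_eq_integral(2)[OF i])
  have int: "f integrable_on {a..b}" by (rule set_borel_integral_eq_integral(1)[OF i])
  have "integral {a..b} f \<ge> 0" by (rule integral_nonneg[OF int nonneg])
  moreover have "integral {a..b} f \<noteq> 0"
  proof
    assume "integral {a..b} f = 0"
    then have "(f has_integral 0) (cbox a b)"
      using integrable_integral[OF int] by simp
    then have "f c = 0"
      by (rule has_integral_0_cbox_imp_0[rotated 2]) (use assms in auto)
    with assms show False by simp
  qed
  ultimately show ?thesis using eq by simp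
qed

lemma deriv_bump_square:
  shows "integrable lborel (\<lambda>y. ((deriv ^^ j) bump y)\<^sup>2)"
    and "(LINT y|lborel. ((deriv ^^ j) bump y)\<^sup>2) > 0"
proof -
  let ?f = "\<lambda>y. ((deriv ^^ j) bump y)\<^sup>2"
  have cont: "continuous_on A ?f" for A
    by (intro continuous_on_power smooth_real_continuous smooth_bump)
  have eq: "indicator {-2..2} y *\<^sub>R ?f y = ?f y" for y
    by (cases "\<bar>y\<bar> > 1") (auto simp: deriv_bump_eq_0 indicator_def abs_le_iff)
  have "set_integrable lborel {-2..2} ?f" by (rule borel_integrable_atLeastAtMost'[OF cont])
  then show "integrable lborel ?f" unfolding set_integrable_def eq .
  obtain y where y: "(deriv ^^ j) bump y \<noteq> 0" using deriv_bump_nonzero by blast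
  then have "\<not> \<bar>y\<bar> > 1" using deriv_bump_eq_0 by blast
  then have "(LINT y:{-2..2}|lborel. ?f y) > 0"
    using y by (intro set_integral_pos_continuous[OF cont, of _ _ y]) auto
  then show "(LINT y|lborel. ?f y) > 0" unfolding set_lebesgue_integral_def eq .
qed

text \<open>The bump \<open>A t * bump (n * (x - v * t) + c)\<close>, written as a wave with
  \<open>\<mu> = n\<close> and \<open>\<nu> = - (n * v)\<close> so that
  \<open>wave_in_Schwartz_strip\<close> applies verbatim.\<close>

definition travelling_bump :: "(real \<Rightarrow> real) \<Rightarrow> real \<Rightarrow> real \<Rightarrow> real \<Rightarrow> real \<Rightarrow> real \<Rightarrow> real" where
  "travelling_bump A n v c t x = A t * bump (n * x + (- (n * v)) * t + c)"

lemma travelling_bump_Schwartz: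
  assumes "T > 0" "smooth_real A" "n > 0"
  shows "travelling_bump A n v c \<in> Schwartz_strip T"
proof -
  have "(\<lambda>t x. A t * bump (n * x + (- (n * v)) * t + c)) \<in> Schwartz_strip T"
    by (rule wave_in_Schwartz_strip[OF assms(2) smooth_bump assms(1)]) (use assms bump_eq_0 in auto)
  then show ?thesis by (simp add: travelling_bump_def[abs_def])
qed

text \<open>To leading order in \<open>n\<close>, a time derivative is \<open>- v\<close> times a
  space derivative; terms with \<open>deriv A\<close> carry one factor \<open>n\<close>
  less.\<close>

lemma pd_travelling_bump:
  fixes n v c :: real
  assumes "T > 0" "smooth_real A" "t \<in> {0..T}"
  defines "y \<equiv> \<lambda>x. n * x + (- (n * v)) * t + c"
  shows "pd T 0 1 (travelling_bump A n v c) t x =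
      deriv A t * bump (y x) - n * v * (A t * deriv bump (y x))"
    and "pd T 1 0 (travelling_bump A n v c) t x = n * (A t * deriv bump (y x))"
    and "pd T 2 0 (travelling_bump A n v c) t x = n * (n * (A t * (deriv ^^ 2) bump (y x)))"
    and "pd T 1 1 (travelling_bump A n v c) t x =
      n * (deriv A t * deriv bump (y x)) - n * v * (n * (A t * (deriv ^^ 2) bump (y x)))"
proof -
  let ?h = "travelling_bump A n v c"
  have X: "((\<lambda>x. (deriv ^^ i) A t * (deriv ^^ j) bump (y x)) has_real_derivative
      n * ((deriv ^^ i) A t * (deriv ^^ Suc j) bump (y x))) (at x)" for i j x
    unfolding y_def by (rule wave_DERIV_x[OF assms(2) smooth_bump])
  have "((\<lambda>s. ?h s x) has_vector_derivative
      deriv A t * bump (y x) + - (n * v) * (A t * deriv bump (y x))) (at t within {0..T})" for x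
    using wave_DERIV_t[OF assms(2) smooth_bump, where i=0 and j=0 and \<mu>=n and \<nu>="- (n * v)" and c=c and x=x and t=t]
    unfolding travelling_bump_def y_def has_real_derivative_iff_has_vector_derivative
    by (simp add: has_vector_derivative_at_within)
  then have t: "pd T 0 1 ?h t = (\<lambda>x. deriv A t * bump (y x) - n * v * (A t * deriv bump (y x)))"
    using dt_eqI[OF assms(1,3)] by (intro ext) (simp add: pd_def pd_t_def)
  then show "pd T 0 1 ?h t x = deriv A t * bump (y x) - n * v * (A t * deriv bump (y x))" by simp
  have h0: "pd T 0 0 ?h t = (\<lambda>x. A t * bump (y x))"
    by (simp add: pd_def travelling_bump_def[abs_def] y_def)
  have x1: "pd T 1 0 ?h t = (\<lambda>x. n * (A t * deriv bump (y x)))"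
    using X[of 0 0] pd_Suc[of T 0 0 ?h t] by (intro ext) (simp add: h0 DERIV_imp_deriv)
  then show "pd T 1 0 ?h t x = n * (A t * deriv bump (y x))" by simp
  show "pd T 2 0 ?h t x = n * (n * (A t * (deriv ^^ 2) bump (y x)))"
    using DERIV_cmult[OF X[of 0 1 x], of n] pd_Suc[of T 1 0 ?h t x]
    by (simp add: x1[simplified] DERIV_imp_deriv numeral_2_eq_2)
  show "pd T 1 1 ?h t x =
      n * (deriv A t * deriv bump (y x)) - n * v * (n * (A t * (deriv ^^ 2) bump (y x)))"
    using DERIV_diff[OF X[of 1 0 x] DERIV_cmult[OF X[of 0 1 x], of "n * v"]] pd_Suc[of T 0 1 ?h t x]
    by (simp add: t[simplified] DERIV_imp_deriv numeral_2_eq_2)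
qed

lemma travelling_bump_zero: "A t = 0 \<Longrightarrow> travelling_bump A n v c t = (\<lambda>x. 0)"
  by (simp add: travelling_bump_def[abs_def])

text \<open>A single \<open>M\<close> for everything that does not involve \<open>n\<close>,
  \<open>v\<close> or \<open>c\<close>, so that \<open>n\<close> may be chosen after
  \<open>M\<close>. Since \<open>M \<ge> 1\<close>, lower powers of \<open>M\<close> can be absorbed
  in higher ones. The pair \<open>(0, 0)\<close> is left out because \<open>\<phi>\<close> itself is
  unbounded.\<close>

definition variation_bound :: "real \<Rightarrow> (real \<Rightarrow> real \<Rightarrow> real) \<Rightarrow> (real \<Rightarrow> real) \<Rightarrow> real \<Rightarrow> bool" where
  "variation_bound T \<phi> A M \<longleftrightarrow> M \<ge> 1 \<and>
    (\<forall>t\<in>{0..T}. \<forall>x. (\<forall>i\<le>3. \<forall>j\<le>1. (i, j) \<noteq> (0, 0) \<longrightarrow> \<bar>pd T i j \<phi> t x\<bar> \<le> M) \<and>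
      \<bar>inverse (pd T 1 0 \<phi> t x)\<bar> \<le> M) \<and>
    (\<forall>t\<in>{0..T}. \<bar>A t\<bar> \<le> M \<and> \<bar>deriv A t\<bar> \<le> M) \<and>
    (\<forall>y. \<bar>bump y\<bar> \<le> M \<and> \<bar>deriv bump y\<bar> \<le> M \<and> \<bar>(deriv ^^ 2) bump y\<bar> \<le> M)"

section \<open>Estimates with explicit powers of the frequency \<open>n\<close>\<close>

context
  fixes T M :: real and \<phi> :: "real \<Rightarrow> real \<Rightarrow> real" and \<alpha> A :: "real \<Rightarrow> real"
  assumes T: "T > 0" and path: "Virasoro_Bott_path T \<phi> \<alpha>" and A: "smooth_real A"
    and bound: "variation_bound T \<phi> A M"
begin

lemma M_ge_1: "M \<ge> 1"
  and M_path: "\<And>t x i j. t \<in> {0..T} \<Longrightarrow> i \<le> 3 \<Longrightarrow> j \<le> 1 \<Longrightarrow> (i, j) \<noteq> (0, 0) \<Longrightarrow> \<bar>pd T i j \<phi> t x\<bar> \<le> M"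
    "\<And>t x. t \<in> {0..T} \<Longrightarrow> \<bar>inverse (pd T 1 0 \<phi> t x)\<bar> \<le> M"
  and M_amplitude: "\<And>t. t \<in> {0..T} \<Longrightarrow> \<bar>A t\<bar> \<le> M" "\<And>t. t \<in> {0..T} \<Longrightarrow> \<bar>deriv A t\<bar> \<le> M"
  and M_bump: "\<And>y. \<bar>bump y\<bar> \<le> M" "\<And>y. \<bar>deriv bump y\<bar> \<le> M" "\<And>y. \<bar>(deriv ^^ 2) bump y\<bar> \<le> M"
  using bound unfolding variation_bound_def by blast+

context
  fixes n v c :: real
  assumes n: "n \<ge> 1" and v: "\<bar>v\<bar> \<le> 1"
begin

abbreviation (input) phase :: "real \<Rightarrow> real \<Rightarrow> real" where
  "phase t x \<equiv> n * x + (- (n * v)) * t + c"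

abbreviation (input) osc :: "real \<Rightarrow> real \<Rightarrow> real" where
  "osc \<equiv> travelling_bump A n v c"

lemma osc_Schwartz: "osc \<in> Schwartz_strip T"
  using n by (intro travelling_bump_Schwartz[OF T A]) simp

lemma osc_outside:
  assumes "t \<in> {0..T}" "\<bar>phase t x\<bar> > 1"
  shows "pd T 0 1 osc t x = 0" "pd T 1 0 osc t x = 0" "pd T 2 0 osc t x = 0" "pd T 1 1 osc t x = 0"
  using deriv_bump_eq_0[OF assms(2), of 0] deriv_bump_eq_0[OF assms(2), of 1] deriv_bump_eq_0[OF assms(2), of 2]
  unfolding pd_travelling_bump[OF T A assms(1)] by simp_all

lemma osc_bounds:
  assumes t: "t \<in> {0..T}"
  shows "\<bar>pd T 0 1 osc t x\<bar> \<le> n * (2 * M * M)" "\<bar>pd T 1 0 osc t x\<bar> \<le> n * (M * M)"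
    "\<bar>pd T 2 0 osc t x\<bar> \<le> n\<^sup>2 * (M * M)" "\<bar>pd T 1 1 osc t x\<bar> \<le> n\<^sup>2 * (2 * M * M)"
proof -
  have n': "\<bar>n\<bar> \<le> n" using n by simp
  have nn: "n \<le> n\<^sup>2" using n by (simp add: power2_eq_square)
  have MM: "M * M \<ge> 0" by simp
  have "\<bar>pd T 0 1 osc t x\<bar> \<le> M * M + n * 1 * (M * M)"
    unfolding pd_travelling_bump[OF T A t] by (intro abs_diff_le abs_mult_le M_amplitude t M_bump n' v)
  also have "\<dots> \<le> n * (M * M) + n * 1 * (M * M)" using n MM by (intro add_right_mono) (simp add: mult_le_cancel_right1)
  finally show "\<bar>pd T 0 1 osc t x\<bar> \<le> n * (2 * M * M)" by (simp add: algebra_simps)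
  show "\<bar>pd T 1 0 osc t x\<bar> \<le> n * (M * M)"
    unfolding pd_travelling_bump[OF T A t] by (intro abs_diff_le abs_mult_le M_amplitude t M_bump n' v)
  have "\<bar>pd T 2 0 osc t x\<bar> \<le> n * (n * (M * M))"
    unfolding pd_travelling_bump[OF T A t] by (intro abs_diff_le abs_mult_le M_amplitude t M_bump n' v)
  then show "\<bar>pd T 2 0 osc t x\<bar> \<le> n\<^sup>2 * (M * M)" by (simp add: power2_eq_square mult_ac)
  have "\<bar>pd T 1 1 osc t x\<bar> \<le> n * (M * M) + n * 1 * (n * (M * M))"
    unfolding pd_travelling_bump[OF T A t] by (intro abs_diff_le abs_mult_le M_amplitude t M_bump n' v)
  also have "\<dots> \<le> n\<^sup>2 * (M * M) + n * 1 * (n * (M * M))"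
    by (intro add_right_mono mult_right_mono nn MM)
  finally show "\<bar>pd T 1 1 osc t x\<bar> \<le> n\<^sup>2 * (2 * M * M)" by (simp add: algebra_simps power2_eq_square)
qed

lemma M_derivatives:
  assumes "t \<in> {0..T}"
  shows "\<bar>pd T 0 1 \<phi> t x\<bar> \<le> M" "\<bar>pd T 1 0 \<phi> t x\<bar> \<le> M" "\<bar>pd T 2 0 \<phi> t x\<bar> \<le> M" "\<bar>pd T 1 1 \<phi> t x\<bar> \<le> M"
    "\<bar>pd T 3 0 \<phi> t x\<bar> \<le> M" "\<bar>pd T 2 1 \<phi> t x\<bar> \<le> M"
  using assms by (simp_all add: M_path)

text \<open>The density has at most two derivatives on the bump, hence order \<open>n^2\<close>, and
  the width of the support leaves order \<open>n\<close>. Its square is of order \<open>n^2\<close>,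
  which is affordable against a leading term of order \<open>n^3\<close>.\<close>

lemma cocycle_first_crude:
  assumes t: "t \<in> {0..T}"
  shows "\<bar>x_integral (cocycle_first T \<phi> osc) t\<bar> \<le> 2 * (n\<^sup>2 * (3 * M ^ 5 + 2 * M ^ 7)) / n"
proof (rule x_integral_abs_le_scaled[OF cocycle_first_decaying[OF T path osc_Schwartz] t, where d="- (n * v * t) + c"])
  show "n > 0" using n by simp
  fix x
  have ph: "n * x + (- (n * v * t) + c) = phase t x" by simp
  show "\<bar>cocycle_first T \<phi> osc t x\<bar> \<le> (n\<^sup>2 * (3 * M ^ 5 + 2 * M ^ 7)) * indicator {-1..1} (n * x + (- (n * v * t) + c))"
  proof (cases "\<bar>phase t x\<bar> > 1")
    case True
    then show ?thesis using M_ge_1 unfolding ph by (simp del: One_nat_def add: cocycle_first_def osc_outside[OF t])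
  next
    case False
    then have i: "indicator {-1..1} (phase t x) = (1::real)"
      by (intro indicator_simps(1)) (simp only: atLeastAtMost_iff, linarith)
    have "\<bar>cocycle_first T \<phi> osc t x\<bar> \<le> (n\<^sup>2 * (2 * M * M) * M + M * (n\<^sup>2 * (M * M))) * M\<^sup>2 + 2 * (n * (M * M)) * M * M * M ^ 3"
      unfolding cocycle_first_def Let_def
      by (intro abs_diff_le abs_add_le abs_mult_le abs_power_le osc_bounds M_derivatives M_path(2) abs_numeral_le t)
    also have "\<dots> = n\<^sup>2 * (3 * M ^ 5) + n * (2 * M ^ 7)" by algebra
    also have "\<dots> \<le> n\<^sup>2 * (3 * M ^ 5) + n\<^sup>2 * (2 * M ^ 7)"
      using n M_ge_1 by (intro add_left_mono mult_right_mono) (auto simp: power2_eq_square)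
    finally show ?thesis unfolding ph i by (simp add: algebra_simps)
  qed
qed

text \<open>Two first derivatives of the bump give \<open>n^2\<close>, the width of the support
  takes one factor back.\<close>

lemma kinetic_crude:
  assumes t: "t \<in> {0..T}"
  shows "\<bar>x_integral (kinetic_second T \<phi> osc) t\<bar> \<le> 2 * (n\<^sup>2 * (8 * M ^ 5)) / n"
proof (rule x_integral_abs_le_scaled[OF kinetic_second_decaying[OF T path osc_Schwartz] t, where d="- (n * v * t) + c"])
  show "n > 0" using n by simp
  fix x
  have ph: "n * x + (- (n * v * t) + c) = phase t x" by simp
  show "\<bar>kinetic_second T \<phi> osc t x\<bar> \<le> (n\<^sup>2 * (8 * M ^ 5)) * indicator {-1..1} (n * x + (- (n * v * t) + c))"
  proof (cases "\<bar>phase t x\<bar> > 1")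
    case True
    then show ?thesis using M_ge_1 unfolding ph by (simp del: One_nat_def add: kinetic_second_def osc_outside[OF t])
  next
    case False
    then have i: "indicator {-1..1} (phase t x) = (1::real)"
      by (intro indicator_simps(1)) (simp only: atLeastAtMost_iff, linarith)
    have "\<bar>kinetic_second T \<phi> osc t x\<bar> \<le> (n * (2 * M * M))\<^sup>2 * M + 2 * M * (n * (2 * M * M)) * (n * (M * M))"
      unfolding kinetic_second_def
      by (intro abs_diff_le abs_add_le abs_mult_le abs_power_le osc_bounds M_derivatives M_path(2) abs_numeral_le t)
    also have "\<dots> = n\<^sup>2 * (8 * M ^ 5)" by algebra
    finally show ?thesis unfolding ph i by simp
  qed
qed

text \<open>The product of \<open>h_tx\<close> and \<open>h_xx\<close> contains
  \<open>- v * n ^ 4 * (A * b'')^2\<close>; all else is of order \<open>n ^ 3\<close>. The sign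
  condition on \<open>w * v\<close> lets the inverse squared slope be replaced by a constant lower
  bound.\<close>

lemma cocycle_second_leading:
  assumes t: "t \<in> {0..T}" and w: "w * v \<le> 0"
  shows "- 2 * w * x_integral (cocycle_second T \<phi> osc) t \<le>
    (2 * w * v / M\<^sup>2 * n ^ 4 * (A t)\<^sup>2 * (LINT y|lborel. ((deriv ^^ 2) bump y)\<^sup>2)
      + 2 * (n ^ 3 * (20 * \<bar>w\<bar> * M ^ 10))) / n"
proof -
  let ?g = "\<lambda>y. 2 * w * v / M\<^sup>2 * n ^ 4 * (A t)\<^sup>2 * ((deriv ^^ 2) bump y)\<^sup>2
      + n ^ 3 * (20 * \<bar>w\<bar> * M ^ 10) * indicator {-1..1} y"
  have "x_integral (\<lambda>t x. (- 2 * w) * cocycle_second T \<phi> osc t x) t \<le> (LINT y|lborel. ?g y) / n"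
  proof (rule x_integral_le_scaled[OF strip_decaying_cmult[OF cocycle_second_decaying[OF T path osc_Schwartz]] t, where d="- (n * v * t) + c"])
    show "n > 0" using n by simp
    show "integrable lborel ?g"
      by (intro Bochner_Integration.integrable_add integrable_mult_right deriv_bump_square integrable_indicator_Icc)
    fix x
    let ?b2 = "(deriv ^^ 2) bump (phase t x)" and ?b1 = "deriv bump (phase t x)"
    let ?u = "inverse (pd T 1 0 \<phi> t x)"
    have ph: "n * x + (- (n * v * t) + c) = phase t x" by simp
    show "(- 2 * w) * cocycle_second T \<phi> osc t x \<le> ?g (n * x + (- (n * v * t) + c))"
    proof (cases "\<bar>phase t x\<bar> > 1")
      case True
      then have "?b2 = 0" by (rule deriv_bump_eq_0)
      then show ?thesis using True M_ge_1 n unfolding ph by (simp del: One_nat_def add: cocycle_second_def osc_outside[OF t])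
    next
      case False
      then have i: "indicator {-1..1} (phase t x) = (1::real)"
      by (intro indicator_simps(1)) (simp only: atLeastAtMost_iff, linarith)
      let ?a = "pd T 1 1 \<phi> t x" and ?b = "pd T 2 0 \<phi> t x"
      let ?a' = "pd T 1 1 osc t x" and ?b' = "pd T 2 0 osc t x" and ?p' = "pd T 1 0 osc t x"
      \<comment> \<open>Everything except the top-order term, with opposite sign: in each summand at
        least one bump derivative is missing.\<close>
      define r where "r = 2 * w * (n ^ 3 * (A t * deriv A t * ?b1 * ?b2)) * ?u\<^sup>2
        - 2 * w * (2 * ?p' * (?a' * ?b + ?a * ?b') * ?u ^ 3) + 2 * w * (3 * ?p'\<^sup>2 * ?a * ?b * ?u ^ 4)"
      have eq: "(- 2 * w) * cocycle_second T \<phi> osc t x = 2 * w * v * n ^ 4 * (A t)\<^sup>2 * ?b2\<^sup>2 * ?u\<^sup>2 - r"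
      proof -
        have "?a' * ?b' = n ^ 3 * (A t * deriv A t * ?b1 * ?b2) - v * n ^ 4 * (A t)\<^sup>2 * ?b2\<^sup>2"
          unfolding pd_travelling_bump(3,4)[OF T A t] by algebra
        then show ?thesis
          unfolding cocycle_second_def Let_def r_def by algebra
      qed
      have n': "\<bar>n\<bar> \<le> n" and w': "\<bar>w\<bar> \<le> \<bar>w\<bar>" using n by simp_all
      have "\<bar>r\<bar> \<le> 2 * \<bar>w\<bar> * (n ^ 3 * (M * M * M * M)) * M\<^sup>2
        + 2 * \<bar>w\<bar> * (2 * (n * (M * M)) * (n\<^sup>2 * (2 * M * M) * M + M * (n\<^sup>2 * (M * M))) * M ^ 3)
        + 2 * \<bar>w\<bar> * (3 * (n * (M * M))\<^sup>2 * M * M * M ^ 4)"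
        unfolding r_def
        by (intro abs_diff_le abs_add_le abs_mult_le abs_power_le osc_bounds M_derivatives M_path(2) abs_numeral_le t n' w' M_amplitude M_bump)
      also have "\<dots> = \<bar>w\<bar> * (n ^ 3 * (2 * M ^ 6) + n ^ 3 * (12 * M ^ 8) + n ^ 2 * (6 * M ^ 10))" by algebra
      also have "\<dots> \<le> \<bar>w\<bar> * (n ^ 3 * (2 * M ^ 10) + n ^ 3 * (12 * M ^ 10) + n ^ 3 * (6 * M ^ 10))"
        using n M_ge_1 by (intro mult_left_mono add_mono mult_right_mono power_increasing) auto
      also have "\<dots> = n ^ 3 * (20 * \<bar>w\<bar> * M ^ 10)" by algebra
      finally have r: "- r \<le> n ^ 3 * (20 * \<bar>w\<bar> * M ^ 10)" by linarith
      \<comment> \<open>The bound needed is from below, because it multiplies a nonpositive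
        coefficient; it comes from the upper bound \<open>M\<close> on the slope.\<close>
      have u: "1 / M\<^sup>2 \<le> ?u\<^sup>2"
      proof -
        have nz: "pd T 1 0 \<phi> t x \<noteq> 0"
          using path_slope_lower_bound[OF T path] t by (metis less_le_not_le)
        have "1 = ?u\<^sup>2 * (pd T 1 0 \<phi> t x)\<^sup>2" using nz by (simp flip: power_mult_distrib)
        also have "\<dots> \<le> ?u\<^sup>2 * M\<^sup>2"
          using M_derivatives(2)[OF t, of x] M_ge_1 by (intro mult_left_mono) (auto simp: abs_le_square_iff[symmetric])
        finally show ?thesis using M_ge_1 by (simp add: pos_divide_le_eq)
      qed
      have "2 * w * v * n ^ 4 * (A t)\<^sup>2 * ?b2\<^sup>2 \<le> 0"
        using mult_nonpos_nonneg[OF w, of "2 * n ^ 4 * (A t)\<^sup>2 * ?b2\<^sup>2"] n by (simp add: mult_ac)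
      from mult_left_mono_neg[OF u this] r
      show ?thesis unfolding eq ph i by simp
    qed
  qed
  also have "(LINT y|lborel. ?g y) = 2 * w * v / M\<^sup>2 * n ^ 4 * (A t)\<^sup>2 * (LINT y|lborel. ((deriv ^^ 2) bump y)\<^sup>2)
      + 2 * (n ^ 3 * (20 * \<bar>w\<bar> * M ^ 10))"
    unfolding Bochner_Integration.integral_add[OF integrable_mult_right[OF deriv_bump_square(1)] integrable_indicator_Icc]
      integral_indicator_Icc by simp
  finally show ?thesis unfolding x_integral_cmult .
qed

text \<open>Completing the algebra leaves \<open>n^2 * (A * b')^2\<close> times the quadratic in
  \<open>v\<close>. Its sign is required on the support of the bump only, since
  \<open>\<phi>_t\<close> need not keep its sign elsewhere.\<close>

lemma kinetic_leading:
  assumes t: "t \<in> {0..T}"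
    and neg: "\<And>x. A t \<noteq> 0 \<Longrightarrow> \<bar>phase t x\<bar> \<le> 1 \<Longrightarrow>
      v\<^sup>2 * pd T 1 0 \<phi> t x - 2 * v * pd T 0 1 \<phi> t x \<le> - \<kappa>"
  shows "x_integral (kinetic_second T \<phi> osc) t \<le>
    (- \<kappa> * n\<^sup>2 * (A t)\<^sup>2 * (LINT y|lborel. (deriv bump y)\<^sup>2) + 2 * (n * (5 * M ^ 5))) / n"
proof -
  let ?g = "\<lambda>y. - \<kappa> * n\<^sup>2 * (A t)\<^sup>2 * (deriv bump y)\<^sup>2 + n * (5 * M ^ 5) * indicator {-1..1} y"
  have b1: "integrable lborel (\<lambda>y. (deriv bump y)\<^sup>2)" using deriv_bump_square(1)[of 1] by simp
  have "x_integral (kinetic_second T \<phi> osc) t \<le> (LINT y|lborel. ?g y) / n"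
  proof (rule x_integral_le_scaled[OF kinetic_second_decaying[OF T path osc_Schwartz] t, where d="- (n * v * t) + c"])
    show "n > 0" using n by simp
    show "integrable lborel ?g"
      by (intro Bochner_Integration.integrable_add integrable_mult_right b1 integrable_indicator_Icc)
    fix x
    let ?b1 = "deriv bump (phase t x)" and ?b0 = "bump (phase t x)"
    let ?p = "pd T 1 0 \<phi> t x" and ?q = "pd T 0 1 \<phi> t x"
    have ph: "n * x + (- (n * v * t) + c) = phase t x" by simp
    show "kinetic_second T \<phi> osc t x \<le> ?g (n * x + (- (n * v * t) + c))"
    proof (cases "\<bar>phase t x\<bar> > 1")
      case True
      then have "?b1 = 0" using deriv_bump_eq_0[of _ 1] by simp
      then show ?thesis using True M_ge_1 n unfolding ph by (simp del: One_nat_def add: kinetic_second_def osc_outside[OF t])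
    next
      case False
      then have i: "indicator {-1..1} (phase t x) = (1::real)"
      by (intro indicator_simps(1)) (simp only: atLeastAtMost_iff, linarith)
      define r where "r = n * (2 * ?q * A t * deriv A t * ?b0 * ?b1 - 2 * v * ?p * A t * deriv A t * ?b0 * ?b1)
        + ?p * (deriv A t)\<^sup>2 * ?b0\<^sup>2"
      have eq: "kinetic_second T \<phi> osc t x = n\<^sup>2 * (A t)\<^sup>2 * ?b1\<^sup>2 * (v\<^sup>2 * ?p - 2 * v * ?q) + r"
        unfolding kinetic_second_def pd_travelling_bump(1,2)[OF T A t] r_def by algebra
      have n': "\<bar>n\<bar> \<le> n" using n by simp
      have "\<bar>r\<bar> \<le> n * (2 * M * M * M * M * M + 2 * 1 * M * M * M * M * M) + M * M\<^sup>2 * M\<^sup>2"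
        unfolding r_def
        by (intro abs_diff_le abs_add_le abs_mult_le abs_power_le osc_bounds M_derivatives M_path(2) abs_numeral_le t n' v M_amplitude M_bump)
      also have "\<dots> = n * (4 * M ^ 5) + 1 * M ^ 5" by algebra
      also have "\<dots> \<le> n * (4 * M ^ 5) + n * M ^ 5"
        using n M_ge_1 by (intro add_left_mono mult_right_mono) auto
      finally have r: "r \<le> n * (5 * M ^ 5)" by linarith
      have "n\<^sup>2 * (A t)\<^sup>2 * ?b1\<^sup>2 * (v\<^sup>2 * ?p - 2 * v * ?q) \<le> n\<^sup>2 * (A t)\<^sup>2 * ?b1\<^sup>2 * (- \<kappa>)"
      proof (cases "A t = 0")
        case nonzero: False
        show ?thesis
          by (rule mult_left_mono[OF neg[OF nonzero]]) (use False in auto)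
      qed simp
      with r show ?thesis unfolding eq ph i by (simp add: mult_ac)
    qed
  qed
  also have "(LINT y|lborel. ?g y) = - \<kappa> * n\<^sup>2 * (A t)\<^sup>2 * (LINT y|lborel. (deriv bump y)\<^sup>2) + 2 * (n * (5 * M ^ 5))"
    unfolding Bochner_Integration.integral_add[OF integrable_mult_right[OF b1] integrable_indicator_Icc]
      integral_indicator_Icc by simp
  finally show ?thesis .
qed

text \<open>The factor \<open>n\<^sup>2\<close> of the crude bound is removed by moving one \<open>x\<close>-derivative off the bump.\<close>

lemma cocycle_first_by_parts:
  assumes t: "t \<in> {0..T}"
  shows "\<bar>x_integral (cocycle_first T \<phi> osc) t\<bar> \<le> 2 * (n * (9 * M ^ 7)) / n"
proof -
  let ?u = "\<lambda>x. inverse (pd T 1 0 \<phi> t x)"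
  let ?a = "pd T 1 1 \<phi> t" and ?b = "pd T 2 0 \<phi> t" and ?ax = "pd T 2 1 \<phi> t" and ?bx = "pd T 3 0 \<phi> t"
  \<comment> \<open>In the derivative of \<open>?F\<close>, the terms in which \<open>h_t\<close>
    and \<open>h_x\<close> are differentiated, together with the slope factor of the second summand,
    make up exactly \<open>cocycle_first\<close>. The rest \<open>?r\<close> contains only first
    derivatives of the bump, so it is of order \<open>n\<close>.\<close>
  let ?F = "\<lambda>x. pd T 0 1 osc t x * ?b x * (?u x)\<^sup>2 + pd T 1 0 osc t x * ?a x * (?u x)\<^sup>2"
  let ?r = "\<lambda>t x. pd T 0 1 osc t x * (pd T 3 0 \<phi> t x * (inverse (pd T 1 0 \<phi> t x))\<^sup>2
      - 2 * (pd T 2 0 \<phi> t x)\<^sup>2 * inverse (pd T 1 0 \<phi> t x) ^ 3)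
      + pd T 1 0 osc t x * (pd T 2 1 \<phi> t x * (inverse (pd T 1 0 \<phi> t x))\<^sup>2)"
  have s: "smooth_strip T \<phi>" "smooth_strip T osc"
    using path osc_Schwartz by (auto simp: Virasoro_Bott_path_def Schwartz_strip_def)
  have nz: "pd T 1 0 \<phi> t x \<noteq> 0" for x
    using path_slope_lower_bound[OF T path] t by (metis less_le_not_le)
  have d\<phi>: "(pd T i j \<phi> t has_real_derivative pd T (Suc i) j \<phi> t x) (at x)" for i j x
    by (rule smooth_strip_has_derivative_x[OF s(1) t])
  have dh: "(pd T i j osc t has_real_derivative pd T (Suc i) j osc t x) (at x)" for i j x
    by (rule smooth_strip_has_derivative_x[OF s(2) t])
  have F: "(?F has_real_derivative cocycle_first T \<phi> osc t x + ?r t x) (at x)" for x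
    using d\<phi>[of 1 0 x] d\<phi>[of 1 1 x] d\<phi>[of 2 0 x] dh[of 0 1 x] dh[of 1 0 x] nz[of x]
    by (auto intro!: derivative_eq_intros simp: numeral_2_eq_2 numeral_3_eq_3 cocycle_first_def Let_def)
       (simp add: field_simps power2_eq_square power3_eq_cube)
  have bdd: "strip_bounded T (\<lambda>t x. pd T 3 0 \<phi> t x * (inverse (pd T 1 0 \<phi> t x))\<^sup>2
      + (- 2) * (pd T 2 0 \<phi> t x)\<^sup>2 * inverse (pd T 1 0 \<phi> t x) ^ 3)"
    "strip_bounded T (\<lambda>t x. pd T 2 1 \<phi> t x * (inverse (pd T 1 0 \<phi> t x))\<^sup>2)"
    using path_pd_decaying[OF T path, of 0 3] path_pd_decaying[OF T path, of 1 2]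
      path_pd_decaying[OF T path, of 0 2] path_inverse_slope_bounded[OF T path]
    by (intro strip_bounded_add strip_bounded_mult strip_bounded_power strip_bounded_const;
        auto intro: strip_decaying_imp_bounded)+
  have r_dec: "strip_decaying T ?r"
    using strip_decaying_add[OF strip_decaying_mult_bounded(1)[OF Schwartz_strip_decaying[OF osc_Schwartz, of 0 1] bdd(1)]
        strip_decaying_mult_bounded(1)[OF Schwartz_strip_decaying[OF osc_Schwartz, of 1 0] bdd(2)]]
    by simp
  note c_dec = cocycle_first_decaying[OF T path osc_Schwartz]
  have "(LINT x|lborel. cocycle_first T \<phi> osc t x + ?r t x) = 0"
  proof (rule integral_deriv_compact_support[OF F, where R="1 + \<bar>n * v * t\<bar> + \<bar>c\<bar>"])
    show "continuous_on UNIV (\<lambda>x. cocycle_first T \<phi> osc t x + ?r t x)"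
      by (rule strip_decaying_slice[OF strip_decaying_add[OF c_dec r_dec] t])
    fix x assume x: "\<bar>x\<bar> > 1 + \<bar>n * v * t\<bar> + \<bar>c\<bar>"
    have "\<bar>x\<bar> \<le> \<bar>n * x\<bar>" using n by (simp add: abs_mult mult_le_cancel_right1)
    with x have "\<bar>phase t x\<bar> > 1" by simp
    from osc_outside[OF t this] show "?F x = 0" by simp
  qed
  then have "x_integral (cocycle_first T \<phi> osc) t = - x_integral ?r t"
    using x_integral_add[OF c_dec r_dec t] by (simp add: x_integral_def)
  moreover have "\<bar>x_integral ?r t\<bar> \<le> 2 * (n * (9 * M ^ 7)) / n"
  proof (rule x_integral_abs_le_scaled[OF r_dec t, where d="- (n * v * t) + c"])
    show "n > 0" using n by simp
    fix x
    have ph: "n * x + (- (n * v * t) + c) = phase t x" by simp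
    show "\<bar>?r t x\<bar> \<le> (n * (9 * M ^ 7)) * indicator {-1..1} (n * x + (- (n * v * t) + c))"
    proof (cases "\<bar>phase t x\<bar> > 1")
      case True
      then show ?thesis using M_ge_1 n unfolding ph by (simp del: One_nat_def add: osc_outside[OF t])
    next
      case False
      then have i: "indicator {-1..1} (phase t x) = (1::real)"
      by (intro indicator_simps(1)) (simp only: atLeastAtMost_iff, linarith)
      have "\<bar>?r t x\<bar> \<le> n * (2 * M * M) * (M * M\<^sup>2 + 2 * M\<^sup>2 * M ^ 3) + n * (M * M) * (M * M\<^sup>2)"
        by (intro abs_diff_le abs_add_le abs_mult_le abs_power_le osc_bounds M_derivatives M_path(2) abs_numeral_le t)
      also have "\<dots> = n * (3 * M ^ 5 + 4 * M ^ 7)" by algebra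
      also have "\<dots> \<le> n * (3 * M ^ 7 + 4 * M ^ 7)"
        using n M_ge_1 by (intro mult_left_mono add_right_mono power_increasing) auto
      also have "\<dots> \<le> n * (9 * M ^ 7)" using n M_ge_1 by simp
      finally show ?thesis unfolding ph i by simp
    qed
  qed
  ultimately show ?thesis by simp
qed

end

end

subsection \<open>Existence of negative variations\<close>

lemma variation_bound_exists:
  assumes "T > 0" "Virasoro_Bott_path T \<phi> \<alpha>" "smooth_real A"
  obtains M where "variation_bound T \<phi> A M"
proof -
  have A: "strip_bounded T (\<lambda>t x. (deriv ^^ i) A t)" for i
  proof -
    have "bounded ((deriv ^^ i) A ` {0..T})"
      by (intro compact_imp_bounded compact_continuous_image smooth_real_continuous assms(3)) auto
    then obtain C where C: "\<forall>t\<in>{0..T}. \<bar>(deriv ^^ i) A t\<bar> \<le> C" by (auto simp: bounded_iff)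
    have "continuous_on (strip T) (\<lambda>p. (deriv ^^ i) A (fst p))"
      by (rule continuous_on_compose2[OF smooth_real_continuous[OF assms(3), of UNIV]])
         (auto intro: continuous_intros)
    then show ?thesis
      by (intro strip_boundedI[of _ _ C]) (use C in \<open>auto simp: case_prod_unfold\<close>)
  qed
  have b: "strip_bounded T (\<lambda>t x. (deriv ^^ i) bump x)" for i
  proof -
    obtain C where C: "C > 0" "\<And>x. \<bar>(deriv ^^ i) bump x\<bar> \<le> C"
      by (rule continuous_vanishing_outside_bounded[OF smooth_real_continuous[OF smooth_bump] deriv_bump_eq_0])
         (assumption, rule that, assumption+)
    have "continuous_on (strip T) (\<lambda>p. (deriv ^^ i) bump (snd p))"
      by (rule continuous_on_compose2[OF smooth_real_continuous[OF smooth_bump, of UNIV]])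
         (auto intro: continuous_intros)
    then show ?thesis
      by (intro strip_boundedI[of _ _ C]) (use C in \<open>auto simp: case_prod_unfold\<close>)
  qed
  \<comment> \<open>Amplitude and bump are regarded as functions on the strip, so that one list
    produces one common bound.\<close>
  let ?fs = "[pd T 0 1 \<phi>, pd T 1 0 \<phi>, pd T 1 1 \<phi>, pd T 2 0 \<phi>, pd T 2 1 \<phi>, pd T 3 0 \<phi>, pd T 3 1 \<phi>,
    \<lambda>t x. inverse (pd T 1 0 \<phi> t x), \<lambda>t x. (deriv ^^ 0) A t, \<lambda>t x. (deriv ^^ 1) A t,
    \<lambda>t x. (deriv ^^ 0) bump x, \<lambda>t x. (deriv ^^ 1) bump x, \<lambda>t x. (deriv ^^ 2) bump x]"
  have p: "strip_bounded T (pd T i j \<phi>)" if "j > 0 \<or> i > 1" for i j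
    by (rule strip_decaying_imp_bounded[OF path_pd_decaying[OF assms(1,2) that]])
  have all: "list_all (strip_bounded T) ?fs"
    using path_slope_bounded[OF assms(1,2)] path_inverse_slope_bounded[OF assms(1,2)]
      A[of 0] A[of 1] b[of 0] b[of 1] b[of 2] by (simp add: p)
  have "\<exists>L. \<forall>f\<in>set ?fs. \<forall>t\<in>{0..T}. \<forall>x. \<bar>f t x\<bar> \<le> L"
    by (rule strip_bounded_common_bound) (use all in \<open>simp only: list_all_iff\<close>)
  then obtain L where L: "\<forall>f\<in>set ?fs. \<forall>t\<in>{0..T}. \<forall>x. \<bar>f t x\<bar> \<le> L" by blast
  have mem: "f \<in> set ?fs \<Longrightarrow> t \<in> {0..T} \<Longrightarrow> \<bar>f t x\<bar> \<le> max L 1" for f t x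
    using L by (meson max.coboundedI1)
  have t0: "(0::real) \<in> {0..T}" using assms(1) by simp
  have pd: "\<bar>pd T i j \<phi> t x\<bar> \<le> max L 1" if "t \<in> {0..T}" "i \<le> 3" "j \<le> 1" "(i, j) \<noteq> (0, 0)" for t x i j
  proof (rule mem[of "pd T i j \<phi>", OF _ that(1)])
    have "i = 0 \<or> i = 1 \<or> i = 2 \<or> i = 3" "j = 0 \<or> j = 1" using that by auto
    then show "pd T i j \<phi> \<in> set ?fs" using that(4) by auto
  qed
  have "variation_bound T \<phi> A (max L 1)"
    unfolding variation_bound_def
  proof (intro conjI ballI allI impI)
    fix t x assume t: "t \<in> {0..T}"
    show "\<bar>inverse (pd T 1 0 \<phi> t x)\<bar> \<le> max L 1"
      using mem[of "\<lambda>t x. inverse (pd T 1 0 \<phi> t x)" t x] t by simp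
    show "\<bar>A t\<bar> \<le> max L 1" "\<bar>deriv A t\<bar> \<le> max L 1"
      using mem[of "\<lambda>t x. (deriv ^^ 0) A t" t 0] mem[of "\<lambda>t x. (deriv ^^ 1) A t" t 0] t by simp_all
  next
    fix y
    show "\<bar>bump y\<bar> \<le> max L 1" "\<bar>deriv bump y\<bar> \<le> max L 1" "\<bar>(deriv ^^ 2) bump y\<bar> \<le> max L 1"
      using mem[of "\<lambda>t x. (deriv ^^ 0) bump x" 0 y] mem[of "\<lambda>t x. (deriv ^^ 1) bump x" 0 y]
        mem[of "\<lambda>t x. (deriv ^^ 2) bump x" 0 y] t0 by simp_all
  qed (use pd in auto)
  then show ?thesis by (rule that)
qed

text \<open>Turns bounds at each time into a bound on the integral; the two parts keep separate
  majorants because their estimates come from different lemmas.\<close>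

lemma second_variation_le:
  assumes "T > 0" "Virasoro_Bott_path T \<phi> \<alpha>" "h \<in> Schwartz_strip T"
    and "continuous_on {0..T} F" "continuous_on {0..T} G"
    and F: "\<And>t. t \<in> {0..T} \<Longrightarrow> x_integral (kinetic_second T \<phi> h) t \<le> F t"
    and G: "\<And>t. t \<in> {0..T} \<Longrightarrow> (x_integral (cocycle_first T \<phi> h) t)\<^sup>2 - 2 * w * x_integral (cocycle_second T \<phi> h) t \<le> G t"
  shows "second_variation T \<phi> w h \<le> (LINT t:{0..T}|lborel. F t) + (LINT t:{0..T}|lborel. G t)"
  unfolding second_variation_def
  by (intro add_mono set_integral_mono set_integrable_continuous assms continuous_on_diff continuous_on_power
      continuous_on_mult continuous_on_const x_integral_continuous cocycle_first_decaying[OF assms(1-3)]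
      cocycle_second_decaying[OF assms(1-3)] kinetic_second_decaying[OF assms(1-3)])

lemma set_integral_const_Icc: "T > 0 \<Longrightarrow> (LINT t:{0..T}|lborel. C) = C * T" for C :: real
  by (simp add: set_lebesgue_integral_def)

lemma set_integral_affine_square:
  fixes A :: "real \<Rightarrow> real"
  assumes "T > 0" "continuous_on {0..T} A"
  shows "(LINT t:{0..T}|lborel. C - D * (A t)\<^sup>2) = C * T - D * (LINT t:{0..T}|lborel. (A t)\<^sup>2)"
proof -
  have "set_integrable lborel {0..T} (\<lambda>t. D * (A t)\<^sup>2)" "set_integrable lborel {0..T} (\<lambda>t. C)"
    by (intro set_integrable_continuous continuous_intros assms)+
  from set_integral_diff(2)[OF this(2,1)] show ?thesis
    by (simp add: set_integral_const_Icc[OF assms(1)])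
qed

text \<open>The leading term is \<open>- \<kappa> * n ^ 3\<close> times the integral of
  \<open>A^2\<close>, and every positive contribution is at most of order \<open>n^2\<close>, so a
  large \<open>n\<close> decides.\<close>

lemma negative_variation_momentum:
  assumes T: "T > 0" and path: "Virasoro_Bott_path T \<phi> \<alpha>" and "w \<noteq> 0"
  shows "\<exists>h\<in>Schwartz_strip T. h 0 = (\<lambda>x. 0) \<and> h T = (\<lambda>x. 0) \<and> second_variation T \<phi> w h < 0"
proof -
  \<comment> \<open>The affine map sends \<open>[0, T]\<close> onto \<open>[-1, 1]\<close>, so the
    amplitude vanishes at both end times and the endpoints of the path are kept.\<close>
  define A where "A = (\<lambda>t. bump (2 / T * t + (- 1)))"
  have A: "smooth_real A" unfolding A_def by (rule smooth_real_affine[OF smooth_bump])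
  have A_cont: "continuous_on {0..T} A" using smooth_real_continuous[OF A, of _ 0] by simp
  have A0: "A 0 = 0" "A T = 0" "A (T / 2) > 0"
    using T bump_0 by (auto simp: A_def bump_eq_0)
  have SA: "(LINT t:{0..T}|lborel. (A t)\<^sup>2) > 0" (is "?SA > 0")
    by (rule set_integral_pos_continuous[of _ _ _ "T / 2"])
       (use T A0 in \<open>auto intro!: continuous_intros A_cont\<close>)
  obtain M where M: "variation_bound T \<phi> A M"
    by (rule variation_bound_exists[OF T path A])
  note hyps = T path A M
  have M_ge_1: "M \<ge> 1" using M by (simp add: variation_bound_def)
  \<comment> \<open>Makes \<open>w * v = - \<bar>w\<bar>\<close>, as negative as
    \<open>\<bar>v\<bar> \<le> 1\<close> permits.\<close>
  define v where "v = - sgn w"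
  have v: "\<bar>v\<bar> \<le> 1" "w * v = - \<bar>w\<bar>" by (auto simp: v_def sgn_if)
  let ?I = "LINT y|lborel. ((deriv ^^ 2) bump y)\<^sup>2"
  define K1 where "K1 = 2 * (3 * M ^ 5 + 2 * M ^ 7)"
  define K2 where "K2 = 40 * \<bar>w\<bar> * M ^ 10"
  define \<kappa> where "\<kappa> = 2 * \<bar>w\<bar> / M\<^sup>2 * ?I"
  have \<kappa>: "\<kappa> > 0" using assms(3) M_ge_1 deriv_bump_square(2)[of 2] by (simp add: \<kappa>_def)
  define C where "C = (16 * M ^ 5 + K1\<^sup>2 + K2) * T"
  \<comment> \<open>\<open>C\<close> collects the contributions of order \<open>n^2\<close>; the
    bound obtained is \<open>n^2 * (C - n * (\<kappa> * ?SA))\<close>, and the summand 1 makes the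
    inequality strict.\<close>
  define n where "n = max 1 (C / (\<kappa> * ?SA) + 1)"
  have n: "n \<ge> 1" by (simp add: n_def)
  \<comment> \<open>The leading coefficient has the right sign at every place, so the bump may be
    put anywhere and \<open>c = 0\<close> will do.\<close>
  let ?h = "travelling_bump A n v 0"
  have h: "?h \<in> Schwartz_strip T" using n by (intro travelling_bump_Schwartz T A) simp
  have "second_variation T \<phi> w ?h \<le> (LINT t:{0..T}|lborel. n * (16 * M ^ 5)) +
      (LINT t:{0..T}|lborel. n\<^sup>2 * (K1\<^sup>2 + K2) - \<kappa> * n ^ 3 * (A t)\<^sup>2)"
  proof (rule second_variation_le[OF T path h])
    fix t assume t: "t \<in> {0..T}"
    have "2 * (n\<^sup>2 * (8 * M ^ 5)) / n = n * (16 * M ^ 5)"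
      using n by (simp add: field_simps power2_eq_square)
    then show "x_integral (kinetic_second T \<phi> ?h) t \<le> n * (16 * M ^ 5)"
      using kinetic_crude[OF hyps n v(1) t, of 0] by (simp only: abs_le_iff)
    have "2 * (n\<^sup>2 * (3 * M ^ 5 + 2 * M ^ 7)) / n = n * K1"
      using n by (simp add: field_simps power2_eq_square K1_def)
    then have "\<bar>x_integral (cocycle_first T \<phi> ?h) t\<bar> \<le> n * K1"
      using cocycle_first_crude[OF hyps n v(1) t, of 0] by simp
    from power_mono[OF this, of 2] have 1: "(x_integral (cocycle_first T \<phi> ?h) t)\<^sup>2 \<le> n\<^sup>2 * K1\<^sup>2"
      by (simp add: power_mult_distrib)
    have "(2 * w * v / M\<^sup>2 * n ^ 4 * (A t)\<^sup>2 * ?I + 2 * (n ^ 3 * (20 * \<bar>w\<bar> * M ^ 10))) / n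
        = n\<^sup>2 * K2 - \<kappa> * n ^ 3 * (A t)\<^sup>2"
    proof -
      have *: "2 * w * v = - (2 * \<bar>w\<bar>)" by (simp add: mult.assoc v(2))
      have n4: "n ^ 4 = n * n ^ 3" "n ^ 3 = n * n\<^sup>2"
        by (simp_all add: power_numeral_reduce)
      have "(2 * w * v / M\<^sup>2 * n ^ 4 * (A t)\<^sup>2 * ?I + 2 * (n ^ 3 * (20 * \<bar>w\<bar> * M ^ 10)))
          = n * (n\<^sup>2 * K2 - \<kappa> * n ^ 3 * (A t)\<^sup>2)"
        unfolding * n4 K2_def \<kappa>_def by (simp add: algebra_simps)
      then show ?thesis using n by simp
    qed
    then have 2: "- 2 * w * x_integral (cocycle_second T \<phi> ?h) t \<le> n\<^sup>2 * K2 - \<kappa> * n ^ 3 * (A t)\<^sup>2"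
      using cocycle_second_leading[OF hyps n v(1) t, of w 0] v(2) by simp
    from 1 2 show "(x_integral (cocycle_first T \<phi> ?h) t)\<^sup>2 - 2 * w * x_integral (cocycle_second T \<phi> ?h) t
        \<le> n\<^sup>2 * (K1\<^sup>2 + K2) - \<kappa> * n ^ 3 * (A t)\<^sup>2"
      by (simp add: algebra_simps)
  qed (intro continuous_intros A_cont)+
  also have "\<dots> = n * (16 * M ^ 5) * T + (n\<^sup>2 * (K1\<^sup>2 + K2) * T - \<kappa> * n ^ 3 * ?SA)"
    by (simp only: set_integral_const_Icc[OF T] set_integral_affine_square[OF T A_cont])
  also have "\<dots> \<le> n\<^sup>2 * (16 * M ^ 5) * T + (n\<^sup>2 * (K1\<^sup>2 + K2) * T - \<kappa> * n ^ 3 * ?SA)"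
    using n M_ge_1 T by (intro add_right_mono mult_right_mono) (auto simp: power2_eq_square)
  also have "\<dots> = n\<^sup>2 * (C - n * (\<kappa> * ?SA))"
    unfolding C_def by algebra
  also have "\<dots> < 0"
  proof (rule mult_pos_neg)
    have "C / (\<kappa> * ?SA) < n" by (simp add: n_def)
    then show "C - n * (\<kappa> * ?SA) < 0" using \<kappa> SA by (simp add: pos_divide_less_eq)
  qed (use n in simp)
  finally show ?thesis
    using travelling_bump_zero[of A] A0 h by (intro bexI[of _ ?h]) auto
qed

text \<open>With \<open>w = 0\<close> only the kinetic term can be negative, at order
  \<open>n\<close>; integration by parts keeps the squared cocycle term bounded. The bump has to be
  localized near a point where \<open>\<phi>_t\<close> does not vanish.\<close>

lemma negative_variation_velocity:
  assumes T: "T > 0" and path: "Virasoro_Bott_path T \<phi> \<alpha>"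
    and t1: "t1 \<in> {0..T}" "pd T 0 1 \<phi> t1 x1 \<noteq> 0"
  shows "\<exists>h\<in>Schwartz_strip T. h 0 = (\<lambda>x. 0) \<and> h T = (\<lambda>x. 0) \<and> second_variation T \<phi> 0 h < 0"
proof -
  define q where "q = pd T 0 1 \<phi> t1 x1"
  have q: "q \<noteq> 0" using t1 by (simp add: q_def)
  have s: "smooth_strip T \<phi>" using path by (simp add: Virasoro_Bott_path_def)
  obtain d where d: "d > 0"
    "\<forall>p\<in>strip T. dist p (t1, x1) < d \<longrightarrow> dist ((\<lambda>(t, x). pd T 0 1 \<phi> t x) p) ((\<lambda>(t, x). pd T 0 1 \<phi> t x) (t1, x1)) < \<bar>q\<bar> / 2"
    using smooth_strip_continuous[OF s, of 0 1, unfolded continuous_on_iff, rule_format, of "(t1, x1)" "\<bar>q\<bar> / 2"] t1(1) q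
    by auto
  \<comment> \<open>By continuity \<open>\<phi>_t\<close> keeps the sign of \<open>q\<close> and at
    least half of its size in a ball of radius \<open>d\<close>; the sum of coordinate distances is
    easier to control than the Euclidean one.\<close>
  have near: "\<bar>q\<bar> / 2 \<le> sgn q * pd T 0 1 \<phi> t x" if "t \<in> {0..T}" "\<bar>t - t1\<bar> + \<bar>x - x1\<bar> < d" for t x
  proof -
    have "dist (t, x) (t1, x1) \<le> \<bar>t - t1\<bar> + \<bar>x - x1\<bar>"
      by (simp add: dist_Pair_Pair dist_real_def sqrt_sum_squares_le_sum_abs)
    then have "\<bar>pd T 0 1 \<phi> t x - q\<bar> < \<bar>q\<bar> / 2"
      using d(2) that by (force simp: dist_real_def q_def)
    then show ?thesis by (cases "q > 0") (auto simp: sgn_if abs_if split: if_splits)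
  qed
  \<comment> \<open>The time \<open>t1\<close> may be an endpoint, where the amplitude must vanish.
    Moving it by the fraction \<open>\<mu>\<close> towards \<open>T / 2\<close> yields an interior
    time \<open>t0\<close> at distance at most \<open>d / 8\<close>.\<close>
  define \<mu> where "\<mu> = min (1/2) (d / (8 * T))"
  have \<mu>: "\<mu> > 0" "\<mu> \<le> 1/2" "\<mu> * T \<le> d / 8"
  proof -
    show "\<mu> > 0" "\<mu> \<le> 1/2" using T d by (auto simp: \<mu>_def)
    have "\<mu> \<le> d / (8 * T)" unfolding \<mu>_def by (rule min.cobounded2)
    then have "\<mu> * T \<le> d / (8 * T) * T" using T by (intro mult_right_mono) auto
    then show "\<mu> * T \<le> d / 8" using T by simp
  qed
  define t0 where "t0 = (1 - \<mu>) * t1 + \<mu> * (T / 2)"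
  have t0: "t0 > 0" "t0 < T" "\<bar>t0 - t1\<bar> \<le> d / 8"
  proof -
    have p: "(1 - \<mu>) * t1 \<ge> 0" "\<mu> * (T / 2) > 0" using \<mu> t1 T by auto
    then show "t0 > 0" unfolding t0_def by linarith
    have "(1 - \<mu>) * t1 \<le> (1 - \<mu>) * T" using \<mu> t1 by (intro mult_left_mono) auto
    moreover have "\<mu> * (T / 2) < \<mu> * T" using \<mu> T by simp
    ultimately show "t0 < T" unfolding t0_def by (simp add: algebra_simps)
    have "\<bar>t0 - t1\<bar> = \<mu> * \<bar>T / 2 - t1\<bar>"
    proof -
      have "t0 - t1 = \<mu> * (T / 2 - t1)" by (simp add: t0_def algebra_simps)
      then show ?thesis using \<mu>(1) by (simp add: abs_mult)
    qed
    also have "\<dots> \<le> \<mu> * T" using \<mu>(1) t1 T by (intro mult_left_mono) (auto simp: abs_le_iff)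
    finally show "\<bar>t0 - t1\<bar> \<le> d / 8" using \<mu>(3) by linarith
  qed
  \<comment> \<open>Half-length of the time support of \<open>A\<close> around \<open>t0\<close>: it
    must stay inside \<open>[0, T]\<close> and close to \<open>t1\<close>.\<close>
  define \<rho> where "\<rho> = min (d / 8) (min t0 (T - t0))"
  have \<rho>: "\<rho> > 0" "\<rho> \<le> d / 8" "\<rho> \<le> t0" "\<rho> \<le> T - t0"
  proof -
    show "\<rho> > 0" using d(1) t0 by (simp add: \<rho>_def)
    show "\<rho> \<le> d / 8" "\<rho> \<le> t0" "\<rho> \<le> T - t0" unfolding \<rho>_def by linarith+
  qed
  define A where "A = (\<lambda>t. bump (1 / \<rho> * t + (- t0 / \<rho>)))"
  have A_eq: "A t = bump ((t - t0) / \<rho>)" for t by (simp add: A_def diff_divide_distrib)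
  have A: "smooth_real A" unfolding A_def by (rule smooth_real_affine[OF smooth_bump])
  have A_cont: "continuous_on {0..T} A" using smooth_real_continuous[OF A, of _ 0] by simp
  have A_supp: "\<bar>t - t0\<bar> < \<rho>" if "A t \<noteq> 0" for t
  proof (rule ccontr)
    assume "\<not> \<bar>t - t0\<bar> < \<rho>"
    then have "\<bar>(t - t0) / \<rho>\<bar> \<ge> 1" using \<rho>(1) by (simp add: abs_divide)
    then show False using that bump_eq_0 by (simp add: A_eq)
  qed
  have A0: "A 0 = 0" "A T = 0" "A t0 > 0"
    using A_supp[of 0] A_supp[of T] \<rho> t0 bump_0 by (auto simp: A_eq)
  have SA: "(LINT t:{0..T}|lborel. (A t)\<^sup>2) > 0" (is "?SA > 0")
    by (rule set_integral_pos_continuous[of _ _ _ t0])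
       (use T A0 t0 in \<open>auto intro!: continuous_intros A_cont\<close>)
  obtain M where M: "variation_bound T \<phi> A M"
    by (rule variation_bound_exists[OF T path A])
  note hyps = T path A M
  have M_ge_1: "M \<ge> 1" using M by (simp add: variation_bound_def)
  \<comment> \<open>The size of the velocity. From \<open>l * M \<le> \<bar>q\<bar> / 2\<close>
    follow \<open>v^2 * \<phi>_x \<le> \<kappa>\<close> and
    \<open>v * \<phi>_t \<ge> \<kappa>\<close> with
    \<open>\<kappa> = l * (\<bar>q\<bar> / 2)\<close>, so the quadratic in \<open>v\<close> is at
    most \<open>\<kappa> - 2 * \<kappa>\<close>.\<close>
  define l where "l = min 1 (\<bar>q\<bar> / (2 * M))"
  have l: "l > 0" "l \<le> 1" "l * M \<le> \<bar>q\<bar> / 2"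
  proof -
    show "l > 0" "l \<le> 1" using q M_ge_1 by (auto simp: l_def)
    have "l \<le> \<bar>q\<bar> / (2 * M)" unfolding l_def by (rule min.cobounded2)
    then have "l * M \<le> \<bar>q\<bar> / (2 * M) * M" using M_ge_1 by (intro mult_right_mono) auto
    then show "l * M \<le> \<bar>q\<bar> / 2" using M_ge_1 by simp
  qed
  define v where "v = sgn q * l"
  have v: "\<bar>v\<bar> \<le> 1" using l by (simp add: v_def abs_mult abs_sgn_eq)
  have v2: "v\<^sup>2 = l * l" using q by (simp add: v_def power2_eq_square sgn_if)
  let ?I = "LINT y|lborel. (deriv bump y)\<^sup>2"
  have I: "?I > 0" using deriv_bump_square(2)[of 1] by simp
  define \<kappa> where "\<kappa> = l * (\<bar>q\<bar> / 2)"
  have \<kappa>: "\<kappa> > 0" using l q by (simp add: \<kappa>_def)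
  define C where "C = (10 * M ^ 5 + (18 * M ^ 7)\<^sup>2) * T"
  \<comment> \<open>The entry \<open>8 / d\<close> makes the bump at most \<open>d / 8\<close> wide
    to either side of its centre; the last entry beats the terms of order 1 collected in
    \<open>C\<close>.\<close>
  define n where "n = max (max 1 (8 / d)) (C / (\<kappa> * ?I * ?SA) + 1)"
  have n: "n \<ge> 1" "n \<ge> 8 / d" "n > C / (\<kappa> * ?I * ?SA)" by (auto simp: n_def)
  \<comment> \<open>Centres the bump at \<open>x1\<close> at time \<open>t0\<close>: the phase
    becomes \<open>n * ((x - x1) - v * (t - t0))\<close>.\<close>
  define c where "c = n * (v * t0 - x1)"
  let ?h = "travelling_bump A n v c"
  have h: "?h \<in> Schwartz_strip T" using n by (intro travelling_bump_Schwartz T A) simp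
  have neg: "v\<^sup>2 * pd T 1 0 \<phi> t x - 2 * v * pd T 0 1 \<phi> t x \<le> - \<kappa>"
    if t: "t \<in> {0..T}" and "A t \<noteq> 0" and y: "\<bar>n * x + (- (n * v)) * t + c\<bar> \<le> 1" for t x
  proof -
    have t': "\<bar>t - t0\<bar> < \<rho>" by (rule A_supp) fact
    have "n * x + (- (n * v)) * t + c = n * ((x - x1) - v * (t - t0))"
      by (simp add: c_def algebra_simps)
    then have "n * \<bar>(x - x1) - v * (t - t0)\<bar> \<le> 1"
      using y n(1) by (simp add: abs_mult)
    moreover have "8 / d * \<bar>(x - x1) - v * (t - t0)\<bar> \<le> n * \<bar>(x - x1) - v * (t - t0)\<bar>"
      using n(2) by (intro mult_right_mono) auto
    ultimately have "8 / d * \<bar>(x - x1) - v * (t - t0)\<bar> \<le> 1" by linarith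
    then have 1: "\<bar>(x - x1) - v * (t - t0)\<bar> \<le> d / 8" using d(1) by (simp add: field_simps)
    have "\<bar>v * (t - t0)\<bar> \<le> 1 * \<rho>" using v t' by (intro abs_mult_le) auto
    then have "\<bar>x - x1\<bar> \<le> d / 8 + \<rho>" using 1 by linarith
    moreover have "\<bar>t - t1\<bar> \<le> \<rho> + d / 8" using t' t0(3) by linarith
    \<comment> \<open>The four errors, each at most \<open>d / 8\<close>, are the width of the bump,
      its travel during the time support, the length of that support, and the shift from
      \<open>t1\<close> to \<open>t0\<close>.\<close>
    ultimately have "\<bar>t - t1\<bar> + \<bar>x - x1\<bar> < d" using \<rho>(2) d(1) by linarith
    from near[OF t this] have 2: "l * (\<bar>q\<bar> / 2) \<le> l * (sgn q * pd T 0 1 \<phi> t x)"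
      using l by (intro mult_left_mono) auto
    have "l * l * pd T 1 0 \<phi> t x \<le> l * l * M"
      using M_path(1)[OF hyps t, of 1 0 x] by (intro mult_left_mono) (auto simp: abs_le_iff)
    also have "\<dots> = l * (l * M)" by simp
    also have "\<dots> \<le> l * (\<bar>q\<bar> / 2)" using l by (intro mult_left_mono) auto
    finally have "v\<^sup>2 * pd T 1 0 \<phi> t x \<le> \<kappa>" by (simp add: v2 \<kappa>_def)
    moreover have "v * pd T 0 1 \<phi> t x \<ge> \<kappa>" using 2 by (simp add: v_def \<kappa>_def mult_ac)
    ultimately show ?thesis by linarith
  qed
  have "second_variation T \<phi> 0 ?h \<le> (LINT t:{0..T}|lborel. 10 * M ^ 5 - \<kappa> * n * ?I * (A t)\<^sup>2) +
      (LINT t:{0..T}|lborel. (18 * M ^ 7)\<^sup>2)"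
  proof (rule second_variation_le[OF T path h])
    fix t assume t: "t \<in> {0..T}"
    have "(- \<kappa> * n\<^sup>2 * (A t)\<^sup>2 * ?I + 2 * (n * (5 * M ^ 5))) / n = 10 * M ^ 5 - \<kappa> * n * ?I * (A t)\<^sup>2"
      using n(1) by (simp add: field_simps power2_eq_square)
    then show "x_integral (kinetic_second T \<phi> ?h) t \<le> 10 * M ^ 5 - \<kappa> * n * ?I * (A t)\<^sup>2"
      using kinetic_leading[OF hyps n(1) v t, of c \<kappa>] neg[OF t] by simp
    have "\<bar>x_integral (cocycle_first T \<phi> ?h) t\<bar> \<le> 18 * M ^ 7"
      using cocycle_first_by_parts[OF hyps n(1) v t, of c] n(1) by simp
    from power_mono[OF this, of 2]
    show "(x_integral (cocycle_first T \<phi> ?h) t)\<^sup>2 - 2 * 0 * x_integral (cocycle_second T \<phi> ?h) t \<le> (18 * M ^ 7)\<^sup>2"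
      by simp
  qed (intro continuous_intros A_cont)+
  also have "\<dots> = C - n * (\<kappa> * ?I * ?SA)"
    unfolding set_integral_const_Icc[OF T] set_integral_affine_square[OF T A_cont] C_def by algebra
  also have "\<dots> < 0"
    using n(3) \<kappa> SA I by (simp add: pos_divide_less_eq)
  finally show ?thesis
    using travelling_bump_zero[of A] A0 h by (intro bexI[of _ ?h]) auto
qed

text \<open>A form of the du Bois-Reymond lemma. The natural choice is
  \<open>\<eta>' = w - m\<close> with \<open>m\<close> the mean of \<open>w\<close>, but
  \<open>w\<close> is only assumed continuous; a polynomial close to it, shifted to mean 0, has a
  polynomial antiderivative vanishing at both ends.\<close>

lemma nonconstant_pairing:
  fixes w :: "real \<Rightarrow> real"
  assumes T: "T > 0" and w: "continuous_on {0..T} w" and nonconst: "\<not> (\<exists>m. \<forall>t\<in>{0..T}. w t = m)"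
  shows "\<exists>\<eta>. smooth_real \<eta> \<and> \<eta> 0 = 0 \<and> \<eta> T = 0 \<and> (LINT t:{0..T}|lborel. w t * deriv \<eta> t) > 0"
proof -
  let ?S = "\<lambda>f::real \<Rightarrow> real. LINT t:{0..T}|lborel. f t"
  note si = set_integrable_continuous[of T]
  define m where "m = ?S w / T"
  define v where "v = (\<lambda>t. w t - m)"
  have v: "continuous_on {0..T} v" unfolding v_def by (intro continuous_intros w)
  have Sv: "?S v = 0"
    unfolding v_def set_integral_diff(2)[OF si[OF w] si[OF continuous_on_const]] set_integral_const_Icc[OF T]
    using T by (simp add: m_def)
  obtain s where s: "s \<in> {0..T}" "v s \<noteq> 0"
  proof -
    from nonconst have "\<not> (\<forall>t\<in>{0..T}. w t = m)" by blast
    then show ?thesis using that by (auto simp: v_def)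
  qed
  have V2: "?S (\<lambda>t. (v t)\<^sup>2) > 0" (is "?V > 0")
    by (rule set_integral_pos_continuous[of _ _ _ s]) (use s T in \<open>auto intro!: continuous_intros v\<close>)
  have "bounded (v ` {0..T})" by (intro compact_imp_bounded compact_continuous_image v compact_Icc)
  then obtain B0 where "\<forall>t\<in>{0..T}. \<bar>v t\<bar> \<le> B0" by (auto simp: bounded_iff)
  then obtain B where B: "B > 0" "\<forall>t\<in>{0..T}. \<bar>v t\<bar> \<le> B"
    by (meson le_max_iff_disj less_max_iff_disj zero_less_one)
  \<comment> \<open>Replacing one factor of \<open>v^2\<close> by the polynomial changes the
    integral by at most \<open>B * e * T\<close>, which is then half of \<open>?V\<close>.\<close>
  define e where "e = ?V / (2 * B * T)"
  have e: "e > 0" using V2 B T by (simp add: e_def)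
  obtain p where p: "real_polynomial_function p" "\<And>t. t \<in> {0..T} \<Longrightarrow> \<bar>v t - p t\<bar> < e"
    using Stone_Weierstrass_real_polynomial_function[OF compact_Icc v e] by blast
  define k where "k = ?S p / T"
  define p0 where "p0 = (\<lambda>t. p t - k)"
  have "real_polynomial_function p0"
    unfolding p0_def by (intro real_polynomial_function_diff p(1)) (auto intro: real_polynomial_function.intros)
  then obtain a n where a: "p0 = (\<lambda>t. \<Sum>i\<le>n. a i * t ^ i)"
    unfolding real_polynomial_function_iff_sum by blast
  \<comment> \<open>Coefficients of the antiderivative of \<open>p0\<close> that is 0 at 0.\<close>
  define b where "b i = (case i of 0 \<Rightarrow> 0 | Suc k \<Rightarrow> a k / real (Suc k))" for i
  define \<eta> where "\<eta> = (\<lambda>t. \<Sum>i\<le>Suc n. b i * t ^ i)"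
  have \<eta>: "smooth_real \<eta>" unfolding \<eta>_def by (rule smooth_real_poly)
  have \<eta>_eq: "\<eta> = (\<lambda>t. \<Sum>i\<le>n. a i / real (Suc i) * t ^ Suc i)"
    unfolding \<eta>_def sum.atMost_Suc_shift by (simp add: b_def)
  have D: "(\<eta> has_real_derivative p0 t) (at t)" for t
    unfolding \<eta>_eq a by (auto intro!: derivative_eq_intros sum.cong simp del: of_nat_Suc power_Suc)
  have p_cont: "continuous_on A p" for A
    by (rule continuous_real_polymonial_function[OF p(1), THEN continuous_at_imp_continuous_on[OF ballI]])
  have p0_cont: "continuous_on A p0" for A unfolding p0_def by (intro continuous_intros p_cont)
  have Sp0: "?S p0 = 0"
    unfolding p0_def set_integral_diff(2)[OF si[OF p_cont] si[OF continuous_on_const]] set_integral_const_Icc[OF T]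
    using T by (simp add: k_def)
  have "?S p0 = \<eta> T - \<eta> 0"
    unfolding set_lebesgue_integral_def
    using D T p0_cont by (intro integral_FTC_atLeastAtMost)
      (auto simp: has_real_derivative_iff_has_vector_derivative has_vector_derivative_at_within)
  moreover have "\<eta> 0 = 0" by (simp add: \<eta>_eq)
  ultimately have ends: "\<eta> 0 = 0" "\<eta> T = 0" using Sp0 by auto
  have deriv: "deriv \<eta> = p0" using D by (auto intro!: ext DERIV_imp_deriv)
  \<comment> \<open>The constants \<open>m\<close> and \<open>k\<close> drop out because
    \<open>v\<close> and \<open>p0\<close> both have mean 0.\<close>
  have "?S (\<lambda>t. w t * p0 t) = ?S (\<lambda>t. v t * p t - k * v t + m * p0 t)"
    by (rule set_lebesgue_integral_cong) (auto simp: v_def p0_def algebra_simps)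
  also have "\<dots> = ?S (\<lambda>t. v t * p t) - k * ?S v + m * ?S p0"
  proof -
    have i: "set_integrable lborel {0..T} (\<lambda>t. v t * p t)" "set_integrable lborel {0..T} (\<lambda>t. k * v t)"
      "set_integrable lborel {0..T} (\<lambda>t. m * p0 t)"
      by (intro si continuous_intros v p_cont p0_cont)+
    show ?thesis
      unfolding set_integral_add(2)[OF set_integral_diff(1)[OF i(1,2)] i(3)] set_integral_diff(2)[OF i(1,2)]
        set_integral_mult_right ..
  qed
  also have "\<dots> = ?S (\<lambda>t. v t * p t)" by (simp add: Sv Sp0)
  finally have eq: "?S (\<lambda>t. w t * p0 t) = ?S (\<lambda>t. v t * p t)" .
  have "?S (\<lambda>t. (v t)\<^sup>2 - B * e) \<le> ?S (\<lambda>t. v t * p t)"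
  proof (rule set_integral_mono)
    fix t assume t: "t \<in> {0..T}"
    have "\<bar>v t * (v t - p t)\<bar> \<le> B * e"
      using B p(2)[OF t] t by (intro abs_mult_le) auto
    then show "(v t)\<^sup>2 - B * e \<le> v t * p t" by (simp add: abs_le_iff algebra_simps power2_eq_square)
  qed (intro si continuous_intros v p_cont)+
  moreover have "?S (\<lambda>t. (v t)\<^sup>2 - B * e) = ?V - B * e * T"
  proof -
    have "set_integrable lborel {0..T} (\<lambda>t. (v t)\<^sup>2)" by (intro si continuous_intros v)
    from set_integral_diff(2)[OF this si[OF continuous_on_const]] show ?thesis
      by (simp add: set_integral_const_Icc[OF T])
  qed
  moreover have "B * e * T = ?V / 2" using B T by (simp add: e_def)
  ultimately have "?S (\<lambda>t. w t * p0 t) > 0" using V2 eq by simp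
  then show ?thesis using \<eta> ends deriv by blast
qed

lemma zero_dt_imp_constant:
  assumes "\<And>t. t \<in> {0..T} \<Longrightarrow> (f has_vector_derivative 0) (at t within {0..T})" "t \<in> {0..T}"
  shows "f t = f 0"
proof -
  obtain c where "\<And>t. t \<in> {0..T} \<Longrightarrow> f t = c"
    using has_vector_derivative_zero_constant[OF convex_real_interval(5) assms(1)] by blast
  then show ?thesis using assms(2) by auto
qed

text \<open>With \<open>\<phi>\<close> fixed the energy is exactly quadratic in \<open>s\<close>,
  with linear coefficient \<open>2 * a > 0\<close>; a small negative step therefore decreases
  it.\<close>

lemma energy_decrease_center:
  assumes T: "T > 0" and path: "Virasoro_Bott_path T \<phi> \<alpha>"
    and \<eta>: "smooth_real \<eta>"
    and pos: "(LINT t:{0..T}|lborel. (dt T \<alpha> t - x_integral (cocycle_density T \<phi>) t) * deriv \<eta> t) > 0"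
    and P: "\<forall>\<^sub>F s in nhds 0. P s"
  shows "\<exists>s. P s \<and> energy T \<phi> (\<lambda>t. \<alpha> t + s * \<eta> t) < energy T \<phi> \<alpha>"
proof -
  let ?S = "\<lambda>f::real \<Rightarrow> real. LINT t:{0..T}|lborel. f t"
  let ?w = "\<lambda>t. dt T \<alpha> t - x_integral (cocycle_density T \<phi>) t"
  note si = set_integrable_continuous[of T]
  have \<alpha>: "\<alpha> \<in> smooth_Icc T" using path by (simp add: Virasoro_Bott_path_def)
  have w: "continuous_on {0..T} ?w"
    using smooth_Icc_continuous[OF \<alpha>, of 1]
    by (intro continuous_on_diff x_integral_continuous cocycle_density_decaying[OF T path]) simp
  have \<eta>': "continuous_on {0..T} (deriv \<eta>)" using smooth_real_continuous[OF \<eta>, of _ 1] by simp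
  define a where "a = ?S (\<lambda>t. ?w t * deriv \<eta> t)"
  define b where "b = ?S (\<lambda>t. (deriv \<eta> t)\<^sup>2)"
  have a: "a > 0" using pos by (simp add: a_def)
  have b: "b \<ge> 0" unfolding b_def set_lebesgue_integral_def by (intro integral_nonneg_AE) auto
  have expand: "energy T \<phi> (\<lambda>t. \<alpha> t + s * \<eta> t) = energy T \<phi> \<alpha> + (2 * s * a + s\<^sup>2 * b)" for s
  proof -
    have "?S (\<lambda>t. (dt T (\<lambda>t. \<alpha> t + s * \<eta> t) t - x_integral (cocycle_density T \<phi>) t)\<^sup>2) =
        ?S (\<lambda>t. (?w t)\<^sup>2 + (2 * s) * (?w t * deriv \<eta> t) + s\<^sup>2 * (deriv \<eta> t)\<^sup>2)"
    proof (rule set_lebesgue_integral_cong, simp, intro allI impI)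
      fix t assume t: "t \<in> {0..T}"
      have "dt T (\<lambda>t. \<alpha> t + s * \<eta> t) t = dt T \<alpha> t + s * deriv \<eta> t"
        using dt_add_scaled[OF T \<alpha> smooth_real_in_smooth_Icc(1)[OF T \<eta>] t, of 1 s]
          smooth_real_in_smooth_Icc(2)[OF T \<eta> t] by simp
      then show "(dt T (\<lambda>t. \<alpha> t + s * \<eta> t) t - x_integral (cocycle_density T \<phi>) t)\<^sup>2 =
          (?w t)\<^sup>2 + (2 * s) * (?w t * deriv \<eta> t) + s\<^sup>2 * (deriv \<eta> t)\<^sup>2"
        by (simp add: algebra_simps power2_eq_square)
    qed
    also have "\<dots> = ?S (\<lambda>t. (?w t)\<^sup>2) + (2 * s) * a + s\<^sup>2 * b"
    proof -
      have i: "set_integrable lborel {0..T} (\<lambda>t. (?w t)\<^sup>2)"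
        "set_integrable lborel {0..T} (\<lambda>t. (2 * s) * (?w t * deriv \<eta> t))"
        "set_integrable lborel {0..T} (\<lambda>t. s\<^sup>2 * (deriv \<eta> t)\<^sup>2)"
        by (intro si continuous_on_power continuous_on_mult continuous_on_const w \<eta>')+
      show ?thesis
        unfolding a_def b_def set_integral_add(2)[OF set_integral_add(1)[OF i(1,2)] i(3)] set_integral_add(2)[OF i(1,2)]
          set_integral_mult_right ..
    qed
    finally show ?thesis by (simp add: energy_eq)
  qed
  obtain d where d: "d > 0" "\<And>s. \<bar>s\<bar> < d \<Longrightarrow> P s"
    using P by (auto simp: eventually_nhds_metric dist_real_def)
  \<comment> \<open>The second entry gives \<open>\<sigma> * b < 2 * a\<close>, so the linear term
    outweighs the quadratic one; \<open>b + 1\<close> covers the case \<open>b = 0\<close>.\<close>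
  define \<sigma> where "\<sigma> = min (d / 2) (a / (b + 1))"
  have \<sigma>: "\<sigma> > 0" "\<sigma> \<le> d / 2" "\<sigma> \<le> a / (b + 1)"
  proof -
    show "\<sigma> > 0" using d(1) a b by (simp add: \<sigma>_def)
    show "\<sigma> \<le> d / 2" "\<sigma> \<le> a / (b + 1)" unfolding \<sigma>_def by linarith+
  qed
  have "\<sigma> * (b + 1) \<le> a" using \<sigma>(3) b by (simp add: pos_le_divide_eq)
  then have "\<sigma> * b < 2 * a" using \<sigma>(1) a by (simp add: algebra_simps)
  then have "\<sigma> * (\<sigma> * b - 2 * a) < 0" using \<sigma>(1) by (intro mult_pos_neg) auto
  then have "2 * (- \<sigma>) * a + (- \<sigma>)\<^sup>2 * b < 0" by (simp add: algebra_simps power2_eq_square)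
  moreover have "P (- \<sigma>)" using d \<sigma> by simp
  ultimately show ?thesis using expand[of "- \<sigma>"] by (intro exI[of _ "- \<sigma>"]) simp
qed

theorem theorem3p2:
  fixes T :: real
    and \<phi> :: "real \<Rightarrow> real \<Rightarrow> real"
    and \<alpha> :: "real \<Rightarrow> real"
    and U :: "((real \<Rightarrow> real \<Rightarrow> real) \<times> (real \<Rightarrow> real)) set"
  assumes "T > 0"
    and "Virasoro_Bott_path T \<phi> \<alpha>"
    and nonconstant: "\<not> (\<forall>t\<in>{0..T}. \<phi> t = \<phi> 0 \<and> \<alpha> t = \<alpha> 0)"
    and neighbourhood: "\<exists>V. openin (path_topology T) V \<and> path_coords \<phi> \<alpha> \<in> V \<and> V \<subseteq> U"
  shows "\<exists>\<psi> \<beta>. Virasoro_Bott_path T \<psi> \<beta> \<and> path_coords \<psi> \<beta> \<in> U \<and>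
           \<psi> 0 = \<phi> 0 \<and> \<psi> T = \<phi> T \<and> \<beta> 0 = \<alpha> 0 \<and> \<beta> T = \<alpha> T \<and>
           energy T \<psi> \<beta> < energy T \<phi> \<alpha>"
proof -
  note T = assms(1) and path = assms(2)
  obtain V where V: "openin (path_topology T) V" "path_coords \<phi> \<alpha> \<in> V" "V \<subseteq> U"
    using neighbourhood by blast
  have f: "(\<lambda>t x. \<phi> t x - x) \<in> Schwartz_strip T" and \<alpha>: "\<alpha> \<in> smooth_Icc T" and s: "smooth_strip T \<phi>"
    using path by (auto simp: Virasoro_Bott_path_def)
  have zero_smooth: "(\<lambda>t. 0) \<in> smooth_Icc T"
    using smooth_Icc_add_scaled[OF T \<alpha> \<alpha>, of "-1"] by simp
  have zero_Schwartz: "(\<lambda>t x. 0) \<in> Schwartz_strip T"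
    using Schwartz_strip_add_scaled[OF T f f, of "-1"] by simp
  have line: "\<forall>\<^sub>F s in nhds 0. Virasoro_Bott_path T (\<lambda>t x. \<phi> t x + s * h t x) (\<lambda>t. \<alpha> t + s * \<eta> t) \<and>
      path_coords (\<lambda>t x. \<phi> t x + s * h t x) (\<lambda>t. \<alpha> t + s * \<eta> t) \<in> U"
    if "h \<in> Schwartz_strip T" "\<eta> \<in> smooth_Icc T" for h \<eta>
    using path_topology_line[OF T V(1) _ f \<alpha> that] perturbed_path[OF T path that] V(2,3)
    by (auto simp: path_coords_def diff_add_eq elim: eventually_elim2)
  let ?w = "\<lambda>t. dt T \<alpha> t - x_integral (cocycle_density T \<phi>) t"
  have w: "continuous_on {0..T} ?w"
    using smooth_Icc_continuous[OF \<alpha>, of 1]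
    by (intro continuous_on_diff x_integral_continuous cocycle_density_decaying[OF T path]) simp
  \<comment> \<open>Since \<open>h\<close> vanishes at both end times and \<open>\<alpha>\<close> is
    unchanged, the endpoints are kept for every value of \<open>s\<close>, whichever sign is
    needed.\<close>
  have variation: ?thesis
    if h: "h \<in> Schwartz_strip T" "h 0 = (\<lambda>x. 0)" "h T = (\<lambda>x. 0)" "second_variation T \<phi> m h < 0"
      and m: "\<And>t. t \<in> {0..T} \<Longrightarrow> ?w t = m" for h m
  proof -
    obtain s where "Virasoro_Bott_path T (\<lambda>t x. \<phi> t x + s * h t x) \<alpha>"
      "path_coords (\<lambda>t x. \<phi> t x + s * h t x) \<alpha> \<in> U"
      "energy T (\<lambda>t x. \<phi> t x + s * h t x) \<alpha> < energy T \<phi> \<alpha>"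
      using energy_decrease[OF T path h(1) m h(4)
          line[OF h(1) zero_smooth, simplified]] by auto
    then show ?thesis
      using h(2,3) by (intro exI[of _ "\<lambda>t x. \<phi> t x + s * h t x"] exI[of _ \<alpha>]) simp
  qed
  show ?thesis
  proof (cases "\<exists>m. \<forall>t\<in>{0..T}. ?w t = m")
    case False
    then obtain \<eta> where \<eta>: "smooth_real \<eta>" "\<eta> 0 = 0" "\<eta> T = 0"
      "(LINT t:{0..T}|lborel. ?w t * deriv \<eta> t) > 0"
      using nonconstant_pairing[OF T w] by blast
    obtain s where "Virasoro_Bott_path T \<phi> (\<lambda>t. \<alpha> t + s * \<eta> t)"
      "path_coords \<phi> (\<lambda>t. \<alpha> t + s * \<eta> t) \<in> U"
      "energy T \<phi> (\<lambda>t. \<alpha> t + s * \<eta> t) < energy T \<phi> \<alpha>"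
      using energy_decrease_center[OF T path \<eta>(1,4)
          line[OF zero_Schwartz smooth_real_in_smooth_Icc(1)[OF T \<eta>(1)], simplified]] by auto
    then show ?thesis
      using \<eta>(2,3) by (intro exI[of _ \<phi>] exI[of _ "\<lambda>t. \<alpha> t + s * \<eta> t"]) simp
  next
    case True
    then obtain m where m: "\<And>t. t \<in> {0..T} \<Longrightarrow> ?w t = m" by blast
    show ?thesis
    proof (cases "m = 0")
      case False
      then show ?thesis
        using negative_variation_momentum[OF T path False] variation[OF _ _ _ _ m] by blast
    next
      case m0: True
      show ?thesis
      proof (cases "\<exists>t\<in>{0..T}. \<exists>x. pd T 0 1 \<phi> t x \<noteq> 0")
        case True
        then show ?thesis
          using negative_variation_velocity[OF T path] variation[OF _ _ _ _ m] m0 by blast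
      next
        \<comment> \<open>Nothing moves: \<open>\<phi>\<close> is constant in time, hence
          \<open>\<phi>_tx = 0\<close> and the cocycle integral vanishes, so that
          \<open>w = 0\<close> reduces to \<open>\<alpha>_t = 0\<close>. This contradicts
          \<open>nonconstant\<close>.\<close>
        case False
        then have \<phi>t: "pd T 0 1 \<phi> t = (\<lambda>x. 0)" if "t \<in> {0..T}" for t using that by auto
        have "\<phi> t x = \<phi> 0 x" if "t \<in> {0..T}" for t x
        proof (rule zero_dt_imp_constant[OF _ that, of "\<lambda>t. \<phi> t x"])
          fix t assume t: "t \<in> {0..T}"
          show "((\<lambda>t. \<phi> t x) has_vector_derivative 0) (at t within {0..T})"
            using smooth_strip_has_derivative_t[OF s t, of 0 x] \<phi>t[OF t] by (simp add: pd_def)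
        qed
        moreover have "\<alpha> t = \<alpha> 0" if "t \<in> {0..T}" for t
        proof (rule zero_dt_imp_constant[OF _ that])
          fix t assume t: "t \<in> {0..T}"
          have "pd T 1 1 \<phi> t x = 0" for x
            using pd_Suc[of T 0 1 \<phi> t x] \<phi>t[OF t] by simp
          then have "x_integral (cocycle_density T \<phi>) t = 0"
            unfolding x_integral_def cocycle_density_def by (simp del: One_nat_def)
          then show "(\<alpha> has_vector_derivative 0) (at t within {0..T})"
            using smooth_Icc_has_derivative[OF \<alpha> t, of 0] m[OF t] m0 by simp
        qed
        ultimately show ?thesis using nonconstant by blast
      qed
    qed
  qed
qed

end
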